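(* Let $0<\alpha<1$, $A>0$, and let $z\in\mathcal{P}_\alpha$, where $\mathcal{P}_\alpha=\{(x,y)\in\mathbb{R}\times\mathbb{R}: x>0,\ |y|<Ax^\alpha\}$ is the parabola-shaped domain in the plane. Then the exit position $B_{\tau_\alpha}$ satisfies $$\lim_{t\to\infty} t^{\alpha-1}\log\big[P_z\{|B_{\tau_\alpha}|>t\}\big]=-\frac{\pi}{2A(1-\alpha)}.$$ Furthermore, $$E_z\big[\exp\big(b\,|B_{\tau_\alpha}|^{1-\alpha}\big)\big]<\infty\quad\text{if and only if}\quad b<\frac{\pi}{2A(1-\alpha)}.$$ Moreover, for $a>0$: if $a<1-\alpha$ then $E_z[\exp(b\,|B_{\tau_\alpha}|^a)]<\infty$ for each positive $b$, and if $a>1-\alpha$ then $E_z[\exp(b\,|B_{\tau_\alpha}|^a)]=\infty$ for every positive $b$.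
   Context: $\{B_t:t\ge 0\}$ is two-dimensional Brownian motion; $P_z$ and $E_z$ are the probability and expectation associated with this motion started at $z$. $\tau_\alpha=\inf\{t>0: B_t\notin\mathcal{P}_\alpha\}$ is the exit time from $\mathcal{P}_\alpha$ and $B_{\tau_\alpha}$ is the exit position. *)

theory Defs
  imports "HOL-Probability.Probability"
begin

definition parabola_domain :: "real \<Rightarrow> real \<Rightarrow> (real \<times> real) set" where
  "parabola_domain A \<alpha> = {(x, y). x > 0 \<and> \<bar>y\<bar> < A * x powr \<alpha>}"

text \<open>
  The probability measure \<open>M\<close> plays the role of \<open>P\<^sub>z\<close>. Only times \<open>t \<ge> 0\<close> matter. The process is
  standard: the increment over \<open>[s, t]\<close> has covariance matrix \<open>(t - s)\<close> times the identity,
  i.e. \<^const>\<open>normal_density\<close> gets the standard deviation \<open>sqrt (t - s)\<close>. All paths are required to be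
  continuous, as on path space, which makes the exit time and exit position measurable without
  completing \<open>M\<close>.
\<close>

locale planar_brownian_motion = prob_space M
  for M :: "'w measure" +
  fixes B :: "real \<Rightarrow> 'w \<Rightarrow> real \<times> real"
    and z :: "real \<times> real"
  assumes measurable_B: "\<And>t. 0 \<le> t \<Longrightarrow> B t \<in> borel_measurable M"
    and start: "AE \<omega> in M. B 0 \<omega> = z"
    and continuous_paths: "\<And>\<omega>. \<omega> \<in> space M \<Longrightarrow> continuous_on {0..} (\<lambda>t. B t \<omega>)"
    and indep_increments:
      "\<And>(t :: nat \<Rightarrow> real) n. 0 \<le> t 0 \<Longrightarrow> (\<And>i. i < n \<Longrightarrow> t i < t (Suc i)) \<Longrightarrow>
        indep_vars (\<lambda>_. borel) (\<lambda>i \<omega>. B (t (Suc i)) \<omega> - B (t i) \<omega>) {..<n}"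
    and gaussian_increments:
      "\<And>s t. 0 \<le> s \<Longrightarrow> s < t \<Longrightarrow>
        distributed M lborel (\<lambda>\<omega>. B t \<omega> - B s \<omega>)
          (\<lambda>(x, y). ennreal (normal_density 0 (sqrt (t - s)) x * normal_density 0 (sqrt (t - s)) y))"

definition exit_time :: "(real \<Rightarrow> 'w \<Rightarrow> 'e) \<Rightarrow> 'e set \<Rightarrow> 'w \<Rightarrow> ereal" where
  "exit_time B D \<omega> = (INF t\<in>{t. t > 0 \<and> B t \<omega> \<notin> D}. ereal t)"

text \<open>
  The exit time is \<open>\<infinity>\<close> on paths that never leave \<open>D\<close>; there the exit position gets the dummy value
  \<open>0\<close>. For planar Brownian motion in a parabola-shaped domain this is a null event.
\<close>

definition exit_position :: "(real \<Rightarrow> 'w \<Rightarrow> 'e::zero) \<Rightarrow> 'e set \<Rightarrow> 'w \<Rightarrow> 'e" where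
  "exit_position B D \<omega> =
    (if exit_time B D \<omega> < \<infinity> then B (real_of_ereal (exit_time B D \<omega>)) \<omega> else 0)"

end

theory Submission
  imports Defs "HOL-Complex_Analysis.Complex_Analysis"
begin

text \<open>
  Everything reduces to two tail bounds with the constant \<open>b = pi / (2 A p)\<close>, where \<open>p = 1 - \<alpha>\<close>:
  \<open>P(|X|^p > u) \<le> C exp (- \<kappa> u)\<close> for each \<open>\<kappa> < b\<close>, and the sharp
  \<open>P(|X| > t) \<ge> c exp (- b t^p)\<close>, which also decides the critical exponent.

  Both come from one principle: if \<open>F\<close> satisfies the sub-mean value property for small Gaussian steps
  up to an error of smaller order than the time step, and \<open>F \<le> C\<close> on a closed set \<open>V\<close> and \<open>F \<le> 0\<close>
  off it, then \<open>F z \<le> C P(exit position \<in> V)\<close>. The property is stable under maxima, so \<open>F\<close> may be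
  glued from real parts of holomorphic functions. No stochastic calculus and no conformal map of the
  domain is used: the function \<open>\<zeta>^p\<close> maps the parabola almost onto a strip. For the upper bound,
  \<open>Re exp (\<kappa> (\<zeta> + 1)^p)\<close> is positive and harmonic on a neighbourhood of the domain. For the lower bound,
  \<open>Re exp (b \<zeta>^p - \<zeta>^(- p / 2))\<close> is negative on the sides and is continued beyond distance \<open>t\<close>
  by a function that is positive there.
\<close>

section \<open>Planar Gaussian steps\<close>

text \<open>The strong Markov property is avoided: the process is followed on a deterministic time
  grid. Mesh h up to time T means T / h steps, so the error per step has to be of smaller order than
  h; cancellation of the Taylor terms below order four gives h^2.

  Origin of the constant: on the side y = A x^\<alpha> the imaginary part of
  \<open>\<zeta>^p\<close> is p y x^(p - 1) = p A to leading order. The image is thus nearly a strip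
  of half-width p A, and the real part of exp (b \<zeta>) vanishes on the edges of that strip when b
  p A = pi / 2.

  The two bounds differ in strength by design. Below, no loss is affordable: divergence at the
  critical exponent needs the exact rate up to a constant factor. There the error in the strip
  approximation must not make the function positive on the sides, which is why the exponent carries
  a correction.\<close>

definition planar_gauss :: "real \<Rightarrow> (real \<times> real) measure" where
  "planar_gauss h = density lborel
     (\<lambda>(x, y). ennreal (normal_density 0 (sqrt h) x * normal_density 0 (sqrt h) y))"

lemma sets_planar_gauss [simp, measurable_cong]: "sets (planar_gauss h) = sets borel"
  and space_planar_gauss [simp]: "space (planar_gauss h) = UNIV"
  by (simp_all add: planar_gauss_def)

abbreviation gauss :: "real \<Rightarrow> real measure" where
  "gauss h \<equiv> density lborel (\<lambda>x. ennreal (normal_density 0 (sqrt h) x))"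

lemma fst_borel_measurable [measurable]: "fst \<in> borel_measurable (borel :: (real \<times> real) measure)"
  and snd_borel_measurable [measurable]: "snd \<in> borel_measurable (borel :: (real \<times> real) measure)"
  by (intro borel_measurable_continuous_onI continuous_intros)+

lemma planar_gauss_eq_pair:
  assumes "h > 0"
  shows "planar_gauss h = gauss h \<Otimes>\<^sub>M gauss h"
proof -
  interpret N: prob_space "gauss h"
    using assms by (intro prob_space_normal_density) (rule real_sqrt_gt_zero)
  have "gauss h \<Otimes>\<^sub>M gauss h = density (lborel \<Otimes>\<^sub>M lborel)
      (\<lambda>(x, y). ennreal (normal_density 0 (sqrt h) x) * ennreal (normal_density 0 (sqrt h) y))"
    by (intro pair_measure_density) (auto intro: lborel.sigma_finite_measure_axioms N.sigma_finite_measure_axioms)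
  also have "\<dots> = planar_gauss h"
    unfolding planar_gauss_def lborel_prod
    by (intro arg_cong2[where f=density]) (auto simp: fun_eq_iff ennreal_mult)
  finally show ?thesis ..
qed

lemma prob_space_planar_gauss: "h > 0 \<Longrightarrow> prob_space (planar_gauss h)"
proof -
  assume h: "h > 0"
  interpret N: prob_space "gauss h"
    using h by (intro prob_space_normal_density) (rule real_sqrt_gt_zero)
  interpret pair_prob_space "gauss h" "gauss h" ..
  show ?thesis unfolding planar_gauss_eq_pair[OF h] by unfold_locales
qed

lemma gauss_uminus:
  assumes "h > 0"
  shows "distr (gauss h) (gauss h) uminus = gauss h"
proof (rule measure_eqI)
  fix A assume "A \<in> sets (distr (gauss h) (gauss h) uminus)"
  then have [measurable]: "A \<in> sets borel" by simp
  have "emeasure (distr (gauss h) (gauss h) uminus) A = emeasure (gauss h) (uminus -` A)"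
    by (subst emeasure_distr) (auto intro!: arg_cong2[where f=emeasure])
  also have "\<dots> = (\<integral>\<^sup>+x. ennreal (normal_density 0 (sqrt h) x) * indicator (uminus -` A) x \<partial>lborel)"
    using measurable_sets[of uminus "borel :: real measure" borel A]
    by (subst emeasure_density) auto
  also have "\<dots> = (\<integral>\<^sup>+x. ennreal (normal_density 0 (sqrt h) (- x)) * indicator A (- x) \<partial>lborel)"
    by (intro nn_integral_cong) (auto simp: normal_density_def indicator_def)
  also have "\<dots> = (\<integral>\<^sup>+x. ennreal (normal_density 0 (sqrt h) x) * indicator A x \<partial>distr lborel borel uminus)"
    by (subst nn_integral_distr) auto
  also have "\<dots> = emeasure (gauss h) A"
    by (simp add: lborel_distr_uminus emeasure_density)
  finally show "emeasure (distr (gauss h) (gauss h) uminus) A = emeasure (gauss h) A" .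
qed simp

text \<open>Multiplication by the imaginary unit in real coordinates. Invariance of the Gaussian law
  under this quarter turn is the only rotation invariance that enters.\<close>

definition rot :: "real \<times> real \<Rightarrow> real \<times> real" where
  "rot = (\<lambda>(x, y). (- y, x))"

lemma rot_measurable [measurable]: "rot \<in> borel_measurable borel"
  unfolding rot_def by (intro borel_measurable_continuous_onI) (auto intro!: continuous_intros simp: case_prod_beta)

text \<open>A quarter turn is a swap of the coordinates followed by a sign change of the first one.
  The product form of the law gives invariance under the swap, the symmetry of the one-dimensional
  law that under the sign change.\<close>

lemma planar_gauss_rot:
  assumes h: "h > 0"
  shows "distr (planar_gauss h) borel rot = planar_gauss h"
proof -
  interpret N: prob_space "gauss h"
    using h by (intro prob_space_normal_density) (rule real_sqrt_gt_zero)
  interpret pair_prob_space "gauss h" "gauss h" ..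
  let ?P = "gauss h \<Otimes>\<^sub>M gauss h"
  have neg: "distr ?P ?P (\<lambda>(x, y). (- x, y)) = ?P"
  proof -
    have "distr (gauss h) (gauss h) uminus \<Otimes>\<^sub>M distr (gauss h) (gauss h) (\<lambda>x. x)
        = distr ?P ?P (\<lambda>(x, y). (- x, y))"
      by (rule pair_measure_distr) (auto simp: distr_id N.sigma_finite_measure_axioms)
    then show ?thesis
      unfolding gauss_uminus[OF h] distr_id by (rule sym)
  qed
  have swap: "distr ?P ?P (\<lambda>(x, y). (y, x)) = ?P"
    by (rule distr_pair_swap[symmetric])
  have "distr ?P borel rot = distr ?P ?P ((\<lambda>(x, y). (- x, y)) \<circ> (\<lambda>(x, y). (y, x)))"
    using sets_planar_gauss[of h]
    by (intro distr_cong) (simp_all only: rot_def case_prod_beta comp_def planar_gauss_eq_pair[OF h] fst_conv snd_conv)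
  also have "\<dots> = distr (distr ?P ?P (\<lambda>(x, y). (y, x))) ?P (\<lambda>(x, y). (- x, y))"
    by (rule distr_distr[symmetric]) auto
  also have "\<dots> = ?P"
    unfolding swap neg ..
  finally show ?thesis
    unfolding planar_gauss_eq_pair[OF h] .
qed

lemma integral_planar_gauss_rot:
  fixes F :: "real \<times> real \<Rightarrow> real"
  assumes h: "h > 0" and [measurable]: "F \<in> borel_measurable borel"
  shows "(\<integral>w. F (rot w) \<partial>planar_gauss h) = (\<integral>w. F w \<partial>planar_gauss h)"
proof -
  have "(\<integral>w. F w \<partial>planar_gauss h) = (\<integral>w. F w \<partial>distr (planar_gauss h) borel rot)"
    by (simp add: planar_gauss_rot[OF h])
  also have "\<dots> = (\<integral>w. F (rot w) \<partial>planar_gauss h)"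
    by (rule integral_distr) auto
  finally show ?thesis ..
qed

lemma norm_pow4_le: "norm (a :: real, b :: real) ^ 4 \<le> 2 * a ^ 4 + 2 * b ^ 4"
proof -
  have "norm (a, b) ^ 4 = (a\<^sup>2 + b\<^sup>2)\<^sup>2"
    by (simp add: norm_Pair power2_eq_square power4_eq_xxxx)
  also have "\<dots> \<le> 2 * (a\<^sup>2)\<^sup>2 + 2 * (b\<^sup>2)\<^sup>2"
    using sum_squares_bound[of "a\<^sup>2" "b\<^sup>2"] by (simp add: power2_sum)
  finally show ?thesis by simp
qed

text \<open>The constant is 2 * 3 + 2 * 3: each coordinate has fourth moment 3 h^2, and
  \<open>norm_pow4_le\<close> avoids the mixed moment. Only the order h^2 matters later.\<close>

lemma planar_gauss_fourth_moment:
  assumes h: "h > 0"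
  shows "(\<integral>\<^sup>+w. ennreal (norm w ^ 4) \<partial>planar_gauss h) \<le> ennreal (12 * h\<^sup>2)"
proof -
  interpret N: prob_space "gauss h"
    using h by (intro prob_space_normal_density) (rule real_sqrt_gt_zero)
  interpret pair_prob_space "gauss h" "gauss h" ..
  have m4: "(\<integral>\<^sup>+x. ennreal (x ^ 4) \<partial>gauss h) = ennreal (3 * h\<^sup>2)"
  proof -
    have "has_bochner_integral lborel (\<lambda>x. normal_density 0 (sqrt h) x * (x - 0) ^ (2 * 2)) (fact (2 * 2) / ((2 / (sqrt h)\<^sup>2)^2 * fact 2))"
      using h by (intro normal_moment_even) (rule real_sqrt_gt_zero)
    moreover have "fact (2 * 2) / ((2 / (sqrt h)\<^sup>2)^2 * fact 2) = 3 * h\<^sup>2"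
      using h by (simp add: fact_numeral field_simps power2_eq_square)
    ultimately have "has_bochner_integral lborel (\<lambda>x. normal_density 0 (sqrt h) x * x ^ 4) (3 * h\<^sup>2)"
      by simp
    then have "(\<integral>\<^sup>+x. ennreal (normal_density 0 (sqrt h) x * x ^ 4) \<partial>lborel) = ennreal (3 * h\<^sup>2)"
      using h
      by (subst nn_integral_eq_integral)
         (auto simp: has_bochner_integral_iff normal_density_def)
    then show ?thesis
      by (subst nn_integral_density) (auto simp: ennreal_mult)
  qed
  have "(\<integral>\<^sup>+w. ennreal (norm w ^ 4) \<partial>planar_gauss h)
      \<le> (\<integral>\<^sup>+w. 2 * ennreal (fst w ^ 4) + 2 * ennreal (snd w ^ 4) \<partial>planar_gauss h)"
    using norm_pow4_le
    by (intro nn_integral_mono)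
       (auto simp: ennreal_mult[symmetric] ennreal_plus[symmetric] ennreal_numeral[symmetric]
             simp del: ennreal_plus ennreal_numeral intro!: ennreal_leI)
  also have "\<dots> = 2 * (\<integral>\<^sup>+w. ennreal (fst w ^ 4) \<partial>planar_gauss h) + 2 * (\<integral>\<^sup>+w. ennreal (snd w ^ 4) \<partial>planar_gauss h)"
    by (subst nn_integral_add) (auto simp: nn_integral_cmult)
  also have "(\<integral>\<^sup>+w. ennreal (fst w ^ 4) \<partial>planar_gauss h) = ennreal (3 * h\<^sup>2)"
    unfolding planar_gauss_eq_pair[OF h]
    by (subst N.nn_integral_fst[symmetric]) (auto simp: N.emeasure_space_1[simplified] m4)
  also have "(\<integral>\<^sup>+w. ennreal (snd w ^ 4) \<partial>planar_gauss h) = ennreal (3 * h\<^sup>2)"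
    unfolding planar_gauss_eq_pair[OF h]
    by (subst N.nn_integral_fst[symmetric]) (auto simp: N.emeasure_space_1[simplified] m4)
  also have "2 * ennreal (3 * h\<^sup>2) + 2 * ennreal (3 * h\<^sup>2) = ennreal (12 * h\<^sup>2)"
    by (simp add: ennreal_mult[symmetric] ennreal_plus[symmetric] ennreal_numeral[symmetric] del: ennreal_plus ennreal_numeral)
  finally show ?thesis .
qed

lemma integrable_planar_gauss_fourth:
  assumes h: "h > 0"
  shows "integrable (planar_gauss h) (\<lambda>w. norm w ^ 4)"
    and "(\<integral>w. norm w ^ 4 \<partial>planar_gauss h) \<le> 12 * h\<^sup>2"
proof -
  show i: "integrable (planar_gauss h) (\<lambda>w. norm w ^ 4)"
    using planar_gauss_fourth_moment[OF h]
    by (intro integrableI_bounded) (auto simp: le_less_trans)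
  have "ennreal (\<integral>w. norm w ^ 4 \<partial>planar_gauss h) \<le> ennreal (12 * h\<^sup>2)"
    using planar_gauss_fourth_moment[OF h] nn_integral_eq_integral[OF i] by simp
  then show "(\<integral>w. norm w ^ 4 \<partial>planar_gauss h) \<le> 12 * h\<^sup>2"
    by (subst (asm) ennreal_le_iff) auto
qed

section \<open>Gaussian averages of harmonic functions\<close>

definition cx :: "real \<times> real \<Rightarrow> complex" where
  "cx = (\<lambda>(x, y). Complex x y)"

lemma cx_add: "cx (v + w) = cx v + cx w"
  by (simp add: cx_def case_prod_beta complex_eq_iff)

lemma Re_cx [simp]: "Re (cx w) = fst w" and Im_cx [simp]: "Im (cx w) = snd w"
  by (simp_all add: cx_def case_prod_beta)

lemma norm_cx [simp]: "cmod (cx w) = norm w"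
  by (simp add: cmod_def norm_prod_def)

lemma cx_rot: "cx (rot w) = \<i> * cx w"
  by (simp add: rot_def case_prod_beta complex_eq_iff)

lemma cx_eq: "cx w = of_real (fst w) + \<i> * of_real (snd w)"
  by (simp add: complex_eq_iff)

lemma continuous_on_cx [continuous_intros]:
  "continuous_on A f \<Longrightarrow> continuous_on A (\<lambda>x. cx (f x))"
  unfolding cx_eq by (intro continuous_intros)

lemma cx_measurable [measurable]: "cx \<in> borel_measurable borel"
  by (intro borel_measurable_continuous_onI continuous_intros)

lemma norm_rot [simp]: "norm (rot w) = norm w"
  by (simp add: rot_def case_prod_beta norm_prod_def)

text \<open>Averaging over the four rotations by multiples of a right angle removes all Taylor terms
  of order one to three.\<close>

lemma holomorphic_rot_average:
  assumes U: "open U" "g holomorphic_on U" and K: "compact K" "K \<subseteq> U"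
  obtains \<delta> L where "\<delta> > 0" "L \<ge> 0" "\<And>x v. x \<in> K \<Longrightarrow> cmod v \<le> \<delta> \<Longrightarrow> x + v \<in> U"
    "\<And>x v. x \<in> K \<Longrightarrow> cmod v \<le> \<delta> \<Longrightarrow>
      cmod ((g (x + v) + g (x + \<i> * v) + g (x - v) + g (x - \<i> * v)) / 4 - g x) \<le> L * cmod v ^ 4"
proof -
  obtain \<delta> where \<delta>: "\<delta> > 0" "(\<Union>x\<in>K. cball x \<delta>) \<subseteq> U"
    using compact_subset_open_imp_cball_epsilon_subset[OF K(1) U(1) K(2)] by blast
  \<comment> \<open>The closed \<delta>-neighbourhood of \<open>K\<close> is compact, so one bound
    on the fourth derivative serves all centres in \<open>K\<close>.\<close>
  define K' where "K' = {x + y |x y. x \<in> K \<and> y \<in> cball (0 :: complex) \<delta>}"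
  have K': "compact K'"
    unfolding K'_def by (rule compact_sums[OF K(1) compact_cball])
  have cb: "cball x \<delta> \<subseteq> K'" if "x \<in> K" for x
  proof
    fix y assume "y \<in> cball x \<delta>"
    then have "y = x + (y - x)" "y - x \<in> cball 0 \<delta>"
      by (auto simp: dist_norm norm_minus_commute)
    then show "y \<in> K'" unfolding K'_def using that by blast
  qed
  have K'U: "K' \<subseteq> U"
  proof
    fix y assume "y \<in> K'"
    then obtain x v where "y = x + v" "x \<in> K" "cmod v \<le> \<delta>" by (auto simp: K'_def)
    then have "y \<in> cball x \<delta>" by (simp add: dist_norm)
    then show "y \<in> U" using \<delta>(2) \<open>x \<in> K\<close> by blast
  qed
  define D where "D = (\<lambda>i. (deriv ^^ i) g)"
  have hol: "D i holomorphic_on U" for i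
    unfolding D_def by (intro holomorphic_higher_deriv U)
  have der: "(D i has_field_derivative D (Suc i) x) (at x)" if "x \<in> U" for i x
    using holomorphic_derivI[OF hol[of i] U(1) that] by (simp add: D_def)
  have "compact (D 4 ` K')"
    by (intro compact_continuous_image holomorphic_on_imp_continuous_on
        holomorphic_on_subset[OF hol K'U] K')
  then obtain B where B: "B > 0" "\<And>x. x \<in> K' \<Longrightarrow> cmod (D 4 x) \<le> B"
    by (metis bounded_pos compact_imp_bounded imageI)
  have taylor: "cmod (g (x + v) - (\<Sum>i\<le>3. D i x * v ^ i / fact i)) \<le> B * cmod v ^ 4"
    if "x \<in> K" "cmod v \<le> \<delta>" for x v
  proof -
    have "cmod (D 0 (x + v) - (\<Sum>i\<le>3. D i x * ((x + v) - x) ^ i / fact i))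
        \<le> B * cmod ((x + v) - x) ^ Suc 3 / fact 3"
    proof (rule complex_Taylor)
      show "convex (cball x \<delta>)" by simp
      show "(D i has_field_derivative D (Suc i) y) (at y within cball x \<delta>)" if "y \<in> cball x \<delta>" for i y
        using der[of y i] cb[OF \<open>x \<in> K\<close>] K'U that by (meson has_field_derivative_at_within subsetD)
      show "cmod (D (Suc 3) y) \<le> B" if "y \<in> cball x \<delta>" for y
        using B(2)[of y] cb[OF \<open>x \<in> K\<close>] that by (auto simp: numeral_eq_Suc)
      show "x \<in> cball x \<delta>" "x + v \<in> cball x \<delta>"
        using \<open>cmod v \<le> \<delta>\<close> \<delta>(1) by (simp_all add: dist_norm)
    qed
    also have "\<dots> \<le> B * cmod v ^ 4"
      using B(1) by (simp add: fact_numeral numeral_eq_Suc field_simps)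
    finally show ?thesis by (simp add: D_def)
  qed
  have avg: "cmod ((g (x + v) + g (x + \<i> * v) + g (x - v) + g (x - \<i> * v)) / 4 - g x) \<le> B * cmod v ^ 4"
    if x: "x \<in> K" "cmod v \<le> \<delta>" for x v
  proof -
    define T where "T = (\<lambda>v. \<Sum>i\<le>3. D i x * v ^ i / fact i)"
    have T: "T v + T (\<i> * v) + T (- v) + T (- (\<i> * v)) = 4 * g x"
      by (simp add: T_def numeral_eq_Suc D_def power_mult_distrib algebra_simps add_divide_distrib[symmetric])
    let ?d = "\<lambda>v. g (x + v) - T v"
    have "(g (x + v) + g (x + \<i> * v) + g (x - v) + g (x - \<i> * v)) / 4 - g x
        = (?d v + ?d (\<i> * v) + ?d (- v) + ?d (- (\<i> * v))) / 4"
      using T by (simp add: field_simps)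
    also have "cmod \<dots> \<le> (cmod (?d v) + cmod (?d (\<i> * v)) + cmod (?d (- v)) + cmod (?d (- (\<i> * v)))) / 4"
      unfolding norm_divide by (intro divide_mono norm_triangle_le add_mono order_refl) auto
    also have "\<dots> \<le> (B * cmod v ^ 4 + B * cmod v ^ 4 + B * cmod v ^ 4 + B * cmod v ^ 4) / 4"
      using taylor[OF x(1), of v] taylor[OF x(1), of "\<i> * v"] taylor[OF x(1), of "- v"]
        taylor[OF x(1), of "- (\<i> * v)"] x(2)
      by (intro divide_right_mono add_mono) (simp_all add: T_def norm_mult)
    finally show ?thesis by simp
  qed
  show ?thesis
  proof (rule that[of \<delta> B])
    show "x + v \<in> U" if "x \<in> K" "cmod v \<le> \<delta>" for x v
    proof -
      have "x + v \<in> cball x \<delta>" using that by (simp add: dist_norm)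
      then show ?thesis using \<delta>(2) that by blast
    qed
  qed (use \<delta> B avg in auto)
qed

text \<open>Four-point averages lose at most a multiple of \<open>norm w ^ 4\<close> on short steps,
  and the fourth moment turns this into order h^2; long steps are absorbed through boundedness. The
  constant is fixed before \<open>F\<close>, which only has to be measurable, bounded by
  \<open>C\<close> and above \<open>Re g\<close> on \<open>U\<close>.\<close>

lemma submean_of_holomorphic_minorant:
  assumes U: "open U" "g holomorphic_on U" and K: "compact K" "K \<subseteq> U" and C: "C \<ge> 0"
  obtains L where "L \<ge> 0"
    "\<And>F x h. F \<in> borel_measurable borel \<Longrightarrow> (\<And>w. \<bar>F w\<bar> \<le> C) \<Longrightarrow>
       (\<And>w. cx w \<in> U \<Longrightarrow> Re (g (cx w)) \<le> F w) \<Longrightarrow> cx x \<in> K \<Longrightarrow> h > 0 \<Longrightarrow>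
       Re (g (cx x)) - L * h\<^sup>2 \<le> (\<integral>w. F (x + w) \<partial>planar_gauss h)"
proof -
  obtain \<delta> B where \<delta>: "\<delta> > 0" "B \<ge> 0" "\<And>x v. x \<in> K \<Longrightarrow> cmod v \<le> \<delta> \<Longrightarrow> x + v \<in> U"
    and avg: "\<And>x v. x \<in> K \<Longrightarrow> cmod v \<le> \<delta> \<Longrightarrow>
      cmod ((g (x + v) + g (x + \<i> * v) + g (x - v) + g (x - \<i> * v)) / 4 - g x) \<le> B * cmod v ^ 4"
    using holomorphic_rot_average[OF U K] by blast
  have "compact (g ` K)"
    by (intro compact_continuous_image holomorphic_on_imp_continuous_on holomorphic_on_subset[OF U(2)] K)
  then obtain G where G: "G > 0" "\<And>x. x \<in> K \<Longrightarrow> cmod (g x) \<le> G"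
    by (metis bounded_pos compact_imp_bounded imageI)
  \<comment> \<open>The second summand makes the pointwise bound trivial beyond \<delta>: there
    \<open>L * norm w ^ 4 \<ge> C + G\<close>, so the left side is at most \<open>- C\<close>, a
    lower bound of \<open>F\<close>.\<close>
  define L where "L = B + (C + G) / \<delta> ^ 4"
  have L: "L \<ge> 0" using \<delta> C G by (simp add: L_def)
  show ?thesis
  proof (rule that[of "12 * L"])
    show "12 * L \<ge> 0" using L by simp
    fix F x and h :: real
    assume F [measurable]: "F \<in> borel_measurable borel" and FC: "\<And>w. \<bar>F w\<bar> \<le> C"
      and Fg: "\<And>w. cx w \<in> U \<Longrightarrow> Re (g (cx w)) \<le> F w" and x: "cx x \<in> K" and h: "h > 0"
    interpret N: prob_space "planar_gauss h" by (rule prob_space_planar_gauss[OF h])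
    \<comment> \<open>By rotation invariance each of the four terms has the same Gaussian integral
      as \<open>F (x + w)\<close>.\<close>
    define r where "r = (\<lambda>w. F (x + w) + F (x + rot w) + F (x + rot (rot w)) + F (x + rot (rot (rot w))))"
    have pw: "Re (g (cx x)) - L * norm w ^ 4 \<le> r w / 4" for w
    proof (cases "norm w \<le> \<delta>")
      case True
      define v where "v = cx w"
      have v: "cmod v \<le> \<delta>" using True by (simp add: v_def)
      have c: "cx (x + w) = cx x + v" "cx (x + rot w) = cx x + \<i> * v"
         "cx (x + rot (rot w)) = cx x - v" "cx (x + rot (rot (rot w))) = cx x - \<i> * v"
        by (simp_all add: cx_add cx_rot v_def)
      have "cmod (\<i> * v) \<le> \<delta>" "cmod (- v) \<le> \<delta>" "cmod (- (\<i> * v)) \<le> \<delta>"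
        using v by (simp_all add: norm_mult)
      note U4 = \<delta>(3)[OF x v] this[THEN \<delta>(3)[OF x]]
      let ?a = "(g (cx x + v) + g (cx x + \<i> * v) + g (cx x - v) + g (cx x - \<i> * v)) / 4"
      have "Re (g (cx x)) - Re ?a \<le> cmod (g (cx x) - ?a)"
        using complex_Re_le_cmod[of "g (cx x) - ?a"] by (simp only: minus_complex.simps)
      also have "\<dots> \<le> B * cmod v ^ 4"
        using avg[OF x v] by (simp only: norm_minus_commute)
      finally have "Re (g (cx x)) - B * cmod v ^ 4 \<le> Re ?a" by linarith
      also have "\<dots> \<le> r w / 4"
        using U4 Fg[of "x + w"] Fg[of "x + rot w"] Fg[of "x + rot (rot w)"] Fg[of "x + rot (rot (rot w))"]
        unfolding r_def c by simp
      finally have "Re (g (cx x)) - B * norm w ^ 4 \<le> r w / 4" by (simp add: v_def)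
      moreover have "B * norm w ^ 4 \<le> L * norm w ^ 4"
        using C G \<delta> by (intro mult_right_mono) (auto simp: L_def)
      ultimately show ?thesis by simp
    next
      case False
      then have "norm w ^ 4 \<ge> \<delta> ^ 4" using \<delta>(1) by (intro power_mono) auto
      then have "(C + G) * \<delta> ^ 4 \<le> (C + G) * norm w ^ 4"
        using C G by (intro mult_left_mono) auto
      then have "C + G \<le> (C + G) / \<delta> ^ 4 * norm w ^ 4"
        using \<delta>(1) by (simp add: pos_le_divide_eq)
      also have "\<dots> \<le> L * norm w ^ 4"
        using \<delta> by (intro mult_right_mono) (auto simp: L_def)
      finally have "Re (g (cx x)) - L * norm w ^ 4 \<le> - C"
        using G(2)[OF x] complex_Re_le_cmod[of "g (cx x)"] by linarith
      also have "\<dots> \<le> r w / 4"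
        unfolding r_def
        using FC[of "x + w", THEN abs_le_D2] FC[of "x + rot w", THEN abs_le_D2]
          FC[of "x + rot (rot w)", THEN abs_le_D2] FC[of "x + rot (rot (rot w))", THEN abs_le_D2]
        by argo
      finally show ?thesis .
    qed
    have intF: "integrable (planar_gauss h) (\<lambda>w. F (x + f w))" if [measurable]: "f \<in> borel_measurable borel" for f
      by (rule N.integrable_const_bound[where B=C]) (auto simp: FC)
    have rotF: "(\<integral>w. F (x + rot (f w)) \<partial>planar_gauss h) = (\<integral>w. F (x + w) \<partial>planar_gauss h)"
      if "f \<in> {\<lambda>w. w, rot, \<lambda>w. rot (rot w)}" for f
      using that integral_planar_gauss_rot[OF h, of "\<lambda>w. F (x + w)"]
        integral_planar_gauss_rot[OF h, of "\<lambda>w. F (x + rot w)"]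
        integral_planar_gauss_rot[OF h, of "\<lambda>w. F (x + rot (rot w))"]
      by auto
    have ir: "integrable (planar_gauss h) r"
      unfolding r_def by (intro Bochner_Integration.integrable_add intF) auto
    have "(\<integral>w. r w \<partial>planar_gauss h) = 4 * (\<integral>w. F (x + w) \<partial>planar_gauss h)"
      unfolding r_def using intF[of "\<lambda>w. w"] intF[of rot] intF[of "\<lambda>w. rot (rot w)"]
        intF[of "\<lambda>w. rot (rot (rot w))"] rotF[of "\<lambda>w. w"] rotF[of rot] rotF[of "\<lambda>w. rot (rot w)"]
      by (simp add: Bochner_Integration.integral_add)
    moreover have "(\<integral>w. Re (g (cx x)) - L * norm w ^ 4 \<partial>planar_gauss h) \<le> (\<integral>w. r w / 4 \<partial>planar_gauss h)"
      using ir integrable_planar_gauss_fourth(1)[OF h] pw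
      by (intro integral_mono) auto
    moreover have "(\<integral>w. Re (g (cx x)) - L * norm w ^ 4 \<partial>planar_gauss h)
        = Re (g (cx x)) - L * (\<integral>w. norm w ^ 4 \<partial>planar_gauss h)"
      using integrable_planar_gauss_fourth(1)[OF h] N.prob_space
      by (subst Bochner_Integration.integral_diff) (auto simp: N.prob_space[simplified])
    moreover have "L * (\<integral>w. norm w ^ 4 \<partial>planar_gauss h) \<le> L * (12 * h\<^sup>2)"
      by (intro mult_left_mono integrable_planar_gauss_fourth L h)
    ultimately show "Re (g (cx x)) - 12 * L * h\<^sup>2 \<le> (\<integral>w. F (x + w) \<partial>planar_gauss h)"
      by simp
  qed
qed

section \<open>The Markov property\<close>

lemma (in prob_space) indep_var_expectation_iterated:
  fixes g :: "_ \<Rightarrow> real"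
  assumes ind: "indep_var S Y T W" and g [measurable]: "g \<in> borel_measurable (S \<Otimes>\<^sub>M T)"
    and bnd: "\<And>x. \<bar>g x\<bar> \<le> C"
  shows "expectation (\<lambda>\<omega>. g (Y \<omega>, W \<omega>)) = expectation (\<lambda>\<omega>. \<integral>w. g (Y \<omega>, w) \<partial>distr M T W)"
proof -
  have [measurable]: "random_variable S Y" "random_variable T W"
    using ind by (auto dest: indep_var_rv1 indep_var_rv2)
  have joint: "distr M (S \<Otimes>\<^sub>M T) (\<lambda>\<omega>. (Y \<omega>, W \<omega>)) = distr M S Y \<Otimes>\<^sub>M distr M T W"
    using ind by (simp add: indep_var_distribution_eq)
  interpret Y: prob_space "distr M S Y" by (rule prob_space_distr) simp
  interpret W: prob_space "distr M T W" by (rule prob_space_distr) simp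
  interpret pair_prob_space "distr M S Y" "distr M T W" ..
  have "(\<integral>\<omega>. g (Y \<omega>, W \<omega>) \<partial>M) = (\<integral>x. g x \<partial>distr M (S \<Otimes>\<^sub>M T) (\<lambda>\<omega>. (Y \<omega>, W \<omega>)))"
    by (subst integral_distr) auto
  also note joint
  also have "(\<integral>x. g x \<partial>(distr M S Y \<Otimes>\<^sub>M distr M T W)) = (\<integral>y. (\<integral>w. g (y, w) \<partial>distr M T W) \<partial>distr M S Y)"
  proof (rule integral_fst'[symmetric])
    show "integrable (distr M S Y \<Otimes>\<^sub>M distr M T W) g"
      by (rule P.integrable_const_bound[where B=C]) (auto simp: bnd)
  qed
  also have "\<dots> = (\<integral>\<omega>. (\<integral>w. g (Y \<omega>, w) \<partial>distr M T W) \<partial>M)"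
    by (subst integral_distr) auto
  finally show ?thesis .
qed

text \<open>Rounding down to dyadic points and using continuity. This reduces a closed condition on
  a whole time interval to countably many times, as both measurability and independence of finitely
  many increments demand.\<close>

lemma dyadic_grid_le:
  fixes f :: "real \<Rightarrow> real"
  assumes f: "continuous_on {a..b} f" and u: "u \<in> {a..b}"
    and c: "\<And>n i. i \<le> 2 ^ n \<Longrightarrow> c \<le> f (a + real i * (b - a) / 2 ^ n)"
  shows "c \<le> f u"
proof (cases "a = b")
  case True
  then show ?thesis using c[of 0 0] u by simp
next
  case False
  with u have ab: "a < b" by auto
  define q where "q = (u - a) / (b - a)"
  have q: "0 \<le> q" "q \<le> 1" "u = a + q * (b - a)"
    using u ab by (auto simp: q_def field_simps)
  define i where "i = (\<lambda>n. nat \<lfloor>q * 2 ^ n\<rfloor>)"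
  have i: "real (i n) \<le> q * 2 ^ n" "q * 2 ^ n - 1 \<le> real (i n)" for n
    using q by (auto simp: i_def)
  have le: "i n \<le> 2 ^ n" for n
  proof -
    have "q * 2 ^ n \<le> 2 ^ n" using q by (simp add: mult_left_le_one_le)
    with i(1) have "real (i n) \<le> 2 ^ n" by (rule order_trans)
    then show ?thesis by (metis of_nat_le_iff of_nat_numeral of_nat_power)
  qed
  have lim: "(\<lambda>n. real (i n) / 2 ^ n) \<longlonglongrightarrow> q"
  proof (rule tendsto_sandwich[OF _ _ _ tendsto_const])
    show "\<forall>\<^sub>F n in sequentially. q - 1 / 2 ^ n \<le> real (i n) / 2 ^ n"
    proof (intro always_eventually allI)
      show "q - 1 / 2 ^ n \<le> real (i n) / 2 ^ n" for n
        using divide_right_mono[OF i(2)[of n], of "2 ^ n"] by (simp add: diff_divide_distrib)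
    qed
    show "\<forall>\<^sub>F n in sequentially. real (i n) / 2 ^ n \<le> q"
      using i(1) by (intro always_eventually allI) (simp add: pos_divide_le_eq)
    have "(\<lambda>n. q - (1 / 2) ^ n) \<longlonglongrightarrow> q - 0"
      by (intro tendsto_intros LIMSEQ_power_zero) auto
    then show "(\<lambda>n. q - 1 / 2 ^ n) \<longlonglongrightarrow> q" by (simp add: power_divide)
  qed
  let ?x = "\<lambda>n. a + real (i n) * (b - a) / 2 ^ n"
  have "(\<lambda>n. a + (real (i n) / 2 ^ n) * (b - a)) \<longlonglongrightarrow> a + q * (b - a)"
    by (intro tendsto_intros lim)
  then have x: "?x \<longlonglongrightarrow> u" by (simp add: q(3)[symmetric])
  have xin: "?x n \<in> {a..b}" for n
  proof -
    have "real (i n) / 2 ^ n \<le> 1"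
      using le[of n] by (metis divide_le_eq_1_pos of_nat_le_iff of_nat_numeral of_nat_power zero_less_numeral zero_less_power)
    then have "real (i n) / 2 ^ n * (b - a) \<le> 1 * (b - a)" using ab by (intro mult_right_mono) auto
    then show ?thesis using ab by simp
  qed
  have "(\<lambda>n. f (?x n)) \<longlonglongrightarrow> f u"
    using f x xin u by (auto simp: continuous_on_sequentially comp_def)
  then show ?thesis
    by (rule LIMSEQ_le_const) (use c le in auto)
qed

context planar_brownian_motion
begin

lemma distr_increment:
  assumes "0 \<le> s" "0 < h"
  shows "distr M borel (\<lambda>\<omega>. B (s + h) \<omega> - B s \<omega>) = planar_gauss h"
proof -
  have "distributed M lborel (\<lambda>\<omega>. B (s + h) \<omega> - B s \<omega>)
      (\<lambda>(x, y). ennreal (normal_density 0 (sqrt h) x * normal_density 0 (sqrt h) y))"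
    using gaussian_increments[of s "s + h"] assms by simp
  then have "distr M lborel (\<lambda>\<omega>. B (s + h) \<omega> - B s \<omega>) = planar_gauss h"
    unfolding planar_gauss_def by (rule distributed_distr_eq_density)
  moreover have "distr M lborel (\<lambda>\<omega>. B (s + h) \<omega> - B s \<omega>) = distr M borel (\<lambda>\<omega>. B (s + h) \<omega> - B s \<omega>)"
    by (rule distr_cong) auto
  ultimately show ?thesis by simp
qed

text \<open>Given the start, the grid positions up to \<open>s\<close> are a function of the first
  \<open>n\<close> increments, and the last increment is independent of these. The past enters only
  through an event on a finite grid because independence is assumed for finitely many increments at
  a time.\<close>

lemma markov_grid:
  fixes F :: "real \<times> real \<Rightarrow> real"
  assumes s: "s > 0" and h: "h > 0" and n: "n > 0"
    and F [measurable]: "F \<in> borel_measurable borel" and bnd: "\<And>x. \<bar>F x\<bar> \<le> C"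
    and Cl [measurable]: "Cl \<in> sets borel"
  defines "G \<equiv> {\<omega>\<in>space M. \<forall>i\<le>n. B (real i * s / real n) \<omega> \<in> Cl}"
  shows "expectation (\<lambda>\<omega>. indicator G \<omega> * F (B (s + h) \<omega>)) =
    expectation (\<lambda>\<omega>. indicator G \<omega> * (\<integral>w. F (B s \<omega> + w) \<partial>planar_gauss h))"
proof -
  \<comment> \<open>One extra time \<open>s + h\<close> at index \<open>Suc n\<close>: increment
    number \<open>n\<close> is then the step into the future.\<close>
  define t where "t = (\<lambda>i. if i \<le> n then real i * s / real n else s + h)"
  define X where "X = (\<lambda>i \<omega>. B (t (Suc i)) \<omega> - B (t i) \<omega>)"
  have t0: "t 0 = 0" and tn: "t n = s" and tSn: "t (Suc n) = s + h"
    using n by (auto simp: t_def)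
  have t_nonneg: "0 \<le> t i" for i using s h by (auto simp: t_def)
  have [measurable]: "random_variable borel (B (t i))" for i
    by (rule measurable_B[OF t_nonneg])
  have [measurable]: "random_variable borel (B s)" "random_variable borel (B (s + h))"
    using measurable_B s h by auto
  have Gt: "G = {\<omega>\<in>space M. \<forall>i\<in>{..n}. B (t i) \<omega> \<in> Cl}"
    by (auto simp: G_def t_def)
  have [measurable]: "G \<in> sets M" unfolding Gt by measurable
  have "indep_vars (\<lambda>_. borel) X {..<Suc n}"
    unfolding X_def
  proof (rule indep_increments)
    show "0 \<le> t 0" by (simp add: t0)
    show "t i < t (Suc i)" if "i < Suc n" for i
      using that s h n by (cases "i = n") (auto simp: t_def field_simps)
  qed
  then have "indep_var (PiM {..<n} (\<lambda>_. borel)) (\<lambda>\<omega>. restrict (\<lambda>i. X i \<omega>) {..<n})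
      (PiM {n} (\<lambda>_. borel)) (\<lambda>\<omega>. restrict (\<lambda>i. X i \<omega>) {n})"
    by (rule indep_var_restrict) auto
  moreover define Y where "Y = (\<lambda>\<omega>. restrict (\<lambda>i. X i \<omega>) {..<n})"
  moreover define W where "W = (\<lambda>\<omega>. restrict (\<lambda>i. X i \<omega>) {n})"
  ultimately have ind: "indep_var (PiM {..<n} (\<lambda>_. borel)) Y (PiM {n} (\<lambda>_. borel)) W"
    by simp
  have W_n: "W \<omega> n = B (s + h) \<omega> - B s \<omega>" for \<omega>
    by (simp add: W_def X_def tn tSn)
  \<comment> \<open>Recovers the position at grid time \<open>k\<close> from the increments. It
    agrees with \<open>B\<close> where \<open>B 0 \<omega> = z\<close>, hence almost everywhere, and
    this is why the rewriting below is done under \<open>AE\<close>.\<close>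
  define pos where "pos = (\<lambda>(k :: nat) f. z + (\<Sum>i<k. f i :: real \<times> real))"
  have pos_meas: "pos k \<in> borel_measurable (PiM {..<n} (\<lambda>_. borel))" if "k \<le> n" for k
    unfolding pos_def using that
    by (intro borel_measurable_add borel_measurable_const borel_measurable_sum
        measurable_component_singleton) auto
  have pos_Y: "pos k (Y \<omega>) = B (t k) \<omega>" if "k \<le> n" "B 0 \<omega> = z" for k \<omega>
  proof -
    have "(\<Sum>i<k. Y \<omega> i) = (\<Sum>i<k. B (t (Suc i)) \<omega> - B (t i) \<omega>)"
      using that by (intro sum.cong) (auto simp: Y_def X_def)
    also have "\<dots> = B (t k) \<omega> - B (t 0) \<omega>" by (rule sum_lessThan_telescope)
    finally show ?thesis using that by (simp add: pos_def t0)
  qed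
  define S where "S = {f\<in>space (PiM {..<n} (\<lambda>_. borel)). \<forall>i\<in>{..n}. pos i f \<in> Cl}"
  have [measurable]: "S \<in> sets (PiM {..<n} (\<lambda>_. borel))"
    unfolding S_def using pos_meas by (intro sets.sets_Collect_finite_All) (auto intro!: measurable_sets_Collect)
  have [measurable]: "pos n \<in> borel_measurable (PiM {..<n} (\<lambda>_. borel))" by (rule pos_meas) simp
  define g where "g = (\<lambda>(f, w). indicator S f * F (pos n f + w n))"
  have g_meas: "g \<in> borel_measurable (PiM {..<n} (\<lambda>_. borel) \<Otimes>\<^sub>M PiM {n} (\<lambda>_. borel))"
  proof -
    have [measurable]: "(\<lambda>w. w n) \<in> borel_measurable (PiM {n} (\<lambda>_. borel :: (real \<times> real) measure))"
      by (rule measurable_component_singleton) simp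
    show ?thesis unfolding g_def by measurable
  qed
  have C: "C \<ge> 0" using bnd[of 0] by simp
  have g_bnd: "\<bar>g x\<bar> \<le> C" for x
    using bnd C by (auto simp: g_def indicator_def split: prod.split)
  have Y_space: "Y \<omega> \<in> space (PiM {..<n} (\<lambda>_. borel))" for \<omega>
    by (auto simp: Y_def space_PiM)
  have indS: "indicator S (Y \<omega>) = (indicator G \<omega> :: real)" if "B 0 \<omega> = z" "\<omega> \<in> space M" for \<omega>
    using that Y_space by (auto simp: S_def Gt pos_Y indicator_def)
  have mY [measurable]: "random_variable (PiM {..<n} (\<lambda>_. borel)) Y" using ind by (rule indep_var_rv1)
  have mW [measurable]: "random_variable (PiM {n} (\<lambda>_. borel)) W" using ind by (rule indep_var_rv2)
  have W_int: "(\<integral>w. H (w n) \<partial>distr M (PiM {n} (\<lambda>_. borel)) W) = (\<integral>w. H w \<partial>planar_gauss h)"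
    if [measurable]: "H \<in> borel_measurable borel" for H :: "real \<times> real \<Rightarrow> real"
  proof -
    have [measurable]: "(\<lambda>w. H (w n)) \<in> borel_measurable (PiM {n} (\<lambda>_. borel))"
      by (rule measurable_compose[OF measurable_component_singleton]) auto
    have "(\<integral>w. H (w n) \<partial>distr M (PiM {n} (\<lambda>_. borel)) W) = expectation (\<lambda>\<omega>. H (W \<omega> n))"
      by (rule integral_distr) auto
    also have "\<dots> = (\<integral>w. H w \<partial>distr M borel (\<lambda>\<omega>. B (s + h) \<omega> - B s \<omega>))"
      unfolding W_n by (rule integral_distr[symmetric]) auto
    finally show ?thesis using s h by (simp add: distr_increment)
  qed
  interpret N: prob_space "planar_gauss h" by (rule prob_space_planar_gauss[OF h])
  have "expectation (\<lambda>\<omega>. indicator G \<omega> * F (B (s + h) \<omega>)) = expectation (\<lambda>\<omega>. g (Y \<omega>, W \<omega>))"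
  proof (rule integral_cong_AE)
    show "AE \<omega> in M. indicator G \<omega> * F (B (s + h) \<omega>) = g (Y \<omega>, W \<omega>)"
      using start AE_space
    proof eventually_elim
      case (elim \<omega>)
      then show ?case by (simp add: g_def indS pos_Y tn W_n)
    qed
    show "(\<lambda>\<omega>. g (Y \<omega>, W \<omega>)) \<in> borel_measurable M"
      using g_meas indep_var_rv2[OF ind] by measurable
  qed measurable
  also have "\<dots> = expectation (\<lambda>\<omega>. \<integral>w. g (Y \<omega>, w) \<partial>distr M (PiM {n} (\<lambda>_. borel)) W)"
    by (rule indep_var_expectation_iterated[OF ind g_meas g_bnd])
  also have "\<dots> = expectation (\<lambda>\<omega>. indicator S (Y \<omega>) * (\<integral>w. F (pos n (Y \<omega>) + w) \<partial>planar_gauss h))"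
  proof -
    have "(\<integral>w. F (c + w n) \<partial>distr M (PiM {n} (\<lambda>_. borel)) W) = (\<integral>w. F (c + w) \<partial>planar_gauss h)" for c
      using W_int[of "\<lambda>w. F (c + w)"] by simp
    then show ?thesis unfolding g_def by simp
  qed
  also have "\<dots> = expectation (\<lambda>\<omega>. indicator G \<omega> * (\<integral>w. F (B s \<omega> + w) \<partial>planar_gauss h))"
  proof (rule integral_cong_AE)
    show "AE \<omega> in M. indicator S (Y \<omega>) * (\<integral>w. F (pos n (Y \<omega>) + w) \<partial>planar_gauss h)
        = indicator G \<omega> * (\<integral>w. F (B s \<omega> + w) \<partial>planar_gauss h)"
      using start AE_space
    proof eventually_elim
      case (elim \<omega>)
      then show ?case by (simp add: g_def indS pos_Y tn)
    qed
    show "(\<lambda>\<omega>. indicator S (Y \<omega>) * (\<integral>w. F (pos n (Y \<omega>) + w) \<partial>planar_gauss h)) \<in> borel_measurable M"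
      by measurable
    show "(\<lambda>\<omega>. indicator G \<omega> * (\<integral>w. F (B s \<omega> + w) \<partial>planar_gauss h)) \<in> borel_measurable M"
      by measurable
  qed
  finally show ?thesis .
qed

end

section \<open>From finite grids to whole time intervals\<close>

lemma expectation_indicator_decseq:
  fixes Y :: "'a \<Rightarrow> real"
  assumes M: "prob_space M" and A: "decseq A" "\<And>n. A n \<in> sets M"
    and Y [measurable]: "Y \<in> borel_measurable M" and bnd: "\<And>\<omega>. \<bar>Y \<omega>\<bar> \<le> C"
  shows "(\<lambda>n. \<integral>\<omega>. indicator (A n) \<omega> * Y \<omega> \<partial>M) \<longlonglongrightarrow> (\<integral>\<omega>. indicator (\<Inter>n. A n) \<omega> * Y \<omega> \<partial>M)"
proof (rule integral_dominated_convergence[where w="\<lambda>_. C"])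
  interpret prob_space M by fact
  note A(2)[measurable]
  show "(\<lambda>\<omega>. indicator (\<Inter>n. A n) \<omega> * Y \<omega>) \<in> borel_measurable M" by measurable
  show "(\<lambda>\<omega>. indicator (A n) \<omega> * Y \<omega>) \<in> borel_measurable M" for n by measurable
  show "integrable M (\<lambda>_. C)" by simp
  show "AE \<omega> in M. (\<lambda>n. indicator (A n) \<omega> * Y \<omega>) \<longlonglongrightarrow> indicator (\<Inter>n. A n) \<omega> * Y \<omega>"
    by (intro AE_I2 tendsto_intros LIMSEQ_indicator_decseq A)
  show "AE \<omega> in M. norm (indicator (A n) \<omega> * Y \<omega>) \<le> C" for n
    using bnd order_trans[OF abs_ge_zero bnd] by (intro AE_I2) (auto simp: indicator_def)
qed

lemma expectation_indicator_incseq: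
  fixes Y :: "'a \<Rightarrow> real"
  assumes M: "prob_space M" and A: "incseq A" "\<And>n. A n \<in> sets M"
    and Y [measurable]: "Y \<in> borel_measurable M" and bnd: "\<And>\<omega>. \<bar>Y \<omega>\<bar> \<le> C"
  shows "(\<lambda>n. \<integral>\<omega>. indicator (A n) \<omega> * Y \<omega> \<partial>M) \<longlonglongrightarrow> (\<integral>\<omega>. indicator (\<Union>n. A n) \<omega> * Y \<omega> \<partial>M)"
proof (rule integral_dominated_convergence[where w="\<lambda>_. C"])
  interpret prob_space M by fact
  note A(2)[measurable]
  show "(\<lambda>\<omega>. indicator (\<Union>n. A n) \<omega> * Y \<omega>) \<in> borel_measurable M" by measurable
  show "(\<lambda>\<omega>. indicator (A n) \<omega> * Y \<omega>) \<in> borel_measurable M" for n by measurable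
  show "integrable M (\<lambda>_. C)" by simp
  show "AE \<omega> in M. (\<lambda>n. indicator (A n) \<omega> * Y \<omega>) \<longlonglongrightarrow> indicator (\<Union>n. A n) \<omega> * Y \<omega>"
    by (intro AE_I2 tendsto_intros LIMSEQ_indicator_incseq A)
  show "AE \<omega> in M. norm (indicator (A n) \<omega> * Y \<omega>) \<le> C" for n
    using bnd order_trans[OF abs_ge_zero bnd] by (intro AE_I2) (auto simp: indicator_def)
qed

context planar_brownian_motion
begin

definition stay :: "(real \<times> real) set \<Rightarrow> real \<Rightarrow> real \<Rightarrow> 'w set" where
  "stay D a b = {\<omega>\<in>space M. \<forall>u\<in>{a..b}. B u \<omega> \<in> D}"

text \<open>Time 0 is left out to match \<open>exit_time\<close>, which looks at positive times
  only; \<open>stay\<close> is the variant over compact time intervals.\<close>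

definition alive :: "(real \<times> real) set \<Rightarrow> real \<Rightarrow> 'w set" where
  "alive D s = {\<omega>\<in>space M. \<forall>u\<in>{0<..s}. B u \<omega> \<in> D}"

text \<open>Closed sets that exhaust \<open>D\<close>. Staying in a closed set can be tested at
  dyadic times, whereas a path may touch the boundary of an open set at a single non-dyadic
  time.\<close>

definition core :: "(real \<times> real) set \<Rightarrow> nat \<Rightarrow> (real \<times> real) set" where
  "core D m = {x. inverse (real (Suc m)) \<le> infdist x (- D)}"

definition grid_event :: "(real \<times> real) set \<Rightarrow> real \<Rightarrow> real \<Rightarrow> nat \<Rightarrow> nat \<Rightarrow> 'w set" where
  "grid_event D a b m n = {\<omega>\<in>space M. \<forall>i\<le>2 ^ n. B (a + real i * (b - a) / 2 ^ n) \<omega> \<in> core D m}"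

lemma closed_core: "closed (core D m)"
  unfolding core_def by (intro closed_Collect_le continuous_intros)

lemma grid_event_measurable:
  assumes "0 \<le> a" "a \<le> b"
  shows "grid_event D a b m n \<in> sets M"
proof -
  have [measurable]: "core D m \<in> sets borel" by (intro borel_closed closed_core)
  have [measurable]: "B (a + real i * (b - a) / 2 ^ n) \<in> borel_measurable M" for i
    using assms by (intro measurable_B) simp
  have "grid_event D a b m n = {\<omega>\<in>space M. \<forall>i\<in>{..2 ^ n}. B (a + real i * (b - a) / 2 ^ n) \<omega> \<in> core D m}"
    by (auto simp: grid_event_def)
  also have "\<dots> \<in> sets M" by measurable
  finally show ?thesis .
qed

lemma decseq_grid_event: "decseq (grid_event D a b m)"
proof (rule decseq_SucI, rule subsetI)
  fix n \<omega> assume \<omega>: "\<omega> \<in> grid_event D a b m (Suc n)"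
  have "B (a + real i * (b - a) / 2 ^ n) \<omega> \<in> core D m" if "i \<le> 2 ^ n" for i
  proof -
    have "B (a + real (2 * i) * (b - a) / 2 ^ Suc n) \<omega> \<in> core D m"
      using \<omega> that unfolding grid_event_def by (simp del: of_nat_mult)
    then show ?thesis by simp
  qed
  then show "\<omega> \<in> grid_event D a b m n"
    using \<omega> by (simp add: grid_event_def)
qed

lemma continuous_path_on: "\<omega> \<in> space M \<Longrightarrow> 0 \<le> a \<Longrightarrow> continuous_on {a..b} (\<lambda>t. B t \<omega>)"
  by (rule continuous_on_subset[OF continuous_paths]) auto

lemma INT_grid_event:
  assumes "0 \<le> a" "a \<le> b"
  shows "(\<Inter>n. grid_event D a b m n) = stay (core D m) a b"
proof (intro equalityI subsetI)
  fix \<omega> assume \<omega>: "\<omega> \<in> (\<Inter>n. grid_event D a b m n)"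
  then have sp: "\<omega> \<in> space M" by (auto simp: grid_event_def)
  have "inverse (real (Suc m)) \<le> infdist (B u \<omega>) (- D)" if "u \<in> {a..b}" for u
  proof (rule dyadic_grid_le[where f="\<lambda>u. infdist (B u \<omega>) (- D)", OF _ that])
    show "continuous_on {a..b} (\<lambda>u. infdist (B u \<omega>) (- D))"
      by (intro continuous_intros continuous_path_on sp assms)
    show "inverse (real (Suc m)) \<le> infdist (B (a + real i * (b - a) / 2 ^ n) \<omega>) (- D)"
      if "i \<le> 2 ^ n" for n i
      using \<omega> that unfolding grid_event_def core_def by blast
  qed
  then show "\<omega> \<in> stay (core D m) a b" using sp by (auto simp: stay_def core_def)
next
  fix \<omega> assume \<omega>: "\<omega> \<in> stay (core D m) a b"
  have "a + real i * (b - a) / 2 ^ n \<in> {a..b}" if "i \<le> 2 ^ n" for n i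
  proof -
    have "real i / 2 ^ n \<le> 1"
      using that by (metis divide_le_eq_1_pos of_nat_le_iff of_nat_numeral of_nat_power zero_less_numeral zero_less_power)
    then have "real i / 2 ^ n * (b - a) \<le> 1 * (b - a)" using assms by (intro mult_right_mono) auto
    then show ?thesis using assms by simp
  qed
  then show "\<omega> \<in> (\<Inter>n. grid_event D a b m n)"
    using \<omega> unfolding stay_def grid_event_def by blast
qed

text \<open>A path segment is compact, so its distance to the complement attains a positive minimum.
  For \<open>D = UNIV\<close> the complement would be empty, \<open>infdist\<close> would be 0 and
  every core would be empty.\<close>

lemma UN_stay_core:
  assumes "0 \<le> a" "a \<le> b" and D: "open D" "D \<noteq> UNIV"
  shows "(\<Union>m. stay (core D m) a b) = stay D a b"
proof (intro equalityI subsetI)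
  fix \<omega> assume "\<omega> \<in> (\<Union>m. stay (core D m) a b)"
  then obtain m where m: "\<omega> \<in> stay (core D m) a b" by blast
  have "core D m \<subseteq> D"
  proof
    fix x assume "x \<in> core D m"
    then have "0 < infdist x (- D)" by (auto simp: core_def intro: less_le_trans[rotated])
    then show "x \<in> D" by (metis ComplI infdist_zero less_irrefl)
  qed
  then show "\<omega> \<in> stay D a b" using m by (auto simp: stay_def)
next
  fix \<omega> assume \<omega>: "\<omega> \<in> stay D a b"
  then have sp: "\<omega> \<in> space M" by (simp add: stay_def)
  have "\<exists>u\<in>{a..b}. \<forall>v\<in>{a..b}. infdist (B u \<omega>) (- D) \<le> infdist (B v \<omega>) (- D)"
    using assms by (intro continuous_attains_inf) (auto intro!: continuous_intros continuous_path_on sp)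
  then obtain u where u: "u \<in> {a..b}" "\<And>v. v \<in> {a..b} \<Longrightarrow> infdist (B u \<omega>) (- D) \<le> infdist (B v \<omega>) (- D)"
    by blast
  have "B u \<omega> \<in> D" using \<omega> u by (auto simp: stay_def)
  then have "infdist (B u \<omega>) (- D) > 0"
    using D by (intro infdist_pos_not_in_closed) (auto simp: closed_def)
  then obtain m where "inverse (real (Suc m)) < infdist (B u \<omega>) (- D)"
    using reals_Archimedean by blast
  then have "\<omega> \<in> stay (core D m) a b"
    using sp u(2) unfolding stay_def core_def by (auto intro: order_trans[OF less_imp_le])
  then show "\<omega> \<in> (\<Union>m. stay (core D m) a b)" by blast
qed

lemma incseq_stay_core: "incseq (\<lambda>m. stay (core D m) a b)"
proof (rule incseq_SucI)
  fix m
  have "core D m \<subseteq> core D (Suc m)"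
  proof
    have "inverse (real (Suc (Suc m))) \<le> inverse (real (Suc m))" by (intro le_imp_inverse_le) auto
    then show "x \<in> core D (Suc m)" if "x \<in> core D m" for x
      using that unfolding core_def mem_Collect_eq by (rule order_trans)
  qed
  then show "stay (core D m) a b \<subseteq> stay (core D (Suc m)) a b"
    by (auto simp: stay_def)
qed

lemma stay_core_measurable:
  assumes "0 \<le> a" "a \<le> b"
  shows "stay (core D m) a b \<in> sets M"
  unfolding INT_grid_event[OF assms, symmetric]
  by (intro sets.countable_INT) (auto intro: grid_event_measurable assms)

lemma stay_measurable:
  assumes "0 \<le> a" "a \<le> b" "open D" "D \<noteq> UNIV"
  shows "stay D a b \<in> sets M"
  unfolding UN_stay_core[OF assms, symmetric]
  by (intro sets.countable_UN) (auto intro: stay_core_measurable assms)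

lemma alive_measurable [measurable]:
  assumes D: "open D" "D \<noteq> UNIV"
  shows "alive D s \<in> sets M"
proof (cases "s > 0")
  case True
  have "alive D s = (\<Inter>j. stay D (s / (real j + 1)) s)"
  proof (intro equalityI subsetI)
    fix \<omega> assume \<omega>: "\<omega> \<in> alive D s"
    have "0 < u" if "s / (real j + 1) \<le> u" for j u
      by (rule less_le_trans[OF _ that]) (use True in simp)
    then show "\<omega> \<in> (\<Inter>j. stay D (s / (real j + 1)) s)"
      using \<omega> by (auto simp: alive_def stay_def)
  next
    fix \<omega> assume \<omega>: "\<omega> \<in> (\<Inter>j. stay D (s / (real j + 1)) s)"
    have "B u \<omega> \<in> D" if u: "u \<in> {0<..s}" for u
    proof -
      obtain j :: nat where "s / u < real j" using reals_Archimedean2 by blast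
      then have "s \<le> u * (real j + 1)" using u True by (simp add: field_simps)
      then have "s / (real j + 1) \<le> u" by (simp add: pos_divide_le_eq)
      then show ?thesis using \<omega> u by (auto simp: stay_def)
    qed
    then show "\<omega> \<in> alive D s" using \<omega> by (auto simp: alive_def stay_def)
  qed
  moreover have "stay D (s / (real j + 1)) s \<in> sets M" for j
    using True by (intro stay_measurable D) (auto simp: field_simps)
  ultimately show ?thesis by auto
next
  case False
  then have "alive D s = space M" by (auto simp: alive_def)
  then show ?thesis by simp
qed

lemma AE_alive_eq_stay:
  assumes "z \<in> D"
  shows "AE \<omega> in M. (indicator (alive D s) \<omega> :: real) = indicator (stay D 0 s) \<omega>"
  using start
proof eventually_elim
  case (elim \<omega>)
  then have "\<omega> \<in> alive D s \<longleftrightarrow> \<omega> \<in> stay D 0 s"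
    using assms unfolding alive_def stay_def
    by (auto simp: less_eq_real_def)
  then show ?case by (simp add: indicator_def)
qed

lemma planar_gauss_integral_bounded:
  fixes F :: "real \<times> real \<Rightarrow> real"
  assumes "h > 0" "F \<in> borel_measurable borel" "\<And>x. \<bar>F x\<bar> \<le> C"
  shows "\<bar>\<integral>w. F (x + w) \<partial>planar_gauss h\<bar> \<le> C"
proof -
  interpret N: prob_space "planar_gauss h" by (rule prob_space_planar_gauss) fact
  note assms(2)[measurable]
  have i: "integrable (planar_gauss h) (\<lambda>w. F (x + w))"
    using assms(3) by (intro N.integrable_const_bound[where B=C]) auto
  have b: "F y \<le> C" "- C \<le> F y" for y using assms(3)[of y] by linarith+
  have "(\<integral>w. F (x + w) \<partial>planar_gauss h) \<le> C"
    by (intro N.integral_le_const i AE_I2 b)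
  moreover have "- C \<le> (\<integral>w. F (x + w) \<partial>planar_gauss h)"
    by (intro N.integral_ge_const i AE_I2 b)
  ultimately show ?thesis by linarith
qed

lemma borel_measurable_planar_gauss_integral:
  fixes F :: "real \<times> real \<Rightarrow> real"
  assumes "h > 0" and [measurable]: "F \<in> borel_measurable borel"
  shows "(\<lambda>x. \<integral>w. F (x + w) \<partial>planar_gauss h) \<in> borel_measurable borel"
proof -
  interpret N: prob_space "planar_gauss h" by (rule prob_space_planar_gauss) fact
  show ?thesis by measurable
qed

text \<open>Two bounded limits of \<open>markov_grid\<close>: dyadic refinement for a fixed core,
  and growing cores. Time \<open>s = 0\<close> is treated apart, since the grid degenerates there;
  only the law of the first increment enters.\<close>

lemma markov_alive:
  fixes F :: "real \<times> real \<Rightarrow> real"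
  assumes D: "open D" "D \<noteq> UNIV" "z \<in> D" and s: "s \<ge> 0" and h: "h > 0"
    and F [measurable]: "F \<in> borel_measurable borel" and bnd: "\<And>x. \<bar>F x\<bar> \<le> C"
  shows "expectation (\<lambda>\<omega>. indicator (alive D s) \<omega> * F (B (s + h) \<omega>)) =
    expectation (\<lambda>\<omega>. indicator (alive D s) \<omega> * (\<integral>w. F (B s \<omega> + w) \<partial>planar_gauss h))"
proof -
  note P = prob_space_axioms
  note borel_measurable_planar_gauss_integral[OF h F, measurable]
  have B_meas [measurable]: "B s \<in> borel_measurable M" "B (s + h) \<in> borel_measurable M" "B 0 \<in> borel_measurable M"
      "B h \<in> borel_measurable M"
    using s h by (auto intro: measurable_B)
  note alive_measurable[OF D(1,2), measurable]
  show ?thesis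
  proof (cases "s = 0")
    case True
    have "expectation (\<lambda>\<omega>. indicator (alive D s) \<omega> * F (B (s + h) \<omega>))
        = expectation (\<lambda>\<omega>. F (z + (B (s + h) \<omega> - B s \<omega>)))"
      using start AE_space True by (intro integral_cong_AE) (auto simp: alive_def elim: eventually_elim2)
    also have "\<dots> = (\<integral>w. F (z + w) \<partial>distr M borel (\<lambda>\<omega>. B (s + h) \<omega> - B s \<omega>))"
      by (subst integral_distr) auto
    also have "\<dots> = (\<integral>w. F (z + w) \<partial>planar_gauss h)"
      by (simp only: distr_increment[OF s h])
    also have "\<dots> = expectation (\<lambda>\<omega>. \<integral>w. F (z + w) \<partial>planar_gauss h)"
      using prob_space by simp
    also have "\<dots> = expectation (\<lambda>\<omega>. indicator (alive D s) \<omega> * (\<integral>w. F (B s \<omega> + w) \<partial>planar_gauss h))"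
      using start AE_space True by (intro integral_cong_AE) (auto simp: alive_def elim: eventually_elim2)
    finally show ?thesis .
  next
    case False
    with s have s0: "s > 0" by simp
    let ?P = "\<lambda>x. \<integral>w. F (x + w) \<partial>planar_gauss h"
    have core: "expectation (\<lambda>\<omega>. indicator (stay (core D m) 0 s) \<omega> * F (B (s + h) \<omega>)) =
        expectation (\<lambda>\<omega>. indicator (stay (core D m) 0 s) \<omega> * ?P (B s \<omega>))" for m
    proof (rule LIMSEQ_unique)
      have eq: "expectation (\<lambda>\<omega>. indicator (grid_event D 0 s m n) \<omega> * F (B (s + h) \<omega>)) =
          expectation (\<lambda>\<omega>. indicator (grid_event D 0 s m n) \<omega> * ?P (B s \<omega>))" for n
        using markov_grid[OF s0 h _ F bnd borel_closed[OF closed_core], of "2 ^ n" D m]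
        by (simp add: grid_event_def)
      show "(\<lambda>n. expectation (\<lambda>\<omega>. indicator (grid_event D 0 s m n) \<omega> * F (B (s + h) \<omega>)))
          \<longlonglongrightarrow> expectation (\<lambda>\<omega>. indicator (stay (core D m) 0 s) \<omega> * F (B (s + h) \<omega>))"
        unfolding INT_grid_event[OF order_refl s, symmetric]
        using s by (intro expectation_indicator_decseq[OF P] decseq_grid_event grid_event_measurable)
          (auto intro: bnd)
      show "(\<lambda>n. expectation (\<lambda>\<omega>. indicator (grid_event D 0 s m n) \<omega> * F (B (s + h) \<omega>)))
          \<longlonglongrightarrow> expectation (\<lambda>\<omega>. indicator (stay (core D m) 0 s) \<omega> * ?P (B s \<omega>))"
        unfolding INT_grid_event[OF order_refl s, symmetric] eq
        using s by (intro expectation_indicator_decseq[OF P] decseq_grid_event grid_event_measurable)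
          (auto intro: planar_gauss_integral_bounded[OF h F bnd])
    qed
    have stay: "expectation (\<lambda>\<omega>. indicator (stay D 0 s) \<omega> * F (B (s + h) \<omega>)) =
        expectation (\<lambda>\<omega>. indicator (stay D 0 s) \<omega> * ?P (B s \<omega>))"
    proof (rule LIMSEQ_unique)
      show "(\<lambda>m. expectation (\<lambda>\<omega>. indicator (stay (core D m) 0 s) \<omega> * F (B (s + h) \<omega>)))
          \<longlonglongrightarrow> expectation (\<lambda>\<omega>. indicator (stay D 0 s) \<omega> * F (B (s + h) \<omega>))"
        unfolding UN_stay_core[OF order_refl s D(1,2), symmetric]
        using s by (intro expectation_indicator_incseq[OF P] incseq_stay_core stay_core_measurable)
          (auto intro: bnd)
      show "(\<lambda>m. expectation (\<lambda>\<omega>. indicator (stay (core D m) 0 s) \<omega> * F (B (s + h) \<omega>)))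
          \<longlonglongrightarrow> expectation (\<lambda>\<omega>. indicator (stay D 0 s) \<omega> * ?P (B s \<omega>))"
        unfolding UN_stay_core[OF order_refl s D(1,2), symmetric] core
        using s by (intro expectation_indicator_incseq[OF P] incseq_stay_core stay_core_measurable)
          (auto intro: planar_gauss_integral_bounded[OF h F bnd])
    qed
    note [measurable] = stay_measurable[OF order_refl s D(1,2)]
    have "expectation (\<lambda>\<omega>. indicator (alive D s) \<omega> * F (B (s + h) \<omega>)) =
        expectation (\<lambda>\<omega>. indicator (stay D 0 s) \<omega> * F (B (s + h) \<omega>))"
      by (rule integral_cong_AE) (use AE_alive_eq_stay[OF D(3), of s] in \<open>auto elim!: eventually_mono\<close>)
    also note stay
    also have "expectation (\<lambda>\<omega>. indicator (stay D 0 s) \<omega> * ?P (B s \<omega>)) =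
        expectation (\<lambda>\<omega>. indicator (alive D s) \<omega> * ?P (B s \<omega>))"
      by (rule integral_cong_AE) (use AE_alive_eq_stay[OF D(3), of s] in \<open>auto elim!: eventually_mono\<close>)
    finally show ?thesis .
  qed
qed

end

section \<open>Exit times\<close>

context planar_brownian_motion
begin

abbreviation tau :: "(real \<times> real) set \<Rightarrow> 'w \<Rightarrow> real" where
  "tau D \<omega> \<equiv> real_of_ereal (exit_time B D \<omega>)"

lemma exit_time_nonneg: "0 \<le> exit_time B D \<omega>"
  unfolding exit_time_def by (rule INF_greatest) auto

lemma exit_time_geI:
  "(\<And>t. t > 0 \<Longrightarrow> B t \<omega> \<notin> D \<Longrightarrow> y \<le> ereal t) \<Longrightarrow> y \<le> exit_time B D \<omega>"
  unfolding exit_time_def by (rule INF_greatest) auto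

lemma exit_time_le: "t > 0 \<Longrightarrow> B t \<omega> \<notin> D \<Longrightarrow> exit_time B D \<omega> \<le> ereal t"
  unfolding exit_time_def by (rule INF_lower) auto

lemma exit_time_ge_alive: "\<omega> \<in> alive D s \<Longrightarrow> ereal s \<le> exit_time B D \<omega>"
  unfolding exit_time_def alive_def
  by (rule INF_greatest) (force simp: not_le dest: less_imp_le)

lemma exit_time_le_not_alive:
  assumes "\<omega> \<in> space M" "\<omega> \<notin> alive D s"
  shows "exit_time B D \<omega> \<le> ereal s"
proof -
  obtain u where "0 < u" "u \<le> s" "B u \<omega> \<notin> D" using assms by (auto simp: alive_def)
  then show ?thesis using exit_time_le[of u \<omega> D] by (meson ereal_less_eq(3) order_trans)
qed

lemma ereal_tau: "exit_time B D \<omega> < \<infinity> \<Longrightarrow> ereal (tau D \<omega>) = exit_time B D \<omega>"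
  using exit_time_nonneg[of D \<omega>] by (intro ereal_real') auto

lemma tau_nonneg: "0 \<le> tau D \<omega>"
  using exit_time_nonneg by (rule real_of_ereal_pos)

text \<open>Rational times suffice because \<open>alive\<close> decreases in time; this yields
  measurability of the exit time.\<close>

lemma exit_time_less_iff:
  assumes "\<omega> \<in> space M"
  shows "exit_time B D \<omega> < y \<longleftrightarrow> (\<exists>q::rat. ereal (real_of_rat q) < y \<and> \<omega> \<notin> alive D (real_of_rat q))"
proof
  assume "exit_time B D \<omega> < y"
  then obtain t where t: "t > 0" "B t \<omega> \<notin> D" "ereal t < y"
    unfolding exit_time_def INF_less_iff by auto
  then obtain q where q: "ereal t < ereal (real_of_rat q)" "ereal (real_of_rat q) < y"
    using ereal_dense3 by blast
  then have "\<omega> \<notin> alive D (real_of_rat q)"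
    using t by (auto simp: alive_def)
  then show "\<exists>q::rat. ereal (real_of_rat q) < y \<and> \<omega> \<notin> alive D (real_of_rat q)"
    using q by blast
next
  assume "\<exists>q::rat. ereal (real_of_rat q) < y \<and> \<omega> \<notin> alive D (real_of_rat q)"
  then show "exit_time B D \<omega> < y"
    using exit_time_le_not_alive[OF assms] by (meson le_less_trans)
qed

lemma exit_time_measurable [measurable]:
  assumes D: "open D" "D \<noteq> UNIV"
  shows "exit_time B D \<in> borel_measurable M"
proof (rule borel_measurableI_less)
  fix y
  have "{\<omega>\<in>space M. exit_time B D \<omega> < y} =
      (\<Union>q\<in>{q::rat. ereal (real_of_rat q) < y}. space M - alive D (real_of_rat q))"
    using exit_time_less_iff by auto
  also have "\<dots> \<in> sets M"
    using alive_measurable[OF D] by (intro sets.countable_UN'') auto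
  finally show "{\<omega>\<in>space M. exit_time B D \<omega> < y} \<in> sets M" .
qed

lemma path_tendsto:
  assumes "\<omega> \<in> space M" "t \<longlonglongrightarrow> s" "\<And>n. 0 \<le> t n"
  shows "(\<lambda>n. B (t n) \<omega>) \<longlonglongrightarrow> B s \<omega>"
proof -
  have "0 \<le> s" using assms(2,3) by (intro LIMSEQ_le_const) auto
  then show ?thesis
    using continuous_paths[OF assms(1)] assms(2,3)
    by (auto simp: continuous_on_sequentially comp_def)
qed

text \<open>The exit time is rounded up to multiples of 1 / (n + 1). The process at a random time
  with countably many values is measurable, and path continuity gives the limit. Where the exit time
  is infinite, \<open>tau\<close> is 0 and the case distinction in \<open>exit_position\<close>
  applies.\<close>

lemma exit_position_measurable [measurable]:
  assumes D: "open D" "D \<noteq> UNIV"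
  shows "exit_position B D \<in> borel_measurable M"
proof -
  note exit_time_measurable[OF D, measurable]
  have [measurable]: "tau D \<in> borel_measurable M" by measurable
  define k where "k = (\<lambda>n \<omega>. nat \<lceil>tau D \<omega> * (real n + 1)\<rceil>)"
  have k [measurable]: "k n \<in> measurable M (count_space UNIV)" for n
    unfolding k_def by measurable
  define X where "X = (\<lambda>n \<omega>. B (real (k n \<omega>) / (real n + 1)) \<omega>)"
  have [measurable]: "X n \<in> borel_measurable M" for n
    unfolding X_def by (rule measurable_compose_countable[OF measurable_B k]) simp
  have lim: "(\<lambda>n. X n \<omega>) \<longlonglongrightarrow> B (tau D \<omega>) \<omega>" if "\<omega> \<in> space M" for \<omega>
    unfolding X_def
  proof (rule path_tendsto[OF that])
    have b: "tau D \<omega> \<le> real (k n \<omega>) / (real n + 1)"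
       "real (k n \<omega>) / (real n + 1) \<le> tau D \<omega> + 1 / (real n + 1)" for n
    proof -
      have "tau D \<omega> * (real n + 1) \<le> real (k n \<omega>)"
        unfolding k_def by (rule of_nat_ceiling)
      then show "tau D \<omega> \<le> real (k n \<omega>) / (real n + 1)" by (simp add: pos_le_divide_eq)
      have "0 \<le> tau D \<omega> * (real n + 1)" using tau_nonneg by simp
      then have "real (k n \<omega>) \<le> tau D \<omega> * (real n + 1) + 1"
        unfolding k_def by linarith
      then have "real (k n \<omega>) / (real n + 1) \<le> (tau D \<omega> * (real n + 1) + 1) / (real n + 1)"
        by (intro divide_right_mono) auto
      then show "real (k n \<omega>) / (real n + 1) \<le> tau D \<omega> + 1 / (real n + 1)"
        by (simp add: add_divide_distrib)
    qed
    have "(\<lambda>n. tau D \<omega> + 1 / (real n + 1)) \<longlonglongrightarrow> tau D \<omega> + 0"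
      using LIMSEQ_inverse_real_of_nat by (intro tendsto_intros) (simp add: inverse_eq_divide add.commute)
    then have up: "(\<lambda>n. tau D \<omega> + 1 / (real n + 1)) \<longlonglongrightarrow> tau D \<omega>" by simp
    show "(\<lambda>n. real (k n \<omega>) / (real n + 1)) \<longlonglongrightarrow> tau D \<omega>"
      by (rule tendsto_sandwich[OF always_eventually always_eventually tendsto_const up]) (intro allI b)+
  qed auto
  have "(\<lambda>\<omega>. B (tau D \<omega>) \<omega>) \<in> borel_measurable M"
    by (rule borel_measurable_LIMSEQ_metric[OF _ lim]) auto
  then show ?thesis
    unfolding exit_position_def[abs_def] by measurable
qed

text \<open>If the path were in the open set \<open>D\<close> at time \<open>tau\<close>, it would
  stay there for a further time e, and no time outside \<open>D\<close> could lie below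
  \<open>tau + e / 2\<close>; so the infimum is attained. The times
  \<open>tau * (1 - 1 / (n + 1))\<close> exhibit the exit point as a limit of points of
  \<open>D\<close>.\<close>

lemma exit_path:
  assumes \<omega>: "\<omega> \<in> space M" "B 0 \<omega> \<in> D" and D: "open D" and fin: "exit_time B D \<omega> < \<infinity>"
  shows "0 < tau D \<omega>" "exit_position B D \<omega> = B (tau D \<omega>) \<omega>" "B (tau D \<omega>) \<omega> \<notin> D"
    "\<And>u. 0 \<le> u \<Longrightarrow> u < tau D \<omega> \<Longrightarrow> B u \<omega> \<in> D" "B (tau D \<omega>) \<omega> \<in> closure D"
proof -
  show pos: "exit_position B D \<omega> = B (tau D \<omega>) \<omega>" using fin by (simp add: exit_position_def)
  show before: "B u \<omega> \<in> D" if "0 \<le> u" "u < tau D \<omega>" for u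
  proof (cases "u = 0")
    case False
    show ?thesis
    proof (rule ccontr)
      assume "B u \<omega> \<notin> D"
      then have "exit_time B D \<omega> \<le> ereal u" using that False by (intro exit_time_le) auto
      then show False using that ereal_tau[OF fin] by (metis ereal_less_eq(3) not_le)
    qed
  qed (use \<omega> in simp)
  show notin: "B (tau D \<omega>) \<omega> \<notin> D"
  proof
    assume "B (tau D \<omega>) \<omega> \<in> D"
    have "openin (top_of_set {0..}) ({0..} \<inter> (\<lambda>t. B t \<omega>) -` D)"
      using continuous_paths[OF \<omega>(1)] D by (rule continuous_openin_preimage_gen)
    then obtain T where T: "open T" "{0..} \<inter> (\<lambda>t. B t \<omega>) -` D = {0..} \<inter> T"
      by (auto simp: openin_open)
    then have "tau D \<omega> \<in> T" using \<open>B (tau D \<omega>) \<omega> \<in> D\<close> tau_nonneg[of D \<omega>] by auto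
    then obtain e where e: "e > 0" "\<And>u. dist u (tau D \<omega>) < e \<Longrightarrow> u \<in> T"
      using T(1) by (metis open_dist)
    have "ereal (tau D \<omega> + e / 2) \<le> exit_time B D \<omega>"
    proof (rule exit_time_geI)
      fix t assume t: "t > 0" "B t \<omega> \<notin> D"
      show "ereal (tau D \<omega> + e / 2) \<le> ereal t"
      proof (rule ccontr)
        assume "\<not> ?thesis"
        then have t2: "t < tau D \<omega> + e / 2" by simp
        show False
        proof (cases "t < tau D \<omega>")
          case True
          then show False using before[of t] t by auto
        next
          case False
          then have "dist t (tau D \<omega>) < e" using t2 e(1) by (simp add: dist_real_def)
          then have "t \<in> T" by (rule e(2))
          then have "t \<in> {0..} \<inter> T" using t by simp
          then have "t \<in> {0..} \<inter> (\<lambda>t. B t \<omega>) -` D" unfolding T(2) .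
          then show False using t by simp
        qed
      qed
    qed
    then have "ereal (tau D \<omega> + e / 2) \<le> ereal (tau D \<omega>)"
      by (rule order_trans[OF _ eq_refl[OF ereal_tau[OF fin, symmetric]]])
    then show False using e(1) by simp
  qed
  show tpos: "0 < tau D \<omega>"
    using notin \<omega>(2) tau_nonneg[of D \<omega>] by (metis less_eq_real_def)
  have "(\<lambda>n. B (tau D \<omega> * (1 - 1 / (real n + 1))) \<omega>) \<longlonglongrightarrow> B (tau D \<omega>) \<omega>"
  proof (rule path_tendsto[OF \<omega>(1)])
    have "(\<lambda>n. tau D \<omega> * (1 - 1 / (real n + 1))) \<longlonglongrightarrow> tau D \<omega> * (1 - 0)"
      using LIMSEQ_inverse_real_of_nat by (intro tendsto_intros) (simp add: inverse_eq_divide add.commute)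
    then show "(\<lambda>n. tau D \<omega> * (1 - 1 / (real n + 1))) \<longlonglongrightarrow> tau D \<omega>" by simp
    show "0 \<le> tau D \<omega> * (1 - 1 / (real n + 1))" for n
      using tpos by (intro mult_nonneg_nonneg) (auto simp: field_simps)
  qed
  moreover have "B (tau D \<omega> * (1 - 1 / (real n + 1))) \<omega> \<in> D" for n
    using tpos by (intro before mult_nonneg_nonneg) (auto simp: field_simps)
  ultimately show "B (tau D \<omega>) \<omega> \<in> closure D"
    unfolding closure_sequential
    by (intro exI[of _ "\<lambda>n. B (tau D \<omega> * (1 - 1 / (real n + 1))) \<omega>"]) auto
qed

lemma exit_time_eqI:
  assumes "t > 0" "B t \<omega> \<notin> D" "\<And>u. 0 < u \<Longrightarrow> u < t \<Longrightarrow> B u \<omega> \<in> D"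
  shows "exit_time B D \<omega> = ereal t" "exit_position B D \<omega> = B t \<omega>"
proof -
  show "exit_time B D \<omega> = ereal t"
  proof (rule antisym)
    show "ereal t \<le> exit_time B D \<omega>"
      unfolding exit_time_def using assms(3) by (intro INF_greatest) (force simp: not_le)
  qed (use assms in \<open>auto intro: exit_time_le\<close>)
  then show "exit_position B D \<omega> = B t \<omega>" by (simp add: exit_position_def)
qed

text \<open>Being alive at \<open>T\<close> confines the increment over \<open>[0, T]\<close> to a
  ball of radius 2 R, and the Gaussian density is at most 1 / (2 pi T). That this tends to 0 as
  \<open>T\<close> grows is all that is used.\<close>

lemma prob_alive_le:
  assumes D: "open D" "z \<in> D" and bd: "\<And>x. x \<in> D \<Longrightarrow> norm x \<le> R" and T: "T > 0"
  shows "prob (alive D T) \<le> measure lborel (cball (0 :: real \<times> real) (2 * R)) / (2 * pi * T)"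
proof -
  have "bounded D" unfolding bounded_iff using bd by blast
  then have DU: "D \<noteq> UNIV" using not_bounded_UNIV by blast
  have [measurable]: "B 0 \<in> borel_measurable M" "B (0 + T) \<in> borel_measurable M" "B T \<in> borel_measurable M"
    using T by (auto intro: measurable_B)
  note [measurable] = alive_measurable[OF D(1) DU]
  let ?K = "cball (0 :: real \<times> real) (2 * R)"
  have [measurable]: "?K \<in> sets borel" by simp
  have fin: "emeasure lborel ?K < \<infinity>" by (rule emeasure_bounded_finite) simp
  have "emeasure M (alive D T) \<le> emeasure M {\<omega>\<in>space M. B (0 + T) \<omega> - B 0 \<omega> \<in> ?K}"
  proof (rule emeasure_mono_AE)
    show "AE \<omega> in M. \<omega> \<in> alive D T \<longrightarrow> \<omega> \<in> {\<omega>\<in>space M. B (0 + T) \<omega> - B 0 \<omega> \<in> ?K}"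
      using start
    proof eventually_elim
      case (elim \<omega>)
      show ?case
      proof
        assume "\<omega> \<in> alive D T"
        then have "B T \<omega> \<in> D" "\<omega> \<in> space M" using T by (auto simp: alive_def)
        then show "\<omega> \<in> {\<omega>\<in>space M. B (0 + T) \<omega> - B 0 \<omega> \<in> ?K}"
          using bd[of "B T \<omega>"] bd[OF D(2)] norm_triangle_ineq4[of "B T \<omega>" "B 0 \<omega>"] elim by simp
      qed
    qed
  qed measurable
  also have "\<dots> = emeasure (distr M borel (\<lambda>\<omega>. B (0 + T) \<omega> - B 0 \<omega>)) ?K"
    using T by (subst emeasure_distr) (auto intro!: arg_cong2[where f=emeasure])
  also have "\<dots> = emeasure (planar_gauss T) ?K"
    by (subst distr_increment) (use T in auto)
  also have "\<dots> = (\<integral>\<^sup>+w. (case w of (x, y) \<Rightarrow> ennreal (normal_density 0 (sqrt T) x * normal_density 0 (sqrt T) y)) * indicator ?K w \<partial>lborel)"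
    unfolding planar_gauss_def
  proof (rule emeasure_density)
    show "(\<lambda>(x, y). ennreal (normal_density 0 (sqrt T) x * normal_density 0 (sqrt T) y)) \<in> borel_measurable lborel"
      unfolding case_prod_beta by measurable
  qed simp
  also have "\<dots> \<le> (\<integral>\<^sup>+w. ennreal (1 / (2 * pi * T)) * indicator ?K w \<partial>lborel)"
  proof (intro nn_integral_mono mult_right_mono)
    fix w :: "real \<times> real"
    have nd: "normal_density 0 (sqrt T) x \<le> 1 / sqrt (2 * pi * T)" for x
      using T by (simp add: normal_density_def field_simps)
    have "normal_density 0 (sqrt T) x * normal_density 0 (sqrt T) y \<le> 1 / sqrt (2 * pi * T) * (1 / sqrt (2 * pi * T))" for x y
      by (intro mult_mono nd) (use T in auto)
    also have "1 / sqrt (2 * pi * T) * (1 / sqrt (2 * pi * T)) = 1 / (2 * pi * T)"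
      using T by (simp add: real_sqrt_mult[symmetric] field_simps)
    finally show "(case w of (x, y) \<Rightarrow> ennreal (normal_density 0 (sqrt T) x * normal_density 0 (sqrt T) y)) \<le> ennreal (1 / (2 * pi * T))"
      by (auto split: prod.split intro!: ennreal_leI)
  qed auto
  also have "\<dots> = ennreal (1 / (2 * pi * T)) * emeasure lborel ?K"
    by (subst nn_integral_cmult) auto
  also have "\<dots> = ennreal (measure lborel ?K / (2 * pi * T))"
    using fin T by (subst emeasure_eq_ennreal_measure) (auto simp: ennreal_mult[symmetric])
  finally show ?thesis
    using T by (simp add: emeasure_eq_measure)
qed

lemma prob_alive_tendsto_0:
  assumes D: "open D" "z \<in> D" "bounded D"
  shows "(\<lambda>n. prob (alive D (real (Suc n)))) \<longlonglongrightarrow> 0"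
proof -
  obtain R where R: "\<And>x. x \<in> D \<Longrightarrow> norm x \<le> R" using D(3) by (auto simp: bounded_iff)
  let ?c = "measure lborel (cball (0 :: real \<times> real) (2 * R)) / (2 * pi)"
  have "(\<lambda>n. ?c * inverse (real (Suc n))) \<longlonglongrightarrow> ?c * 0"
    by (intro tendsto_intros LIMSEQ_inverse_real_of_nat)
  then have lim: "(\<lambda>n. ?c * inverse (real (Suc n))) \<longlonglongrightarrow> 0" by simp
  have "prob (alive D (real (Suc n))) \<le> ?c * inverse (real (Suc n))" for n
    using prob_alive_le[OF D(1,2) R, of "real (Suc n)"] by (simp add: field_simps)
  then show ?thesis
    by (intro tendsto_sandwich[OF always_eventually always_eventually tendsto_const lim]) auto
qed

lemma AE_exit_time_finite:
  assumes D: "open D" "z \<in> D" "bounded D"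
  shows "AE \<omega> in M. exit_time B D \<omega> < \<infinity>"
proof -
  have DU: "D \<noteq> UNIV" using D(3) not_bounded_UNIV by blast
  note [measurable] = alive_measurable[OF D(1) DU] exit_time_measurable[OF D(1) DU]
  have le: "prob {\<omega>\<in>space M. \<not> exit_time B D \<omega> < \<infinity>} \<le> prob (alive D (real (Suc n)))" for n
  proof (rule finite_measure_mono)
    show "{\<omega>\<in>space M. \<not> exit_time B D \<omega> < \<infinity>} \<subseteq> alive D (real (Suc n))"
    proof
      fix \<omega> assume "\<omega> \<in> {\<omega>\<in>space M. \<not> exit_time B D \<omega> < \<infinity>}"
      then show "\<omega> \<in> alive D (real (Suc n))"
        using exit_time_le_not_alive[of \<omega> D "real (Suc n)"]
        by (cases "exit_time B D \<omega>") auto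
    qed
  qed measurable
  have "prob {\<omega>\<in>space M. \<not> exit_time B D \<omega> < \<infinity>} \<le> 0"
    using le by (intro LIMSEQ_le_const[OF prob_alive_tendsto_0[OF D]]) auto
  then have "prob {\<omega>\<in>space M. \<not> exit_time B D \<omega> < \<infinity>} = 0"
    by (simp add: antisym)
  then show ?thesis
    by (subst AE_iff_measurable[OF _ refl]) (auto simp: emeasure_eq_measure)
qed

end

section \<open>The exit principle\<close>

context planar_brownian_motion
begin

text \<open>Finiteness is part of the event so that the dummy value 0 of
  \<open>exit_position\<close> never counts as an exit.\<close>

definition exits_in :: "(real \<times> real) set \<Rightarrow> (real \<times> real) set \<Rightarrow> 'w set" where
  "exits_in D V = {\<omega>\<in>space M. exit_time B D \<omega> < \<infinity> \<and> exit_position B D \<omega> \<in> V}"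

lemma exits_in_measurable [measurable]:
  assumes "open D" "D \<noteq> UNIV" and [measurable]: "V \<in> sets borel"
  shows "exits_in D V \<in> sets M"
proof -
  note [measurable] = exit_time_measurable[OF assms(1,2)] exit_position_measurable[OF assms(1,2)]
  show ?thesis unfolding exits_in_def by measurable
qed

definition grid_exit :: "(real \<times> real) set \<Rightarrow> (real \<times> real) set \<Rightarrow> real \<Rightarrow> nat \<Rightarrow> 'w set" where
  "grid_exit D V h k = {\<omega> \<in> alive D (real k * h) - alive D (real (Suc k) * h). B (real (Suc k) * h) \<omega> \<in> V}"

lemma alive_antimono: "s \<le> t \<Longrightarrow> alive D t \<subseteq> alive D s"
  by (auto simp: alive_def)

text \<open>A telescoping sum over the grid of mesh \<open>h\<close>; the exit is recorded at the first grid time after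
  it.\<close>

lemma grid_exit_principle:
  fixes F :: "real \<times> real \<Rightarrow> real"
  assumes D: "open D" "D \<noteq> UNIV" "z \<in> D" and h: "h > 0"
    and F [measurable]: "F \<in> borel_measurable borel" and bnd: "\<And>x. \<bar>F x\<bar> \<le> C'"
    and sub: "\<And>x. x \<in> D \<Longrightarrow> F x - \<epsilon> \<le> (\<integral>w. F (x + w) \<partial>planar_gauss h)" and \<epsilon>: "\<epsilon> \<ge> 0"
    and V [measurable]: "V \<in> sets borel" and C: "C \<ge> 0" "\<And>x. F x \<le> C * indicator V x"
  shows "F z \<le> real N * \<epsilon> + C * prob (alive D (real N * h)) + C * prob (\<Union>k<N. grid_exit D V h k)"
proof -
  define t where "t = (\<lambda>k. real k * h)"
  have t: "0 \<le> t k" "t (Suc k) = t k + h" for k using h by (auto simp: t_def algebra_simps)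
  have [measurable]: "B (t k) \<in> borel_measurable M" for k by (intro measurable_B t)
  note [measurable] = alive_measurable[OF D(1,2)] borel_measurable_planar_gauss_integral[OF h F]
  have int: "integrable M (\<lambda>\<omega>. indicator A \<omega> * F (B (t k) \<omega>))" if [measurable]: "A \<in> sets M" for A k
    using bnd order_trans[OF abs_ge_zero bnd]
    by (intro integrable_const_bound[where B=C'] AE_I2) (auto simp: indicator_def)
  have ind: "integrable M (indicator A :: _ \<Rightarrow> real)" if [measurable]: "A \<in> sets M" for A
    by (rule integrable_const_bound[where B=1]) (auto simp: indicator_def)
  \<comment> \<open>\<open>J N\<close> is the expectation of \<open>F\<close> at the process stopped
    at the first grid time at which it is no longer alive, or at grid time \<open>N\<close> if that
    is earlier.\<close>
  define J where "J = (\<lambda>N. expectation (\<lambda>\<omega>. indicator (alive D (t N)) \<omega> * F (B (t N) \<omega>)) +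
    (\<Sum>k<N. expectation (\<lambda>\<omega>. indicator (alive D (t k) - alive D (t (Suc k))) \<omega> * F (B (t (Suc k)) \<omega>))))"
  have step: "J N - \<epsilon> \<le> J (Suc N)" for N
  proof -
    have sub': "alive D (t (Suc N)) \<subseteq> alive D (t N)"
      using h by (intro alive_antimono) (simp add: t)
    have "expectation (\<lambda>\<omega>. indicator (alive D (t (Suc N))) \<omega> * F (B (t (Suc N)) \<omega>)) +
        expectation (\<lambda>\<omega>. indicator (alive D (t N) - alive D (t (Suc N))) \<omega> * F (B (t (Suc N)) \<omega>))
      = expectation (\<lambda>\<omega>. indicator (alive D (t N)) \<omega> * F (B (t (Suc N)) \<omega>))"
      (is "?l1 + ?l2 = ?r")
    proof -
      have "?l1 + ?l2 = expectation (\<lambda>\<omega>. indicator (alive D (t (Suc N))) \<omega> * F (B (t (Suc N)) \<omega>)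
          + indicator (alive D (t N) - alive D (t (Suc N))) \<omega> * F (B (t (Suc N)) \<omega>))"
        by (rule Bochner_Integration.integral_add[symmetric]; rule int; measurable)
      also have "\<dots> = ?r"
        using sub' by (intro Bochner_Integration.integral_cong) (auto simp: indicator_def)
      finally show ?thesis .
    qed
    also have "\<dots> = expectation (\<lambda>\<omega>. indicator (alive D (t N)) \<omega> * (\<integral>w. F (B (t N) \<omega> + w) \<partial>planar_gauss h))"
      unfolding t(2) by (rule markov_alive[OF D t(1) h F bnd])
    also have "\<dots> \<ge> expectation (\<lambda>\<omega>. indicator (alive D (t N)) \<omega> * F (B (t N) \<omega>) - \<epsilon>)"
    proof (rule integral_mono_AE)
      show "integrable M (\<lambda>\<omega>. indicator (alive D (t N)) \<omega> * F (B (t N) \<omega>) - \<epsilon>)"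
        by (intro Bochner_Integration.integrable_diff int) auto
      show "integrable M (\<lambda>\<omega>. indicator (alive D (t N)) \<omega> * (\<integral>w. F (B (t N) \<omega> + w) \<partial>planar_gauss h))"
        using planar_gauss_integral_bounded[OF h F bnd] order_trans[OF abs_ge_zero bnd]
        by (intro integrable_const_bound[where B=C'] AE_I2) (auto simp: indicator_def)
      show "AE \<omega> in M. indicator (alive D (t N)) \<omega> * F (B (t N) \<omega>) - \<epsilon>
          \<le> indicator (alive D (t N)) \<omega> * (\<integral>w. F (B (t N) \<omega> + w) \<partial>planar_gauss h)"
        using start
      proof eventually_elim
        case (elim \<omega>)
        show ?case
        proof (cases "\<omega> \<in> alive D (t N)")
          case True
          \<comment> \<open>At time 0 the event \<open>alive\<close> says nothing about the
            position; there \<open>z \<in> D\<close> takes over.\<close>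
          then have "B (t N) \<omega> \<in> D"
            using D(3) elim t(1)[of N] by (cases "t N = 0") (auto simp: alive_def)
          then show ?thesis using sub[of "B (t N) \<omega>"] True by simp
        qed (use \<epsilon> in simp)
      qed
    qed
    also have "expectation (\<lambda>\<omega>. indicator (alive D (t N)) \<omega> * F (B (t N) \<omega>) - \<epsilon>)
        = expectation (\<lambda>\<omega>. indicator (alive D (t N)) \<omega> * F (B (t N) \<omega>)) - \<epsilon>"
      using prob_space by (subst Bochner_Integration.integral_diff) (auto intro: int)
    finally show ?thesis by (simp add: J_def)
  qed
  have J0: "J 0 = F z"
  proof -
    have t00: "t 0 = 0" by (simp add: t_def)
    have [measurable]: "B 0 \<in> borel_measurable M" by (rule measurable_B) simp
    have "J 0 = expectation (\<lambda>\<omega>. indicator (alive D 0) \<omega> * F (B 0 \<omega>))"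
      by (simp add: J_def t00)
    also have "\<dots> = expectation (\<lambda>\<omega>. F z)"
    proof (rule integral_cong_AE)
      show "AE \<omega> in M. indicator (alive D 0) \<omega> * F (B 0 \<omega>) = F z"
        using start AE_space by eventually_elim (simp add: alive_def)
    qed measurable
    finally have "J 0 = expectation (\<lambda>\<omega>. F z)" .
    then show ?thesis using prob_space by simp
  qed
  have "F z \<le> real N * \<epsilon> + J N"
  proof (induction N)
    case (Suc N)
    then show ?case using step[of N] by (simp add: algebra_simps)
  qed (simp add: J0)
  also have "J N \<le> C * prob (alive D (t N)) + (\<Sum>k<N. C * prob (grid_exit D V h k))"
    unfolding J_def
  proof (intro add_mono sum_mono)
    have "expectation (\<lambda>\<omega>. indicator (alive D (t N)) \<omega> * F (B (t N) \<omega>)) \<le> expectation (\<lambda>\<omega>. C * indicator (alive D (t N)) \<omega>)"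
    proof (rule integral_mono[OF int])
      show "indicator (alive D (t N)) \<omega> * F (B (t N) \<omega>) \<le> C * indicator (alive D (t N)) \<omega>" for \<omega>
        using C(1) C(2)[of "B (t N) \<omega>"]
        by (cases "B (t N) \<omega> \<in> V"; cases "\<omega> \<in> alive D (t N)") auto
    qed (auto intro: ind)
    then show "expectation (\<lambda>\<omega>. indicator (alive D (t N)) \<omega> * F (B (t N) \<omega>)) \<le> C * prob (alive D (t N))"
      by simp
  next
    fix k
    have ge: "grid_exit D V h k = {\<omega>\<in>space M. \<omega> \<in> alive D (t k) - alive D (t (Suc k)) \<and> B (t (Suc k)) \<omega> \<in> V}"
      by (auto simp: grid_exit_def t_def alive_def)
    have [measurable]: "grid_exit D V h k \<in> sets M" unfolding ge by measurable
    have "expectation (\<lambda>\<omega>. indicator (alive D (t k) - alive D (t (Suc k))) \<omega> * F (B (t (Suc k)) \<omega>))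
        \<le> expectation (\<lambda>\<omega>. C * indicator (grid_exit D V h k) \<omega>)"
    proof (rule integral_mono[OF int])
      show "indicator (alive D (t k) - alive D (t (Suc k))) \<omega> * F (B (t (Suc k)) \<omega>) \<le> C * indicator (grid_exit D V h k) \<omega>"
        if "\<omega> \<in> space M" for \<omega>
        using C(1) C(2)[of "B (t (Suc k)) \<omega>"] that unfolding ge
        by (cases "B (t (Suc k)) \<omega> \<in> V"; cases "\<omega> \<in> alive D (t k) - alive D (t (Suc k))") auto
    qed (auto intro: ind)
    then show "expectation (\<lambda>\<omega>. indicator (alive D (t k) - alive D (t (Suc k))) \<omega> * F (B (t (Suc k)) \<omega>))
        \<le> C * prob (grid_exit D V h k)"
      by simp
  qed
  also have "(\<Sum>k<N. C * prob (grid_exit D V h k)) = C * prob (\<Union>k<N. grid_exit D V h k)"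
  proof -
    have ge: "grid_exit D V h k = {\<omega>\<in>space M. \<omega> \<in> alive D (t k) - alive D (t (Suc k)) \<and> B (t (Suc k)) \<omega> \<in> V}" for k
      by (auto simp: grid_exit_def t_def alive_def)
    have m: "grid_exit D V h k \<in> sets M" for k unfolding ge by measurable
    have "disjoint_family_on (grid_exit D V h) {..<N}"
    proof -
      have "grid_exit D V h i \<inter> grid_exit D V h j = {}" if "i < j" for i j
      proof -
        have "alive D (t j) \<subseteq> alive D (t (Suc i))"
          using that h by (intro alive_antimono) (auto simp: t_def intro!: mult_right_mono)
        then show ?thesis unfolding ge by blast
      qed
      then have "grid_exit D V h i \<inter> grid_exit D V h j = {}" if "i \<noteq> j" for i j
        using that by (metis Int_commute linorder_neqE_nat)
      then show ?thesis by (auto simp: disjoint_family_on_def)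
    qed
    then have "prob (\<Union>k<N. grid_exit D V h k) = (\<Sum>k<N. prob (grid_exit D V h k))"
      using m by (intro finite_measure_finite_Union) auto
    then show ?thesis by (simp add: sum_distrib_left)
  qed
  finally show ?thesis by (simp add: t_def add.assoc)
qed

text \<open>Up to time \<open>T\<close> there are T / h steps of error L h^2, a total of T L h,
  which vanishes with h for fixed \<open>T\<close>; survival up to \<open>T\<close> vanishes as
  \<open>T\<close> grows. The path may be outside \<open>closure D\<close> when its exit is
  recorded, hence \<open>F\<close> is controlled on the whole plane. Closedness of \<open>V\<close>
  is what passes from recorded positions to the exit position.\<close>

lemma exit_principle:
  fixes F :: "real \<times> real \<Rightarrow> real"
  assumes D: "open D" "bounded D" "z \<in> D"
    and F: "F \<in> borel_measurable borel" and bnd: "\<And>x. \<bar>F x\<bar> \<le> C'"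
    and L: "L \<ge> 0"
    and sub: "\<And>x h. x \<in> D \<Longrightarrow> h > 0 \<Longrightarrow> F x - L * h\<^sup>2 \<le> (\<integral>w. F (x + w) \<partial>planar_gauss h)"
    and V: "closed V" and C: "C \<ge> 0" "\<And>x. F x \<le> C * indicator V x"
  shows "F z \<le> C * prob (exits_in D V)"
proof -
  have DU: "D \<noteq> UNIV" using D(2) not_bounded_UNIV by blast
  have Vb [measurable]: "V \<in> sets borel" using V by (rule borel_closed)
  \<comment> \<open>\<open>T * Suc n\<close> steps of length \<open>1 / real (Suc n)\<close> cover
    \<open>[0, T]\<close>.\<close>
  define E where "E = (\<lambda>T n. \<Union>k<T * Suc n. grid_exit D V (1 / real (Suc n)) k)"
  have ge: "grid_exit D V h k = {\<omega>\<in>space M. \<omega> \<in> alive D (real k * h) - alive D (real (Suc k) * h) \<and> B (real (Suc k) * h) \<omega> \<in> V}" for h k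
    by (auto simp: grid_exit_def alive_def)
  have gm: "grid_exit D V h k \<in> sets M" if "h > 0" for h k
  proof -
    note [measurable] = alive_measurable[OF D(1) DU]
    have [measurable]: "B (real (Suc k) * h) \<in> borel_measurable M" using that by (intro measurable_B) simp
    show ?thesis unfolding ge by measurable
  qed
  have [measurable]: "E T n \<in> sets M" for T n
    unfolding E_def using gm[of "1 / real (Suc n)"] by (intro sets.countable_UN'') (auto simp del: of_nat_Suc)
  have bound: "F z \<le> real T * L * (1 / real (Suc n)) + C * prob (alive D (real T)) + C * prob (E T n)" for T n
  proof -
    let ?h = "1 / real (Suc n)"
    have h: "?h > 0" by simp
    have "F z \<le> real (T * Suc n) * (L * ?h\<^sup>2) + C * prob (alive D (real (T * Suc n) * ?h)) + C * prob (E T n)"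
      unfolding E_def
      by (rule grid_exit_principle[OF D(1) DU D(3) h F bnd sub _ Vb C]) (use L h in auto)
    also have "real (T * Suc n) * ?h = real T" unfolding of_nat_mult by (simp del: of_nat_Suc)
    also have "real (T * Suc n) * (L * ?h\<^sup>2) = real T * L * ?h"
      unfolding of_nat_mult by (simp add: power2_eq_square del: of_nat_Suc)
    finally show ?thesis .
  qed
  \<comment> \<open>The events \<open>E T n\<close> need not be monotone in \<open>n\<close>, so the
    limit is taken through their limit superior. There infinitely many meshes record a position in
    \<open>V\<close>, each at a time between \<open>tau\<close> and \<open>tau\<close> plus the
    mesh.\<close>
  have limsup: "(\<Inter>m. \<Union>n\<in>{m..}. E T n) \<subseteq> exits_in D V" for T
  proof
    fix \<omega> assume \<omega>: "\<omega> \<in> (\<Inter>m. \<Union>n\<in>{m..}. E T n)"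
    have "\<exists>n k. n \<ge> m \<and> k < T * Suc n \<and> \<omega> \<in> grid_exit D V (1 / real (Suc n)) k" for m
      using \<omega> unfolding E_def by blast
    then obtain n k where nk: "\<And>m. n m \<ge> m" "\<And>m. k m < T * Suc (n m)"
      "\<And>m. \<omega> \<in> grid_exit D V (1 / real (Suc (n m))) (k m)"
      by metis
    have sp: "\<omega> \<in> space M" using nk(3)[of 0] by (auto simp: ge)
    define s where "s = (\<lambda>m. real (Suc (k m)) * (1 / real (Suc (n m))))"
    have na: "\<omega> \<notin> alive D (s m)" and BV: "B (s m) \<omega> \<in> V" and al: "\<omega> \<in> alive D (real (k m) * (1 / real (Suc (n m))))" for m
      using nk(3)[of m] unfolding ge s_def by auto
    have fin: "exit_time B D \<omega> < \<infinity>"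
      using exit_time_le_not_alive[OF sp na[of 0]] by (metis ereal_infty_less(1) PInfty_neq_ereal(1) ereal_infty_less_eq(1) less_ereal.simps(4) less_le_trans not_le)
    have up: "tau D \<omega> \<le> s m" for m
      using exit_time_le_not_alive[OF sp na[of m]] ereal_tau[OF fin] by (metis ereal_less_eq(3))
    have lo: "s m \<le> tau D \<omega> + 1 / real (Suc (n m))" for m
    proof -
      have "real (k m) * (1 / real (Suc (n m))) \<le> tau D \<omega>"
        using exit_time_ge_alive[OF al[of m]] ereal_tau[OF fin] by (metis ereal_less_eq(3))
      then show ?thesis by (simp add: s_def add_divide_distrib)
    qed
    have lo': "s m \<le> tau D \<omega> + inverse (real (Suc m))" for m
    proof -
      have "1 / real (Suc (n m)) \<le> inverse (real (Suc m))"
        using nk(1)[of m] by (simp add: field_simps)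
      then show ?thesis using lo[of m] by linarith
    qed
    have "(\<lambda>m. tau D \<omega> + inverse (real (Suc m))) \<longlonglongrightarrow> tau D \<omega> + 0"
      by (intro tendsto_intros LIMSEQ_inverse_real_of_nat)
    then have lim: "(\<lambda>m. tau D \<omega> + inverse (real (Suc m))) \<longlonglongrightarrow> tau D \<omega>" by simp
    have "s \<longlonglongrightarrow> tau D \<omega>"
      by (rule tendsto_sandwich[OF always_eventually always_eventually tendsto_const lim]) (intro allI up lo')+
    then have "(\<lambda>m. B (s m) \<omega>) \<longlonglongrightarrow> B (tau D \<omega>) \<omega>"
      by (rule path_tendsto[OF sp]) (simp add: s_def)
    then have "B (tau D \<omega>) \<omega> \<in> V"
      using V BV by (metis closed_sequentially)
    then show "\<omega> \<in> exits_in D V"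
      using sp fin by (simp add: exits_in_def exit_position_def)
  qed
  have bound2: "F z \<le> C * prob (alive D (real T)) + C * prob (exits_in D V)" for T
  proof -
    define G where "G = (\<lambda>m. \<Union>n\<in>{m..}. E T n)"
    have Gm: "range G \<subseteq> sets M" unfolding G_def by (auto intro!: sets.countable_UN')
    have dec: "decseq G" unfolding G_def decseq_def by fastforce
    have lim: "(\<lambda>m. prob (G m)) \<longlonglongrightarrow> prob (\<Inter>m. G m)"
      by (rule finite_Lim_measure_decseq[OF Gm dec])
    have le: "F z \<le> real T * L * inverse (real (Suc m)) + C * prob (alive D (real T)) + C * prob (G m)" for m
    proof -
      have "prob (E T m) \<le> prob (G m)"
        using Gm by (intro finite_measure_mono) (auto simp: G_def)
      then have "C * prob (E T m) \<le> C * prob (G m)" using C(1) by (rule mult_left_mono)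
      then show ?thesis using bound[of T m] by (simp add: inverse_eq_divide)
    qed
    have lim2: "(\<lambda>m. real T * L * inverse (real (Suc m)) + C * prob (alive D (real T)) + C * prob (G m))
        \<longlonglongrightarrow> real T * L * 0 + C * prob (alive D (real T)) + C * prob (\<Inter>m. G m)"
      by (intro tendsto_intros lim LIMSEQ_inverse_real_of_nat)
    have "F z \<le> real T * L * 0 + C * prob (alive D (real T)) + C * prob (\<Inter>m. G m)"
      by (rule LIMSEQ_le_const[OF lim2]) (use le in blast)
    moreover have "prob (\<Inter>m. G m) \<le> prob (exits_in D V)"
      using limsup[of T] exits_in_measurable[OF D(1) DU Vb] unfolding G_def by (rule finite_measure_mono)
    ultimately show ?thesis using C(1) mult_left_mono by fastforce
  qed
  have "(\<lambda>n. C * prob (alive D (real (Suc n))) + C * prob (exits_in D V)) \<longlonglongrightarrow> C * 0 + C * prob (exits_in D V)"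
    by (intro tendsto_intros prob_alive_tendsto_0 D)
  then have "F z \<le> C * 0 + C * prob (exits_in D V)"
    by (rule LIMSEQ_le_const) (use bound2 in blast)
  then show ?thesis by simp
qed

end

section \<open>Powers of complex numbers\<close>

text \<open>The argument that a maximum of harmonic functions is subharmonic: at each point
  \<open>F\<close> touches one of the pieces, and it lies above that piece on all of
  \<open>U i\<close>. The sum of the finitely many constants works for every piece.\<close>

lemma submean_of_holomorphic_family:
  fixes F :: "real \<times> real \<Rightarrow> real"
  assumes I: "finite I"
    and U: "\<And>i. i \<in> I \<Longrightarrow> open (U i)" "\<And>i. i \<in> I \<Longrightarrow> g i holomorphic_on U i"
    and K: "\<And>i. i \<in> I \<Longrightarrow> compact (K i)" "\<And>i. i \<in> I \<Longrightarrow> K i \<subseteq> U i"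
    and F: "F \<in> borel_measurable borel" "\<And>w. \<bar>F w\<bar> \<le> C"
    and touch: "\<And>x. x \<in> D \<Longrightarrow> \<exists>i\<in>I. cx x \<in> K i \<and> F x = Re (g i (cx x))"
    and minorant: "\<And>i w. i \<in> I \<Longrightarrow> cx w \<in> U i \<Longrightarrow> Re (g i (cx w)) \<le> F w"
  obtains L where "L \<ge> 0"
    "\<And>x h. x \<in> D \<Longrightarrow> h > 0 \<Longrightarrow> F x - L * h\<^sup>2 \<le> (\<integral>w. F (x + w) \<partial>planar_gauss h)"
proof -
  have C: "C \<ge> 0" using F(2)[of 0] by simp
  have "\<exists>L\<ge>0. \<forall>x h. cx x \<in> K i \<longrightarrow> h > 0 \<longrightarrow>
      Re (g i (cx x)) - L * h\<^sup>2 \<le> (\<integral>w. F (x + w) \<partial>planar_gauss h)" if i: "i \<in> I" for i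
  proof -
    obtain L where "L \<ge> 0"
      "\<And>F x h. F \<in> borel_measurable borel \<Longrightarrow> (\<And>w. \<bar>F w\<bar> \<le> C) \<Longrightarrow>
       (\<And>w. cx w \<in> U i \<Longrightarrow> Re (g i (cx w)) \<le> F w) \<Longrightarrow> cx x \<in> K i \<Longrightarrow> h > 0 \<Longrightarrow>
       Re (g i (cx x)) - L * h\<^sup>2 \<le> (\<integral>w. F (x + w) \<partial>planar_gauss h)"
      using submean_of_holomorphic_minorant[OF U(1)[OF i] U(2)[OF i] K(1)[OF i] K(2)[OF i] C] by blast
    then show ?thesis using F minorant[OF i] by blast
  qed
  then obtain L where L: "\<And>i. i \<in> I \<Longrightarrow> L i \<ge> (0 :: real)"
    "\<And>i x h. i \<in> I \<Longrightarrow> cx x \<in> K i \<Longrightarrow> h > 0 \<Longrightarrow>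
      Re (g i (cx x)) - L i * h\<^sup>2 \<le> (\<integral>w. F (x + w) \<partial>planar_gauss h)"
    by metis
  show ?thesis
  proof (rule that[of "\<Sum>i\<in>I. L i"])
    show "(\<Sum>i\<in>I. L i) \<ge> 0" using L(1) by (rule sum_nonneg)
    fix x and h :: real assume x: "x \<in> D" and h: "h > 0"
    obtain i where i: "i \<in> I" "cx x \<in> K i" "F x = Re (g i (cx x))" using touch[OF x] by blast
    have "L i * h\<^sup>2 \<le> (\<Sum>i\<in>I. L i) * h\<^sup>2"
      using member_le_sum[of i I L] I L(1) i(1) by (intro mult_right_mono) auto
    then show "F x - (\<Sum>i\<in>I. L i) * h\<^sup>2 \<le> (\<integral>w. F (x + w) \<partial>planar_gauss h)"
      using L(2)[OF i(1,2) h] i(3) by linarith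
  qed
qed

lemma (in planar_brownian_motion) harmonic_exit_principle:
  fixes F :: "real \<times> real \<Rightarrow> real"
  assumes D: "open D" "bounded D" "z \<in> D"
    and I: "finite I"
    and U: "\<And>i. i \<in> I \<Longrightarrow> open (U i)" "\<And>i. i \<in> I \<Longrightarrow> g i holomorphic_on U i"
    and K: "\<And>i. i \<in> I \<Longrightarrow> compact (K i)" "\<And>i. i \<in> I \<Longrightarrow> K i \<subseteq> U i"
    and F: "F \<in> borel_measurable borel" "\<And>w. \<bar>F w\<bar> \<le> C'"
    and touch: "\<And>x. x \<in> D \<Longrightarrow> \<exists>i\<in>I. cx x \<in> K i \<and> F x = Re (g i (cx x))"
    and minorant: "\<And>i w. i \<in> I \<Longrightarrow> cx w \<in> U i \<Longrightarrow> Re (g i (cx w)) \<le> F w"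
    and V: "closed V" and C: "C \<ge> 0" "\<And>x. F x \<le> C * indicator V x"
  shows "F z \<le> C * prob (exits_in D V)"
proof -
  obtain L where L: "L \<ge> 0"
    "\<And>x h. x \<in> D \<Longrightarrow> h > 0 \<Longrightarrow> F x - L * h\<^sup>2 \<le> (\<integral>w. F (x + w) \<partial>planar_gauss h)"
    using submean_of_holomorphic_family[OF I U K F touch minorant] by blast
  show ?thesis by (rule exit_principle[OF D F L V C])
qed

section \<open>Real powers in the right half-plane\<close>

definition cpow :: "real \<Rightarrow> complex \<Rightarrow> complex" where
  "cpow q w = exp (of_real q * Ln w)"

lemma norm_cpow: "w \<noteq> 0 \<Longrightarrow> cmod (cpow q w) = cmod w powr q"
  by (simp add: cpow_def powr_def)

lemma cpow_of_real: "x > 0 \<Longrightarrow> cpow q (of_real x) = of_real (x powr q)"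
  by (simp add: cpow_def powr_def Ln_of_real exp_of_real[symmetric])

lemma has_field_derivative_cpow:
  assumes "w \<notin> \<real>\<^sub>\<le>\<^sub>0"
  shows "(cpow q has_field_derivative of_real q * cpow (q - 1) w) (at w)"
proof -
  have "w \<noteq> 0" using assms by auto
  then show ?thesis
    unfolding cpow_def[abs_def] using assms
    by (auto intro!: derivative_eq_intros simp: left_diff_distrib exp_diff divide_inverse)
qed

lemma holomorphic_on_cpow [holomorphic_intros]:
  assumes "f holomorphic_on S" "\<And>w. w \<in> S \<Longrightarrow> f w \<notin> \<real>\<^sub>\<le>\<^sub>0"
  shows "(\<lambda>w. cpow q (f w)) holomorphic_on S"
  unfolding cpow_def using assms by (intro holomorphic_intros) auto

lemma Re_pos_not_nonpos_Reals: "Re w > 0 \<Longrightarrow> w \<notin> \<real>\<^sub>\<le>\<^sub>0"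
  by (auto simp: complex_nonpos_Reals_iff)

text \<open>Along a vertical line the derivative of \<open>w^q\<close> is
  \<open>\<i> q w^(q - 1)\<close>, so real and imaginary parts alternate while the exponent drops by
  one. The estimates below repeat this step.\<close>

lemma has_real_derivative_cpow_vertical:
  assumes "x > 0"
  shows "((\<lambda>y. Re (cpow q (Complex x y))) has_real_derivative - q * Im (cpow (q - 1) (Complex x y))) (at y)"
    and "((\<lambda>y. Im (cpow q (Complex x y))) has_real_derivative q * Re (cpow (q - 1) (Complex x y))) (at y)"
proof -
  have "((\<lambda>y. Complex x y) has_vector_derivative \<i>) (at y)"
    unfolding Complex_eq has_vector_derivative_def
    by (auto intro!: derivative_eq_intros simp: scaleR_conv_of_real)
  moreover have "(cpow q has_field_derivative of_real q * cpow (q - 1) (Complex x y)) (at (Complex x y))"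
    using assms by (intro has_field_derivative_cpow Re_pos_not_nonpos_Reals) simp
  ultimately have "((cpow q \<circ> (\<lambda>y. Complex x y)) has_vector_derivative \<i> * (of_real q * cpow (q - 1) (Complex x y))) (at y)"
    by (rule field_vector_diff_chain_at)
  then have d: "((\<lambda>y. cpow q (Complex x y)) has_vector_derivative \<i> * (of_real q * cpow (q - 1) (Complex x y))) (at y)"
    by (simp add: comp_def)
  from bounded_linear.has_vector_derivative[OF bounded_linear_Re d]
  show "((\<lambda>y. Re (cpow q (Complex x y))) has_real_derivative - q * Im (cpow (q - 1) (Complex x y))) (at y)"
    by (simp add: has_real_derivative_iff_has_vector_derivative)
  from bounded_linear.has_vector_derivative[OF bounded_linear_Im d]
  show "((\<lambda>y. Im (cpow q (Complex x y))) has_real_derivative q * Re (cpow (q - 1) (Complex x y))) (at y)"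
    by (simp add: has_real_derivative_iff_has_vector_derivative)
qed

lemma mvt_from_zero:
  fixes f :: "real \<Rightarrow> real"
  assumes "\<And>s. (f has_real_derivative f' s) (at s)"
  obtains \<xi> where "\<bar>\<xi>\<bar> \<le> \<bar>y\<bar>" "f y = f 0 + y * f' \<xi>"
proof -
  consider "y = 0" | "y > 0" | "y < 0" by linarith
  then show ?thesis
  proof cases
    case 1
    then show ?thesis using that[of 0] by simp
  next
    case 2
    obtain \<xi> where "0 < \<xi>" "\<xi> < y" "f y - f 0 = (y - 0) * f' \<xi>"
      using MVT2[of 0 y f f'] 2 assms by blast
    then show ?thesis using that[of \<xi>] by (simp add: algebra_simps)
  next
    case 3
    obtain \<xi> where "y < \<xi>" "\<xi> < 0" "f 0 - f y = (0 - y) * f' \<xi>"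
      using MVT2[of y 0 f f'] 3 assms by blast
    then show ?thesis using that[of \<xi>] by (simp add: algebra_simps)
  qed
qed

lemma norm_cpow_le:
  assumes "x > 0" "q \<le> 0"
  shows "cmod (cpow q (Complex x y)) \<le> x powr q"
proof -
  have n: "x \<le> cmod (Complex x y)" using complex_Re_le_cmod[of "Complex x y"] by simp
  have "Complex x y \<noteq> 0" using assms by (auto simp: complex_eq_iff)
  then have "cmod (cpow q (Complex x y)) = cmod (Complex x y) powr q" by (rule norm_cpow)
  also have "\<dots> \<le> x powr q" using assms n by (intro powr_mono2') auto
  finally show ?thesis .
qed

text \<open>The power is real on the positive axis, so one mean value step leaves the exponent
  \<open>q - 1 \<le> 0\<close>, for which the modulus is largest on the axis. The two estimates
  after it take one further step each and end with the exponents \<open>q - 2\<close> and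
  \<open>q - 3\<close>.\<close>

lemma Im_cpow_bound:
  assumes "x > 0" "q \<le> 1"
  shows "\<bar>Im (cpow q (Complex x y))\<bar> \<le> \<bar>q\<bar> * \<bar>y\<bar> * x powr (q - 1)"
proof -
  obtain \<xi> where "Im (cpow q (Complex x y)) = Im (cpow q (Complex x 0)) + y * (q * Re (cpow (q - 1) (Complex x \<xi>)))"
    using mvt_from_zero[OF has_real_derivative_cpow_vertical(2)[OF assms(1)]] by metis
  then have "\<bar>Im (cpow q (Complex x y))\<bar> = \<bar>q\<bar> * \<bar>y\<bar> * \<bar>Re (cpow (q - 1) (Complex x \<xi>))\<bar>"
    using cpow_of_real[OF assms(1), of q] by (simp add: complex_of_real_def abs_mult)
  also have "\<dots> \<le> \<bar>q\<bar> * \<bar>y\<bar> * x powr (q - 1)"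
    using norm_cpow_le[of x "q - 1" \<xi>] abs_Re_le_cmod[of "cpow (q - 1) (Complex x \<xi>)"] assms
    by (intro mult_left_mono) auto
  finally show ?thesis .
qed

lemma Re_cpow_approx:
  assumes "x > 0" "q \<le> 2"
  shows "\<bar>Re (cpow q (Complex x y)) - x powr q\<bar> \<le> \<bar>q * (q - 1)\<bar> * y\<^sup>2 * x powr (q - 2)"
proof -
  obtain \<xi> where \<xi>: "\<bar>\<xi>\<bar> \<le> \<bar>y\<bar>"
    "Re (cpow q (Complex x y)) = Re (cpow q (Complex x 0)) + y * (- q * Im (cpow (q - 1) (Complex x \<xi>)))"
    using mvt_from_zero[OF has_real_derivative_cpow_vertical(1)[OF assms(1)]] by metis
  then have "\<bar>Re (cpow q (Complex x y)) - x powr q\<bar> = \<bar>q\<bar> * \<bar>y\<bar> * \<bar>Im (cpow (q - 1) (Complex x \<xi>))\<bar>"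
    using cpow_of_real[OF assms(1), of q] by (simp add: complex_of_real_def abs_mult)
  also have "\<dots> \<le> \<bar>q\<bar> * \<bar>y\<bar> * (\<bar>q - 1\<bar> * \<bar>y\<bar> * x powr (q - 1 - 1))"
    using Im_cpow_bound[of x "q - 1" \<xi>] assms \<xi>(1)
    by (intro mult_left_mono order_trans[OF Im_cpow_bound] mult_right_mono) auto
  also have "\<dots> = \<bar>q * (q - 1)\<bar> * y\<^sup>2 * x powr (q - 2)"
    by (simp add: abs_mult power2_eq_square)
  finally show ?thesis .
qed

lemma Im_cpow_approx:
  assumes "x > 0" "q \<le> 1"
  shows "\<bar>Im (cpow q (Complex x y)) - q * y * x powr (q - 1)\<bar>
    \<le> \<bar>q * (q - 1) * (q - 2)\<bar> * \<bar>y\<bar> ^ 3 * x powr (q - 3)"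
proof -
  obtain \<xi> where \<xi>: "\<bar>\<xi>\<bar> \<le> \<bar>y\<bar>"
    "Im (cpow q (Complex x y)) = Im (cpow q (Complex x 0)) + y * (q * Re (cpow (q - 1) (Complex x \<xi>)))"
    using mvt_from_zero[OF has_real_derivative_cpow_vertical(2)[OF assms(1)]] by metis
  then have "Im (cpow q (Complex x y)) - q * y * x powr (q - 1)
      = q * y * (Re (cpow (q - 1) (Complex x \<xi>)) - x powr (q - 1))"
    using cpow_of_real[OF assms(1), of q] by (simp add: complex_of_real_def algebra_simps)
  then have "\<bar>Im (cpow q (Complex x y)) - q * y * x powr (q - 1)\<bar>
      = \<bar>q\<bar> * \<bar>y\<bar> * \<bar>Re (cpow (q - 1) (Complex x \<xi>)) - x powr (q - 1)\<bar>"
    by (simp add: abs_mult)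
  also have "\<dots> \<le> \<bar>q\<bar> * \<bar>y\<bar> * (\<bar>(q - 1) * (q - 1 - 1)\<bar> * y\<^sup>2 * x powr (q - 1 - 2))"
    using assms \<xi>(1)
    by (intro mult_left_mono order_trans[OF Re_cpow_approx] mult_right_mono)
       (auto simp: abs_le_square_iff)
  also have "\<dots> = \<bar>q * (q - 1) * (q - 2)\<bar> * \<bar>y\<bar> ^ 3 * x powr (q - 3)"
  proof -
    have "\<bar>y\<bar> ^ 3 = \<bar>y\<bar> * y\<^sup>2" by (simp add: power3_eq_cube power2_eq_square)
    then show ?thesis by (simp add: abs_mult)
  qed
  finally show ?thesis .
qed

text \<open>From \<open>(1 + s) powr p \<le> 1 + s\<close>. An extra distance of the order of the
  width of the parabola changes \<open>x powr p\<close> by a bounded amount only; this keeps the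
  resulting losses in the tail bounds to constant factors.\<close>

lemma powr_add_le:
  fixes x c p :: real
  assumes "0 < p" "p < 1" "0 \<le> c" "0 \<le> x"
  shows "(x + c * x powr (1 - p)) powr p \<le> x powr p + c"
proof (cases "x = 0")
  case False
  with assms have x: "x > 0" by simp
  have "x + c * x powr (1 - p) = x * (1 + c * x powr (- p))"
    using x by (simp add: powr_diff powr_minus field_simps)
  then have "(x + c * x powr (1 - p)) powr p = x powr p * (1 + c * x powr (- p)) powr p"
    using x assms by (simp add: powr_mult)
  also have "\<dots> \<le> x powr p * (1 + c * x powr (- p)) powr 1"
    using x assms by (intro mult_left_mono powr_mono) auto
  also have "\<dots> = x powr p + c"
    using x assms by (simp add: powr_minus field_simps)
  finally show ?thesis .
qed (use assms in auto)

lemma norm_pair_le_sum: "norm (x :: real, y :: real) \<le> \<bar>x\<bar> + \<bar>y\<bar>"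
  using norm_triangle_ineq[of "(x, 0)" "(0, y)"] by simp

section \<open>Parabola-shaped domains: the upper tail\<close>

locale parabola_exit = planar_brownian_motion M B z
  for M :: "'w measure" and B :: "real \<Rightarrow> 'w \<Rightarrow> real \<times> real" and z +
  fixes \<alpha> A :: real
  assumes alpha: "0 < \<alpha>" "\<alpha> < 1" and A: "A > 0" and z: "z \<in> parabola_domain A \<alpha>"
begin

section \<open>Constants and bounded truncations of the parabola\<close>

definition p :: real where "p = 1 - \<alpha>"

definition bc :: real where "bc = pi / (2 * A * p)"

definition exit_pos :: "'w \<Rightarrow> real \<times> real" where "exit_pos = exit_position B (parabola_domain A \<alpha>)"

definition truncated :: "real \<Rightarrow> (real \<times> real) set" where
  "truncated R = {w \<in> parabola_domain A \<alpha>. fst w < R}"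

definition closed_truncated :: "real \<Rightarrow> (real \<times> real) set" where
  "closed_truncated R = {w. 0 \<le> fst w \<and> fst w \<le> R \<and> \<bar>snd w\<bar> \<le> A * fst w powr \<alpha>}"

lemma p: "0 < p" "p < 1"
  using alpha by (auto simp: p_def)

lemma bc: "bc > 0" "bc * p * A = pi / 2"
  using p A by (auto simp: bc_def)

text \<open>The maximum with 0 makes the profile continuous on the whole plane, so that openness and
  closedness of the domains follow from continuity.\<close>

lemma continuous_on_profile: "continuous_on S (\<lambda>w :: real \<times> real. max 0 (fst w) powr \<alpha>)"
  using alpha by (intro continuous_on_powr' continuous_intros) auto

lemma parabola_eq: "parabola_domain A \<alpha> = {w. 0 < fst w \<and> \<bar>snd w\<bar> < A * max 0 (fst w) powr \<alpha>}"
  by (auto simp: parabola_domain_def max_def)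

lemma open_parabola: "open (parabola_domain A \<alpha>)"
  unfolding parabola_eq
  by (intro open_Collect_conj open_Collect_less continuous_intros continuous_on_profile)

lemma parabola_neq_UNIV: "parabola_domain A \<alpha> \<noteq> UNIV"
proof -
  have "(0, 0) \<notin> parabola_domain A \<alpha>" by (simp add: parabola_domain_def)
  then show ?thesis by blast
qed

lemma open_truncated: "open (truncated R)"
proof -
  have "truncated R = parabola_domain A \<alpha> \<inter> {w. fst w < R}" by (auto simp: truncated_def)
  moreover have "open {w :: real \<times> real. fst w < R}" by (intro open_Collect_less continuous_intros)
  ultimately show ?thesis using open_parabola by auto
qed

lemma closed_closed_truncated: "closed (closed_truncated R)"
proof -
  have "closed_truncated R = {w. 0 \<le> fst w \<and> fst w \<le> R \<and> \<bar>snd w\<bar> \<le> A * max 0 (fst w) powr \<alpha>}"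
    by (auto simp: closed_truncated_def max_def)
  also have "closed \<dots>"
    by (intro closed_Collect_conj closed_Collect_le continuous_intros continuous_on_profile)
  finally show ?thesis .
qed

lemma truncated_subset: "truncated R \<subseteq> closed_truncated R"
  by (auto simp: truncated_def closed_truncated_def parabola_domain_def)

lemma closure_truncated: "closure (truncated R) \<subseteq> closed_truncated R"
  by (intro closure_minimal truncated_subset closed_closed_truncated)

lemma norm_closed_truncated_le:
  assumes "w \<in> closed_truncated R"
  shows "norm w \<le> R + A * R powr \<alpha>"
proof -
  have w: "0 \<le> fst w" "fst w \<le> R" "\<bar>snd w\<bar> \<le> A * fst w powr \<alpha>"
    using assms by (auto simp: closed_truncated_def)
  then have "A * fst w powr \<alpha> \<le> A * R powr \<alpha>"
    using A alpha by (intro mult_left_mono powr_mono2) auto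
  then show ?thesis using norm_pair_le_sum[of "fst w" "snd w"] w by simp
qed

lemma compact_closed_truncated: "compact (closed_truncated R)"
  unfolding compact_eq_bounded_closed bounded_iff
  using norm_closed_truncated_le closed_closed_truncated by blast

lemma bounded_truncated: "bounded (truncated R)"
  using bounded_subset[OF compact_imp_bounded[OF compact_closed_truncated] truncated_subset] .

lemma z_truncated: "fst z < R \<Longrightarrow> z \<in> truncated R"
  using z by (simp add: truncated_def)

lemma norm_powr_closed_truncated_le:
  assumes "w \<in> closed_truncated R"
  shows "norm w powr p \<le> fst w powr p + A"
proof -
  have w: "0 \<le> fst w" "\<bar>snd w\<bar> \<le> A * fst w powr (1 - p)"
    using assms by (auto simp: closed_truncated_def p_def)
  have "norm w \<le> fst w + A * fst w powr (1 - p)"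
    using norm_pair_le_sum[of "fst w" "snd w"] w by simp
  then have "norm w powr p \<le> (fst w + A * fst w powr (1 - p)) powr p"
    using p by (intro powr_mono2) auto
  also have "\<dots> \<le> fst w powr p + A"
    using p A w by (intro powr_add_le) auto
  finally show ?thesis .
qed

lemma exit_pos_measurable [measurable]: "exit_pos \<in> borel_measurable M"
  unfolding exit_pos_def by (intro exit_position_measurable open_parabola parabola_neq_UNIV)

text \<open>The cut \<open>fst w = R\<close> makes the domain bounded, as
  \<open>exit_principle\<close> requires. An exit strictly to the left of the cut is also the exit
  from the whole parabola, because up to then the path was inside both.\<close>

lemma AE_truncated_exit:
  assumes R: "fst z < R"
  shows "AE \<omega> in M. exit_time B (truncated R) \<omega> < \<infinity> \<and>
    exit_position B (truncated R) \<omega> \<in> closed_truncated R \<and>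
    exit_position B (truncated R) \<omega> \<notin> truncated R \<and>
    (fst (exit_position B (truncated R) \<omega>) < R \<longrightarrow> exit_pos \<omega> = exit_position B (truncated R) \<omega>)"
  using AE_exit_time_finite[OF open_truncated z_truncated[OF R] bounded_truncated] start AE_space
proof eventually_elim
  case (elim \<omega>)
  then have B0: "B 0 \<omega> \<in> truncated R" using z_truncated[OF R] by simp
  note e = exit_path[OF elim(3) B0 open_truncated elim(1)]
  have "exit_pos \<omega> = B (tau (truncated R) \<omega>) \<omega>" if "fst (B (tau (truncated R) \<omega>) \<omega>) < R"
    unfolding exit_pos_def
  proof (rule exit_time_eqI(2)[OF e(1)])
    show "B (tau (truncated R) \<omega>) \<omega> \<notin> parabola_domain A \<alpha>"
      using e(3) that by (simp add: truncated_def)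
    show "B u \<omega> \<in> parabola_domain A \<alpha>" if "0 < u" "u < tau (truncated R) \<omega>" for u
      using e(4)[of u] that by (simp add: truncated_def)
  qed
  then show ?case using elim(1) e closure_truncated[of R] by auto
qed

text \<open>The barrier is \<open>1 - Re u / m s\<close>, where \<open>m s\<close> bounds
  \<open>Re u\<close> from below to the right of \<open>s\<close>. It is at most 1 everywhere and at
  most 0 to the right of \<open>s\<close>, so its value at \<open>z\<close> is a lower bound for the
  probability of an exit with abscissa at most \<open>s\<close>. Since \<open>C\<close> is chosen
  before \<open>R\<close>, the cut may lie anywhere beyond \<open>s\<close> and
  \<open>fst z\<close>.\<close>

lemma upper_truncated:
  assumes \<kappa>: "0 < \<kappa>" "\<kappa> < bc"
  obtains C where "C \<ge> 0"
    "\<And>s R. 0 \<le> s \<Longrightarrow> s < R \<Longrightarrow> fst z < R \<Longrightarrow>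
      1 - C * exp (- \<kappa> * s powr p) \<le> prob (exits_in (truncated R) {w. fst w \<le> s})"
proof -
  have kA: "\<kappa> * p * A < pi / 2"
    using \<kappa> p A bc(2) by (metis mult_strict_right_mono)
  \<comment> \<open>The midpoint between \<open>A\<close> and the value at which
    \<open>\<kappa> * p * A'\<close> would reach \<open>pi / 2\<close>: the wider parabola leaves
    room around the closed domain and still keeps the cosine positive.\<close>
  define A' where "A' = (A + pi / (2 * \<kappa> * p)) / 2"
  have A': "A < A'" "\<kappa> * p * A' < pi / 2"
    using kA \<kappa> p by (auto simp: A'_def field_simps)
  have A'0: "A' > 0" using A A' by simp
  define c where "c = cos (\<kappa> * p * A')"
  have c: "c > 0" unfolding c_def using A' A'0 \<kappa> p by (intro cos_gt_zero) auto
  define u where "u = (\<lambda>\<zeta>. exp (of_real \<kappa> * cpow p (\<zeta> + 1)))"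
  \<comment> \<open>The term \<open>A'^2\<close> absorbs the second-order error of
    \<open>Re_cpow_approx\<close>, which on the wider parabola is at most
    \<open>A'^2 * x powr (- p)\<close> with \<open>x = Re \<zeta> + 1\<close>.\<close>
  define m where "m = (\<lambda>s. c * exp (\<kappa> * (s powr p - A'\<^sup>2)))"
  have m: "m s > 0" for s using c by (simp add: m_def)
  \<comment> \<open>On this set \<open>Re \<zeta> + 1 > 1 / 2\<close>, so the maximum is inactive;
    it keeps the base positive and thus the profile continuous on the whole plane. The shift by 1
    keeps the branch point of the power outside.\<close>
  define U where "U = (\<lambda>R. {\<zeta>. - 1 / 2 < Re \<zeta> \<and> Re \<zeta> < R + 1 \<and> \<bar>Im \<zeta>\<bar> < A' * (max (1 / 2) (Re \<zeta> + 1)) powr \<alpha>})"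
  have openU: "open (U R)" for R
    unfolding U_def
    by (intro open_Collect_conj open_Collect_less continuous_intros) (auto simp: max_def)
  have holu: "u holomorphic_on U R" for R
    unfolding u_def by (intro holomorphic_intros Re_pos_not_nonpos_Reals) (auto simp: U_def)
  have u_lower: "Re (u \<zeta>) \<ge> c * exp (\<kappa> * Re (cpow p (\<zeta> + 1)))" if "\<zeta> \<in> U R" for \<zeta> R
  proof -
    have \<zeta>: "Re \<zeta> + 1 > 1 / 2" "\<bar>Im \<zeta>\<bar> < A' * (Re \<zeta> + 1) powr \<alpha>"
      using that by (auto simp: U_def max_def split: if_splits)
    have "\<zeta> + 1 = Complex (Re \<zeta> + 1) (Im \<zeta>)" by (simp add: complex_eq_iff)
    then have "\<bar>Im (cpow p (\<zeta> + 1))\<bar> \<le> p * \<bar>Im \<zeta>\<bar> * (Re \<zeta> + 1) powr (p - 1)"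
      using Im_cpow_bound[of "Re \<zeta> + 1" p "Im \<zeta>"] \<zeta> p by simp
    also have "\<dots> \<le> p * (A' * (Re \<zeta> + 1) powr \<alpha>) * (Re \<zeta> + 1) powr (p - 1)"
      using \<zeta> p by (intro mult_right_mono mult_left_mono) auto
    also have "\<dots> = p * A'"
      using \<zeta> by (simp add: p_def mult.assoc powr_add[symmetric])
    finally have "\<kappa> * \<bar>Im (cpow p (\<zeta> + 1))\<bar> \<le> \<kappa> * (p * A')"
      using \<kappa> by (intro mult_left_mono) auto
    then have "\<bar>\<kappa> * Im (cpow p (\<zeta> + 1))\<bar> \<le> \<kappa> * p * A'"
      using \<kappa> by (simp add: abs_mult mult.assoc)
    then have "c \<le> cos \<bar>\<kappa> * Im (cpow p (\<zeta> + 1))\<bar>"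
      unfolding c_def using A' by (intro cos_monotone_0_pi_le) auto
    then have "exp (\<kappa> * Re (cpow p (\<zeta> + 1))) * c \<le> exp (\<kappa> * Re (cpow p (\<zeta> + 1))) * cos (\<kappa> * Im (cpow p (\<zeta> + 1)))"
      by (intro mult_left_mono) auto
    then show ?thesis by (simp add: u_def Re_exp mult.commute)
  qed
  have u_pos: "Re (u \<zeta>) \<ge> 0" if "\<zeta> \<in> U R" for \<zeta> R
    by (rule order_trans[OF _ u_lower[OF that]]) (use c in simp)
  have u_m: "Re (u \<zeta>) \<ge> m s" if "\<zeta> \<in> U R" "s < Re \<zeta>" "0 \<le> s" for \<zeta> R s
  proof -
    have \<zeta>: "\<bar>Im \<zeta>\<bar> < A' * (Re \<zeta> + 1) powr \<alpha>"
      using that by (auto simp: U_def max_def split: if_splits)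
    let ?x = "Re \<zeta> + 1"
    have x: "?x > 1" using that by simp
    have "\<zeta> + 1 = Complex ?x (Im \<zeta>)" by (simp add: complex_eq_iff)
    then have "Re (cpow p (\<zeta> + 1)) \<ge> ?x powr p - \<bar>p * (p - 1)\<bar> * (Im \<zeta>)\<^sup>2 * ?x powr (p - 2)"
      using Re_cpow_approx[of ?x p "Im \<zeta>"] x p by (simp add: abs_le_iff)
    moreover have "\<bar>p * (p - 1)\<bar> * (Im \<zeta>)\<^sup>2 * ?x powr (p - 2) \<le> A'\<^sup>2"
    proof -
      have "(Im \<zeta>)\<^sup>2 \<le> (A' * ?x powr \<alpha>)\<^sup>2"
        using \<zeta> by (metis abs_ge_zero less_imp_le power2_abs power_mono)
      then have "(Im \<zeta>)\<^sup>2 * ?x powr (p - 2) \<le> (A' * ?x powr \<alpha>)\<^sup>2 * ?x powr (p - 2)"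
        by (intro mult_right_mono) auto
      also have "\<dots> = A'\<^sup>2 * ?x powr (- p)"
      proof -
        have "?x powr \<alpha> * ?x powr \<alpha> * ?x powr (p - 2) = ?x powr (\<alpha> + \<alpha> + (p - 2))"
          by (simp only: powr_add)
        also have "\<alpha> + \<alpha> + (p - 2) = - p" by (simp add: p_def)
        finally show ?thesis by (simp add: power2_eq_square ac_simps)
      qed
      also have "\<dots> \<le> A'\<^sup>2 * ?x powr 0"
        using x p by (intro mult_left_mono powr_mono) auto
      finally have 1: "(Im \<zeta>)\<^sup>2 * ?x powr (p - 2) \<le> A'\<^sup>2" using x by simp
      have "\<bar>p * (p - 1)\<bar> \<le> 1" using p by (simp add: abs_mult mult_le_one)
      then have "\<bar>p * (p - 1)\<bar> * ((Im \<zeta>)\<^sup>2 * ?x powr (p - 2)) \<le> 1 * A'\<^sup>2"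
        using 1 by (intro mult_mono) auto
      then show ?thesis by (simp add: mult.assoc)
    qed
    moreover have "?x powr p \<ge> s powr p" using that p by (intro powr_mono2) auto
    ultimately have "Re (cpow p (\<zeta> + 1)) \<ge> s powr p - A'\<^sup>2" by linarith
    then have "m s \<le> c * exp (\<kappa> * Re (cpow p (\<zeta> + 1)))"
      unfolding m_def using c \<kappa> by (intro mult_left_mono) auto
    then show ?thesis using u_lower[OF that(1)] by linarith
  qed
  define C where "C = \<bar>Re (u (cx z))\<bar> * exp (\<kappa> * A'\<^sup>2) / c"
  show ?thesis
  proof (rule that[of C])
    show "C \<ge> 0" using c by (simp add: C_def)
    fix s R :: real assume s: "0 \<le> s" "s < R" "fst z < R"
    define F where "F = (\<lambda>w. if cx w \<in> U R then 1 - Re (u (cx w)) / m s else 0)"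
    \<comment> \<open>A crude bound that grows with \<open>R\<close>. It serves the boundedness of
      \<open>F\<close> only and does not enter \<open>C\<close>.\<close>
    define G where "G = exp (\<kappa> * (R + 2 + A' * (R + 2) powr \<alpha>) powr p)"
    have u_le: "Re (u \<zeta>) \<le> G" if "\<zeta> \<in> U R" for \<zeta>
    proof -
      have \<zeta>: "0 < Re \<zeta> + 1" "Re \<zeta> + 1 \<le> R + 2" "\<bar>Im \<zeta>\<bar> < A' * (Re \<zeta> + 1) powr \<alpha>"
        using that by (auto simp: U_def max_def split: if_splits)
      then have "A' * (Re \<zeta> + 1) powr \<alpha> \<le> A' * (R + 2) powr \<alpha>"
        using A'0 alpha by (intro mult_left_mono powr_mono2) auto
      then have "cmod (\<zeta> + 1) \<le> R + 2 + A' * (R + 2) powr \<alpha>"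
        using cmod_le[of "\<zeta> + 1"] \<zeta> by simp
      then have "cmod (\<zeta> + 1) powr p \<le> (R + 2 + A' * (R + 2) powr \<alpha>) powr p"
        using p by (intro powr_mono2) auto
      moreover have "\<zeta> + 1 \<noteq> 0" using \<zeta>(1) by (auto simp: complex_eq_iff)
      ultimately have "Re (cpow p (\<zeta> + 1)) \<le> (R + 2 + A' * (R + 2) powr \<alpha>) powr p"
        using complex_Re_le_cmod[of "cpow p (\<zeta> + 1)"] by (simp add: norm_cpow)
      then have "exp (\<kappa> * Re (cpow p (\<zeta> + 1))) \<le> G"
        unfolding G_def using \<kappa> by simp
      moreover have "Re (u \<zeta>) \<le> exp (\<kappa> * Re (cpow p (\<zeta> + 1)))"
        using complex_Re_le_cmod[of "u \<zeta>"] by (simp add: u_def)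
      ultimately show ?thesis by linarith
    qed
    have meas: "F \<in> borel_measurable borel"
    proof -
      have "continuous_on (U R) (\<lambda>\<zeta>. 1 - Re (u \<zeta>) / m s)"
        using m[of s] by (intro continuous_intros holomorphic_on_imp_continuous_on holu) (simp add: less_imp_neq[symmetric])
      then have "(\<lambda>\<zeta>. if \<zeta> \<in> U R then 1 - Re (u \<zeta>) / m s else 0) \<in> borel_measurable borel"
        using openU[of R] by (intro borel_measurable_continuous_on_if) (auto intro: borel_open)
      then show ?thesis unfolding F_def by (rule measurable_compose[OF cx_measurable])
    qed
    have bnd: "\<bar>F w\<bar> \<le> 1 + G / m s" for w
    proof -
      have "0 \<le> G / m s" using m[of s] by (simp add: G_def less_imp_le)
      moreover have "0 \<le> Re (u (cx w)) / m s" "Re (u (cx w)) / m s \<le> G / m s" if "cx w \<in> U R"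
        using u_pos[OF that] u_le[OF that] m[of s] by (auto intro: divide_right_mono)
      ultimately show ?thesis unfolding F_def by (auto simp: abs_le_iff)
    qed
    have KU: "cx ` closed_truncated R \<subseteq> U R"
    proof
      fix \<zeta> assume "\<zeta> \<in> cx ` closed_truncated R"
      then have \<zeta>: "0 \<le> Re \<zeta>" "Re \<zeta> \<le> R" "\<bar>Im \<zeta>\<bar> \<le> A * Re \<zeta> powr \<alpha>"
        by (auto simp: closed_truncated_def)
      have "A * Re \<zeta> powr \<alpha> \<le> A * (Re \<zeta> + 1) powr \<alpha>"
        using \<zeta> A alpha by (intro mult_left_mono powr_mono2) auto
      also have "\<dots> < A' * (Re \<zeta> + 1) powr \<alpha>"
        using \<zeta> A' by (intro mult_strict_right_mono) auto
      finally show "\<zeta> \<in> U R" using \<zeta> by (auto simp: U_def max_def)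
    qed
    have "F z \<le> 1 * prob (exits_in (truncated R) {w. fst w \<le> s})"
    proof (rule harmonic_exit_principle[where I="{()}" and U="\<lambda>_. U R" and K="\<lambda>_. cx ` closed_truncated R"
          and g="\<lambda>_ \<zeta>. 1 - u \<zeta> / of_real (m s)"])
      show "compact (cx ` closed_truncated R)"
        by (intro compact_continuous_image continuous_intros compact_closed_truncated)
      show "(\<lambda>\<zeta>. 1 - u \<zeta> / of_real (m s)) holomorphic_on U R"
        using m[of s] by (intro holomorphic_intros holu) auto
      show "\<exists>i\<in>{()}. cx x \<in> cx ` closed_truncated R \<and> F x = Re (1 - u (cx x) / of_real (m s))" if "x \<in> truncated R" for x
        using that truncated_subset KU by (auto simp: F_def)
      show "closed {w :: real \<times> real. fst w \<le> s}" by (intro closed_Collect_le continuous_intros)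
      show "F w \<le> 1 * indicator {w. fst w \<le> s} w" for w
        using m[of s] u_pos[of "cx w" R] u_m[of "cx w" R s] s
        by (auto simp: F_def indicator_def field_simps)
      show "\<bar>F w\<bar> \<le> 1 + G / m s" for w by (rule bnd)
      show "z \<in> truncated R" by (rule z_truncated[OF s(3)])
    qed (use openU open_truncated bounded_truncated KU meas in \<open>simp_all add: F_def\<close>)
    moreover have "F z = 1 - Re (u (cx z)) / m s"
      using KU truncated_subset[of R] z_truncated[OF s(3)] by (auto simp: F_def)
    moreover have "Re (u (cx z)) / m s \<le> C * exp (- \<kappa> * s powr p)"
    proof -
      have "Re (u (cx z)) / m s \<le> \<bar>Re (u (cx z))\<bar> / m s"
        using m[of s] by (intro divide_right_mono) auto
      also have "\<dots> = C * exp (- \<kappa> * s powr p)"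
        by (simp add: C_def m_def right_diff_distrib exp_diff exp_minus field_simps)
      finally show ?thesis .
    qed
    ultimately show "1 - C * exp (- \<kappa> * s powr p) \<le> prob (exits_in (truncated R) {w. fst w \<le> s})"
      by linarith
  qed
qed

lemma upper_tail:
  assumes \<kappa>: "0 < \<kappa>" "\<kappa> < bc"
  obtains C where "C > 0"
    "\<And>u. prob {\<omega>\<in>space M. norm (exit_pos \<omega>) powr p > u} \<le> C * exp (- \<kappa> * u)"
proof -
  obtain C where C: "C \<ge> 0" "\<And>s R. 0 \<le> s \<Longrightarrow> s < R \<Longrightarrow> fst z < R \<Longrightarrow>
      1 - C * exp (- \<kappa> * s powr p) \<le> prob (exits_in (truncated R) {w. fst w \<le> s})"
    using upper_truncated[OF \<kappa>] by blast
  show ?thesis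
  proof (rule that[of "(C + 1) * exp (\<kappa> * A)"])
    show "(C + 1) * exp (\<kappa> * A) > 0" using C(1) by simp
    fix u :: real
    show "prob {\<omega>\<in>space M. norm (exit_pos \<omega>) powr p > u} \<le> (C + 1) * exp (\<kappa> * A) * exp (- \<kappa> * u)"
    proof (cases "u \<le> A")
      case True
      \<comment> \<open>For \<open>u \<le> A\<close> the factor \<open>exp (\<kappa> * A)\<close>
        makes the claimed bound at least 1.\<close>
      have "1 \<le> exp (\<kappa> * A) * exp (- \<kappa> * u)"
        using True \<kappa> by (simp flip: exp_add)
      also have "\<dots> \<le> (C + 1) * exp (\<kappa> * A) * exp (- \<kappa> * u)"
        using C(1) by (simp add: mult_le_cancel_right1)
      finally show ?thesis using prob_le_1 order_trans by blast
    next
      case False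
      \<comment> \<open>On the closed truncation
        \<open>norm w powr p \<le> fst w powr p + A\<close>, so an exit with abscissa at most
        \<open>s\<close> has \<open>norm w powr p \<le> u\<close>.\<close>
      define s where "s = (u - A) powr (1 / p)"
      define R where "R = max s (fst z) + 1"
      have s: "0 \<le> s" "s < R" "fst z < R" "s powr p = u - A"
        using False p by (auto simp: s_def R_def powr_powr)
      have DU: "truncated R \<noteq> UNIV" using parabola_neq_UNIV by (auto simp: truncated_def)
      have [measurable]: "{w :: real \<times> real. fst w \<le> s} \<in> sets borel"
        by (intro borel_closed closed_Collect_le continuous_intros)
      note [measurable] = exits_in_measurable[OF open_truncated DU]
      have "prob {\<omega>\<in>space M. norm (exit_pos \<omega>) powr p > u} \<le> prob (space M - exits_in (truncated R) {w. fst w \<le> s})"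
      proof (rule finite_measure_mono_AE)
        show "AE \<omega> in M. \<omega> \<in> {\<omega>\<in>space M. norm (exit_pos \<omega>) powr p > u} \<longrightarrow>
            \<omega> \<in> space M - exits_in (truncated R) {w. fst w \<le> s}"
          using AE_truncated_exit[OF s(3)]
        proof eventually_elim
          case (elim \<omega>)
          let ?e = "exit_position B (truncated R) \<omega>"
          show ?case
          proof (rule impI, rule ccontr)
            assume "\<omega> \<in> {\<omega>\<in>space M. norm (exit_pos \<omega>) powr p > u}"
              and "\<omega> \<notin> space M - exits_in (truncated R) {w. fst w \<le> s}"
            then have *: "norm (exit_pos \<omega>) powr p > u" "fst ?e \<le> s" by (auto simp: exits_in_def)
            then have "exit_pos \<omega> = ?e" using elim s by auto
            then have "norm (exit_pos \<omega>) powr p \<le> fst ?e powr p + A"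
              using norm_powr_closed_truncated_le[of ?e R] elim by simp
            also have "\<dots> \<le> s powr p + A"
              using * elim p by (intro add_mono powr_mono2) (auto simp: closed_truncated_def)
            finally show False using * s by simp
          qed
        qed
      qed measurable
      also have "\<dots> = 1 - prob (exits_in (truncated R) {w. fst w \<le> s})"
        by (rule prob_compl) measurable
      also have "\<dots> \<le> C * exp (- \<kappa> * s powr p)" using C(2)[OF s(1-3)] by linarith
      also have "\<dots> \<le> (C + 1) * exp (- \<kappa> * (u - A))"
        unfolding s(4) by (intro mult_right_mono) auto
      also have "\<dots> = (C + 1) * exp (\<kappa> * A) * exp (- \<kappa> * u)"
        by (simp add: right_diff_distrib exp_diff exp_minus field_simps)
      finally show ?thesis .
    qed
  qed
qed

end

section \<open>Parabola-shaped domains: the lower tail\<close>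

lemma cos_nonpos:
  assumes "pi / 2 \<le> \<bar>u\<bar>" "\<bar>u\<bar> \<le> 3 * pi / 2"
  shows "cos u \<le> 0"
proof -
  have "0 \<le> cos (\<bar>u\<bar> - pi)" using assms by (intro cos_ge_zero) auto
  then show ?thesis by simp
qed

lemma cos_ge_half:
  assumes "\<bar>u\<bar> \<le> pi / 3"
  shows "1 / 2 \<le> cos u"
proof -
  have "cos (pi / 3) \<le> cos \<bar>u\<bar>" using assms by (intro cos_monotone_0_pi_le) auto
  then show ?thesis by (simp add: cos_60)
qed

context parabola_exit
begin

definition sigma :: real where "sigma = p / 2"

text \<open>The perturbation \<open>\<zeta> powr - sigma\<close> is bounded, so it costs only a constant factor in \<open>exp (Re phi)\<close>.
  On the sides of the parabola it raises \<open>\<bar>Im phi\<bar>\<close> by the order of \<open>x powr - (3 sigma)\<close>, which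
  outweighs the error of order \<open>x powr - (4 sigma)\<close> of the first term.\<close>

definition phi :: "complex \<Rightarrow> complex" where
  "phi \<zeta> = of_real bc * cpow p \<zeta> - cpow (- sigma) \<zeta>"

lemma sigma: "sigma > 0" "sigma < 1" using p by (auto simp: sigma_def)

lemma holomorphic_phi: "(\<And>\<zeta>. \<zeta> \<in> S \<Longrightarrow> Re \<zeta> > 0) \<Longrightarrow> phi holomorphic_on S"
  unfolding phi_def[abs_def] by (intro holomorphic_intros Re_pos_not_nonpos_Reals) auto

lemma Re_phi_le:
  assumes "1 \<le> Re \<zeta>"
  shows "Re (phi \<zeta>) \<le> bc * cmod \<zeta> powr p + 1"
proof -
  have n: "1 \<le> cmod \<zeta>" using complex_Re_le_cmod[of \<zeta>] assms by linarith
  then have "\<zeta> \<noteq> 0" by auto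
  have "Re (cpow p \<zeta>) \<le> cmod \<zeta> powr p"
    using complex_Re_le_cmod[of "cpow p \<zeta>"] norm_cpow[OF \<open>\<zeta> \<noteq> 0\<close>] by simp
  then have "bc * Re (cpow p \<zeta>) \<le> bc * cmod \<zeta> powr p" using bc by (intro mult_left_mono) auto
  moreover have "- Re (cpow (- sigma) \<zeta>) \<le> 1"
  proof -
    have "cmod (cpow (- sigma) \<zeta>) = cmod \<zeta> powr (- sigma)" by (rule norm_cpow[OF \<open>\<zeta> \<noteq> 0\<close>])
    also have "\<dots> \<le> cmod \<zeta> powr 0" using n sigma by (intro powr_mono) auto
    finally have "cmod (cpow (- sigma) \<zeta>) \<le> 1" using n by (auto split: if_splits)
    then show ?thesis using abs_Re_le_cmod[of "cpow (- sigma) \<zeta>"] by linarith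
  qed
  ultimately show ?thesis by (simp add: phi_def)
qed

lemma eventually_neg_powr_less:
  fixes q \<epsilon> :: real
  assumes "q > 0" "\<epsilon> > 0"
  shows "\<forall>\<^sub>F x in at_top. x powr (- q) < \<epsilon>"
  using tendsto_neg_powr[of "- q" "\<lambda>x. x" at_top] assms
  by (intro order_tendstoD(2)[of _ 0]) (auto intro: filterlim_ident)

lemma Im_phi_side:
  obtains x0 where "x0 \<ge> 2"
    "\<And>x y. x \<ge> x0 \<Longrightarrow> \<bar>y\<bar> = A * x powr \<alpha> \<Longrightarrow> pi / 2 < \<bar>Im (phi (Complex x y))\<bar>"
proof -
  define C1 where "C1 = \<bar>p * (p - 1) * (p - 2)\<bar>"
  define C2 where "C2 = \<bar>- sigma * (- sigma - 1) * (- sigma - 2)\<bar>"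
  \<comment> \<open>Collects the error coefficients of both powers; the added 1 keeps the later
    divisor positive.\<close>
  define K where "K = (bc * C1 + C2) * A ^ 3 + 1"
  have K: "K > 0" using bc A by (simp add: K_def C1_def C2_def add_nonneg_pos)
  have "\<forall>\<^sub>F x in at_top. x powr (- sigma) < sigma * A / K"
    using sigma A K by (intro eventually_neg_powr_less) auto
  then obtain b where b: "\<And>x. x \<ge> b \<Longrightarrow> x powr (- sigma) < sigma * A / K"
    by (auto simp: eventually_at_top_linorder)
  show ?thesis
  proof (rule that[of "max 2 b"])
    fix x y :: real assume x: "x \<ge> max 2 b" and y: "\<bar>y\<bar> = A * x powr \<alpha>"
    have x0: "x > 0" "x \<ge> 1" using x by auto
    \<comment> \<open>The sign of \<open>y\<close>, so that one computation covers both sides of the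
      parabola.\<close>
    define e where "e = sgn y"
    have "y \<noteq> 0" using y A x0 by auto
    then have e: "\<bar>e\<bar> = 1" "e * y = A * x powr \<alpha>"
      using y by (auto simp: e_def sgn_if abs_if split: if_splits)
    have ey: "e * (a * y) = a * (A * x powr \<alpha>)" for a
      using e(2) by (metis mult.left_commute)
    have main: "\<bar>e * Im (cpow q (Complex x y)) - q * A * x powr (\<alpha> + (q - 1))\<bar>
        \<le> \<bar>q * (q - 1) * (q - 2)\<bar> * A ^ 3 * x powr (3 * \<alpha> + (q - 3))" if "q \<le> 1" for q
    proof -
      have "e * Im (cpow q (Complex x y)) - q * A * x powr (\<alpha> + (q - 1))
          = e * (Im (cpow q (Complex x y)) - q * y * x powr (q - 1))"
        using e(2) by (auto simp: right_diff_distrib powr_add ac_simps)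
      then have "\<bar>e * Im (cpow q (Complex x y)) - q * A * x powr (\<alpha> + (q - 1))\<bar>
          = \<bar>Im (cpow q (Complex x y)) - q * y * x powr (q - 1)\<bar>"
        by (simp add: abs_mult e(1))
      also have "\<dots> \<le> \<bar>q * (q - 1) * (q - 2)\<bar> * \<bar>y\<bar> ^ 3 * x powr (q - 3)"
        by (rule Im_cpow_approx[OF x0(1) that])
      also have "\<bar>y\<bar> ^ 3 = A ^ 3 * x powr (3 * \<alpha>)"
        using x0 by (simp add: y power_mult_distrib powr_powr[symmetric] mult.commute[of 3 \<alpha>] powr_numeral)
      finally show ?thesis by (simp add: powr_add ac_simps)
    qed
    \<comment> \<open>The exponents of main terms and errors on the side, in units of
      \<open>sigma\<close>. The main term of \<open>\<zeta>^p\<close> has exponent 0: it is the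
      constant \<open>p * A\<close>, and \<open>bc\<close> times it is exactly
      \<open>pi / 2\<close>.\<close>
    have ex: "\<alpha> + (p - 1) = 0" "3 * \<alpha> + (p - 3) = - (4 * sigma)"
      "\<alpha> + (- sigma - 1) = - (3 * sigma)" "3 * \<alpha> + (- sigma - 3) = - (7 * sigma)"
      by (simp_all add: sigma_def p_def field_simps)
    have 1: "e * Im (cpow p (Complex x y)) \<ge> p * A - C1 * A ^ 3 * x powr (- (4 * sigma))"
      using main[of p] p x0 unfolding ex C1_def[symmetric] by (simp add: abs_le_iff)
    have 2: "e * Im (cpow (- sigma) (Complex x y)) \<le> - sigma * A * x powr (- (3 * sigma)) + C2 * A ^ 3 * x powr (- (7 * sigma))"
      using main[of "- sigma"] sigma unfolding ex C2_def[symmetric] by (simp add: abs_le_iff)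
    have 3: "x powr (- (7 * sigma)) \<le> x powr (- (4 * sigma))"
      using x0 sigma by (intro powr_mono) auto
    have "bc * (p * A - C1 * A ^ 3 * x powr (- (4 * sigma))) \<le> bc * (e * Im (cpow p (Complex x y)))"
      using 1 bc by (intro mult_left_mono) auto
    then have 4: "pi / 2 - bc * C1 * A ^ 3 * x powr (- (4 * sigma)) \<le> bc * (e * Im (cpow p (Complex x y)))"
      using bc(2) by (simp add: right_diff_distrib mult.assoc)
    have 5: "C2 * A ^ 3 * x powr (- (7 * sigma)) \<le> C2 * A ^ 3 * x powr (- (4 * sigma))"
      using 3 A by (intro mult_left_mono) (auto simp: C2_def)
    have "e * Im (phi (Complex x y)) \<ge> pi / 2 + sigma * A * x powr (- (3 * sigma)) - (bc * C1 + C2) * A ^ 3 * x powr (- (4 * sigma))"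
      using 2 4 5 by (simp add: phi_def algebra_simps)
    moreover have "(bc * C1 + C2) * A ^ 3 * x powr (- (4 * sigma)) < sigma * A * x powr (- (3 * sigma))"
    proof -
      have "x powr (- (4 * sigma)) = x powr (- (3 * sigma)) * x powr (- sigma)"
        by (simp flip: powr_add)
      have "(bc * C1 + C2) * A ^ 3 * x powr (- sigma) \<le> K * x powr (- sigma)"
        by (intro mult_right_mono) (auto simp: K_def)
      also have "\<dots> < sigma * A" using b[of x] x K by (simp add: pos_less_divide_eq mult.commute)
      finally have "x powr (- (3 * sigma)) * ((bc * C1 + C2) * A ^ 3 * x powr (- sigma)) < x powr (- (3 * sigma)) * (sigma * A)"
        using x0 by (intro mult_strict_left_mono) auto
      then show ?thesis
        unfolding \<open>x powr (- (4 * sigma)) = x powr (- (3 * sigma)) * x powr (- sigma)\<close>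
        by (simp add: ac_simps)
    qed
    ultimately have "pi / 2 < e * Im (phi (Complex x y))" by linarith
    also have "\<dots> \<le> \<bar>e\<bar> * \<bar>Im (phi (Complex x y))\<bar>" by (metis abs_ge_self abs_mult)
    finally show "pi / 2 < \<bar>Im (phi (Complex x y))\<bar>" by (simp add: e(1))
  qed simp
qed

text \<open>At bounded height the imaginary part of \<open>phi\<close> tends to 0 and its real part
  to infinity, so \<open>Re (exp phi)\<close> exceeds any given level far to the right. This lets
  \<open>g2\<close> in \<open>lower_tail\<close> take over from the half-strip around the
  start.\<close>

lemma phi_near_axis:
  obtains x1 where "x1 \<ge> b"
    "\<And>x y. x \<ge> x1 \<Longrightarrow> \<bar>y\<bar> \<le> Y \<Longrightarrow> \<bar>Im (phi (Complex x y))\<bar> \<le> 1"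
    "\<And>x y. x \<ge> x1 \<Longrightarrow> \<bar>y\<bar> \<le> Y \<Longrightarrow> N \<le> Re (exp (phi (Complex x y)))"
proof -
  define Y' where "Y' = \<bar>Y\<bar> + 1"
  define \<epsilon> where "\<epsilon> = 1 / (2 * (bc * p * Y' + sigma * Y'))"
  have den: "bc * p * Y' + sigma * Y' > 0"
    using bc p sigma by (simp add: Y'_def add_pos_pos)
  have \<epsilon>: "\<epsilon> > 0" using den by (simp add: \<epsilon>_def)
  have "\<forall>\<^sub>F x in at_top. x powr (- \<alpha>) < \<epsilon>" "\<forall>\<^sub>F x in at_top. x powr (- (sigma + 1)) < \<epsilon>"
    using alpha sigma \<epsilon> by (auto intro!: eventually_neg_powr_less simp del: minus_add_distrib)
  then have "\<forall>\<^sub>F x in at_top. x powr (- \<alpha>) < \<epsilon> \<and> x powr (- (sigma + 1)) < \<epsilon>"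
    by (rule eventually_conj)
  then obtain b1 where b1: "\<And>x. x \<ge> b1 \<Longrightarrow> x powr (- \<alpha>) < \<epsilon>" "\<And>x. x \<ge> b1 \<Longrightarrow> x powr (- (sigma + 1)) < \<epsilon>"
    by (auto simp: eventually_at_top_linorder)
  \<comment> \<open>Chosen so that \<open>bc * (T - Y'^2)\<close> equals
    \<open>\<bar>ln (2 * (\<bar>N\<bar> + 1))\<bar> + 1\<close>. The final 1 pays for the
    perturbation in \<open>phi\<close>, the factor 2 under the logarithm for a cosine that is only
    known to be at least 1 / 2.\<close>
  define T where "T = (\<bar>ln (2 * (\<bar>N\<bar> + 1))\<bar> + bc * Y'\<^sup>2 + 1) / bc"
  have T: "T > 0" using bc by (simp add: T_def add_nonneg_pos)
  define b2 where "b2 = T powr (1 / p)"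
  show ?thesis
  proof (rule that[of "max (max b 1) (max b1 b2)"])
    fix x y :: real assume x: "x \<ge> max (max b 1) (max b1 b2)" and y: "\<bar>y\<bar> \<le> Y"
    have x1: "x \<ge> 1" "x > 0" using x by auto
    have y': "\<bar>y\<bar> \<le> Y'" using y by (simp add: Y'_def)
    have e1: "\<bar>Im (cpow p (Complex x y))\<bar> \<le> p * Y' * \<epsilon>"
    proof -
      have "\<bar>Im (cpow p (Complex x y))\<bar> \<le> p * \<bar>y\<bar> * x powr (p - 1)"
        using Im_cpow_bound[OF x1(2), of p y] p by simp
      also have "\<dots> \<le> p * Y' * \<epsilon>"
        using b1(1)[of x] x y' p by (intro mult_mono) (auto simp: p_def Y'_def)
      finally show ?thesis .
    qed
    have e2: "\<bar>Im (cpow (- sigma) (Complex x y))\<bar> \<le> sigma * Y' * \<epsilon>"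
    proof -
      have "\<bar>Im (cpow (- sigma) (Complex x y))\<bar> \<le> sigma * \<bar>y\<bar> * x powr (- (sigma + 1))"
        using Im_cpow_bound[OF x1(2), of "- sigma" y] sigma by simp
      also have "\<dots> \<le> sigma * Y' * \<epsilon>"
        using b1(2)[of x] x y' sigma by (intro mult_mono) (auto simp: Y'_def)
      finally show ?thesis .
    qed
    have "\<bar>Im (phi (Complex x y))\<bar> \<le> bc * \<bar>Im (cpow p (Complex x y))\<bar> + \<bar>Im (cpow (- sigma) (Complex x y))\<bar>"
      using bc abs_triangle_ineq4[of "bc * Im (cpow p (Complex x y))" "Im (cpow (- sigma) (Complex x y))"]
      by (simp add: phi_def abs_mult)
    also have "\<dots> \<le> bc * (p * Y' * \<epsilon>) + sigma * Y' * \<epsilon>"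
      using e1 e2 bc by (intro add_mono mult_left_mono) auto
    also have "\<dots> = (bc * p * Y' + sigma * Y') * \<epsilon>" by (simp add: algebra_simps)
    also have "\<dots> = 1 / 2" using den by (simp add: \<epsilon>_def)
    finally have im: "\<bar>Im (phi (Complex x y))\<bar> \<le> 1 / 2" .
    then show "\<bar>Im (phi (Complex x y))\<bar> \<le> 1" by simp
    have "Re (cpow p (Complex x y)) \<ge> x powr p - \<bar>p * (p - 1)\<bar> * y\<^sup>2 * x powr (p - 2)"
      using Re_cpow_approx[OF x1(2), of p y] p by (simp add: abs_le_iff)
    moreover have "\<bar>p * (p - 1)\<bar> * y\<^sup>2 * x powr (p - 2) \<le> 1 * Y'\<^sup>2 * x powr 0"
    proof (intro mult_mono)
      show "\<bar>p * (p - 1)\<bar> \<le> 1" using p by (simp add: abs_mult mult_le_one)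
      show "y\<^sup>2 \<le> Y'\<^sup>2" using y' by (metis abs_ge_zero power2_abs power_mono)
      show "x powr (p - 2) \<le> x powr 0" using x1 p by (intro powr_mono) auto
    qed auto
    moreover have "T \<le> x powr p"
    proof -
      have "T = b2 powr p" using T p by (simp add: b2_def powr_powr)
      also have "\<dots> \<le> x powr p" using x p by (intro powr_mono2) (auto simp: b2_def)
      finally show ?thesis .
    qed
    ultimately have "T - Y'\<^sup>2 \<le> Re (cpow p (Complex x y))" using x1 by simp
    then have "bc * (T - Y'\<^sup>2) \<le> bc * Re (cpow p (Complex x y))" using bc by (intro mult_left_mono) auto
    moreover have "bc * (T - Y'\<^sup>2) = \<bar>ln (2 * (\<bar>N\<bar> + 1))\<bar> + 1"
      using bc by (simp add: T_def field_simps)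
    moreover have "Re (cpow (- sigma) (Complex x y)) \<le> 1"
    proof -
      have "cmod (cpow (- sigma) (Complex x y)) \<le> x powr (- sigma)"
        using x1 sigma by (intro norm_cpow_le) auto
      also have "\<dots> \<le> x powr 0" using x1 sigma by (intro powr_mono) auto
      finally show ?thesis using x1 complex_Re_le_cmod[of "cpow (- sigma) (Complex x y)"] by simp
    qed
    ultimately have "ln (2 * (\<bar>N\<bar> + 1)) \<le> Re (phi (Complex x y))"
      by (simp add: phi_def)
    then have "2 * (\<bar>N\<bar> + 1) \<le> exp (Re (phi (Complex x y)))"
      by (metis abs_ge_zero add_nonneg_pos exp_le_cancel_iff exp_ln mult_pos_pos zero_less_numeral zero_less_one)
    moreover have "1 / 2 \<le> cos (Im (phi (Complex x y)))"
      using im pi_gt3 by (intro cos_ge_half) auto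
    ultimately have "2 * (\<bar>N\<bar> + 1) * (1 / 2) \<le> exp (Re (phi (Complex x y))) * cos (Im (phi (Complex x y)))"
      by (intro mult_mono) auto
    then show "N \<le> Re (exp (phi (Complex x y)))" by (simp add: Re_exp)
  qed simp
qed

end

lemma compact_cx_image: "compact K \<Longrightarrow> compact (cx ` K)"
  by (intro compact_continuous_image continuous_intros)

lemma cx_Complex: "cx w = Complex (fst w) (snd w)"
  by (simp add: complex_eq_iff)

context parabola_exit
begin

text \<open>The parabola widens to the right, so a thin horizontal half-strip at the height of
  \<open>z\<close> that begins a little to the left of \<open>z\<close> stays inside. Strict
  inequality at \<open>z\<close> leaves room for both margins.\<close>

lemma room_left_of_start:
  obtains xl \<delta> where "0 < xl" "xl < fst z" "\<delta> > 0" "\<bar>snd z\<bar> + \<delta> < A * xl powr \<alpha>"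
proof -
  have z': "fst z > 0" "\<bar>snd z\<bar> < A * fst z powr \<alpha>"
    using z by (auto simp: parabola_domain_def)
  define r where "r = (\<bar>snd z\<bar> / A + fst z powr \<alpha>) / 2"
  have r: "\<bar>snd z\<bar> / A < r" "r < fst z powr \<alpha>" "r > 0"
    using z' A by (auto simp: r_def field_simps add_pos_nonneg)
  define xl where "xl = r powr (1 / \<alpha>)"
  have xl: "xl > 0" "xl powr \<alpha> = r" using r alpha by (auto simp: xl_def powr_powr)
  have "xl < (fst z powr \<alpha>) powr (1 / \<alpha>)"
    unfolding xl_def using r alpha by (intro powr_less_mono2) auto
  then have "xl < fst z" using z' alpha by (simp add: powr_powr)
  moreover have "\<bar>snd z\<bar> < A * xl powr \<alpha>" using r A by (simp add: xl field_simps)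
  ultimately show ?thesis
    using that[of xl "(A * xl powr \<alpha> - \<bar>snd z\<bar>) / 2"] xl(1) by (simp add: field_simps)
qed

text \<open>Three harmonic functions are glued by taking maxima: \<open>g1\<close> is positive in a horizontal half-strip
  containing \<open>z\<close>, \<open>g2\<close> follows the parabola up to distance about \<open>t\<close> and is negative on its sides, and
  \<open>g3\<close>, on the scale \<open>t powr \<alpha>\<close> of the width at \<open>t\<close>, is positive across the sides just beyond \<open>t\<close>.
  Where one of them is cut off at a positive value, the next one is larger.\<close>

lemma lower_tail:
  obtains c t0 where "c > 0" "t0 \<ge> 1"
    "\<And>t. t \<ge> t0 \<Longrightarrow> c * exp (- bc * t powr p) \<le> prob {\<omega>\<in>space M. norm (exit_pos \<omega>) > t}"
proof -
  obtain xl \<delta> where xl: "0 < xl" "xl < fst z" and \<delta>: "\<delta> > 0" "\<bar>snd z\<bar> + \<delta> < A * xl powr \<alpha>"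
    by (rule room_left_of_start)
  obtain x0 where x0: "x0 \<ge> 2"
    and side: "\<And>x y. x \<ge> x0 \<Longrightarrow> \<bar>y\<bar> = A * x powr \<alpha> \<Longrightarrow> pi / 2 < \<bar>Im (phi (Complex x y))\<bar>"
    using Im_phi_side by blast
  \<comment> \<open>\<open>r0\<close> bounds the modulus where the abscissa is at most
    \<open>x0\<close> and the height at most \<open>2 * A * x0 powr \<alpha>\<close>. With the level
    \<open>K\<close> subtracted, \<open>g2\<close> is nonpositive just to the left of
    \<open>x0\<close> and can be cut off there.\<close>
  define r0 where "r0 = x0 + 2 * A * x0 powr \<alpha>"
  define K where "K = exp (bc * r0 powr p + 1)"
  have K: "K > 0" by (simp add: K_def)
  \<comment> \<open>The level \<open>2 * K\<close> leaves \<open>g2 \<ge> K\<close> in the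
    half-strip beyond \<open>x1\<close> after \<open>K\<close> has been subtracted.\<close>
  obtain x1 where x1: "x1 \<ge> max x0 (fst z)"
    and axis: "\<And>x y. x \<ge> x1 \<Longrightarrow> \<bar>y\<bar> \<le> \<bar>snd z\<bar> + \<delta> \<Longrightarrow> \<bar>Im (phi (Complex x y))\<bar> \<le> 1"
      "\<And>x y. x \<ge> x1 \<Longrightarrow> \<bar>y\<bar> \<le> \<bar>snd z\<bar> + \<delta> \<Longrightarrow> 2 * K \<le> Re (exp (phi (Complex x y)))"
    using phi_near_axis[of "max x0 (fst z)" "\<bar>snd z\<bar> + \<delta>" "2 * K"] by blast
  \<comment> \<open>The cosine in \<open>g1\<close> vanishes on the edges of the strip of half-width
    \<delta>.\<close>
  define \<mu>1 where "\<mu>1 = pi / (2 * \<delta>)"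
  \<comment> \<open>Scaled so that \<open>g1 \<le> K \<le> g2\<close> where the half-strip is cut
    off, between \<open>x1\<close> and \<open>x1 + 1\<close>.\<close>
  define a1 where "a1 = K * exp (- \<mu>1 * (x1 + 1))"
  define g1 where "g1 = (\<lambda>\<zeta> :: complex. of_real a1 * (exp (of_real \<mu>1 * (\<zeta> - \<i> * of_real (snd z))) - of_real (exp (\<mu>1 * xl))))"
  define g2 where "g2 = (\<lambda>\<zeta>. exp (phi \<zeta>) - of_real K)"
  have \<mu>1: "\<mu>1 > 0" "\<mu>1 * \<delta> = pi / 2" using \<delta> by (auto simp: \<mu>1_def)
  have a1: "a1 > 0" using K by (simp add: a1_def)
  have Re_g1: "Re (g1 (cx w)) = a1 * (exp (\<mu>1 * fst w) * cos (\<mu>1 * (snd w - snd z)) - exp (\<mu>1 * xl))" for w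
    by (simp add: g1_def Re_exp)
  have g1_le: "Re (g1 (cx w)) \<le> K" if "fst w \<le> x1 + 1" for w
  proof -
    have "exp (\<mu>1 * fst w) * cos (\<mu>1 * (snd w - snd z)) \<le> exp (\<mu>1 * fst w) * 1"
      by (intro mult_left_mono) auto
    also have "\<dots> \<le> exp (\<mu>1 * (x1 + 1))" using that \<mu>1 by simp
    finally have "exp (\<mu>1 * fst w) * cos (\<mu>1 * (snd w - snd z)) - exp (\<mu>1 * xl) \<le> exp (\<mu>1 * (x1 + 1))"
      by (smt (verit) exp_gt_zero)
    then have "Re (g1 (cx w)) \<le> a1 * exp (\<mu>1 * (x1 + 1))"
      unfolding Re_g1 using a1 by (intro mult_left_mono) auto
    also have "\<dots> = K" by (simp add: a1_def exp_minus)
    finally show ?thesis .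
  qed
  have g1_left: "Re (g1 (cx w)) \<le> 0" if "fst w \<le> xl" for w
  proof -
    have "exp (\<mu>1 * fst w) * cos (\<mu>1 * (snd w - snd z)) \<le> exp (\<mu>1 * fst w) * 1"
      by (intro mult_left_mono) auto
    also have "\<dots> \<le> exp (\<mu>1 * xl)" using that \<mu>1 by simp
    finally show ?thesis unfolding Re_g1 using a1 by (simp add: mult_le_0_iff)
  qed
  have g1_side: "Re (g1 (cx w)) \<le> 0" if "\<delta> \<le> \<bar>snd w - snd z\<bar>" "\<bar>snd w - snd z\<bar> < 2 * \<delta>" for w
  proof -
    have "\<bar>\<mu>1 * (snd w - snd z)\<bar> = \<mu>1 * \<bar>snd w - snd z\<bar>" using \<mu>1 by (simp add: abs_mult)
    moreover have "\<mu>1 * \<delta> \<le> \<mu>1 * \<bar>snd w - snd z\<bar>" "\<mu>1 * \<bar>snd w - snd z\<bar> \<le> \<mu>1 * (2 * \<delta>)"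
      using that \<mu>1 by (auto intro!: mult_left_mono)
    ultimately have "cos (\<mu>1 * (snd w - snd z)) \<le> 0"
      using \<mu>1(2) by (intro cos_nonpos) auto
    then have "exp (\<mu>1 * fst w) * cos (\<mu>1 * (snd w - snd z)) \<le> 0" by (simp add: mult_le_0_iff)
    then have "exp (\<mu>1 * fst w) * cos (\<mu>1 * (snd w - snd z)) - exp (\<mu>1 * xl) \<le> 0"
      by (smt (verit) exp_gt_zero)
    then show ?thesis unfolding Re_g1 using a1 by (simp add: mult_le_0_iff)
  qed
  have Re_g2: "Re (g2 \<zeta>) = exp (Re (phi \<zeta>)) * cos (Im (phi \<zeta>)) - K" for \<zeta>
    by (simp add: g2_def Re_exp)
  have g2_le: "Re (g2 \<zeta>) \<le> exp (bc * s powr p + 1) - K" if "1 \<le> Re \<zeta>" "cmod \<zeta> \<le> s" for \<zeta> s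
  proof -
    have "Re (phi \<zeta>) \<le> bc * cmod \<zeta> powr p + 1" using that(1) by (rule Re_phi_le)
    also have "\<dots> \<le> bc * s powr p + 1"
      using that bc p by (intro add_mono mult_left_mono powr_mono2) auto
    finally have "exp (Re (phi \<zeta>)) \<le> exp (bc * s powr p + 1)" by simp
    moreover have "exp (Re (phi \<zeta>)) * cos (Im (phi \<zeta>)) \<le> exp (Re (phi \<zeta>)) * 1"
      by (intro mult_left_mono) auto
    ultimately have "exp (Re (phi \<zeta>)) * cos (Im (phi \<zeta>)) \<le> exp (bc * s powr p + 1)" by linarith
    then show ?thesis by (simp add: Re_g2)
  qed
  define c1 where "c1 = Re (g1 (cx z))"
  have c1: "c1 > 0" unfolding c1_def Re_g1 using a1 xl \<mu>1 by simp
  \<comment> \<open>In the parabola of doubled width and up to abscissa \<open>R\<close>, the norm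
    is at most \<open>t + 2 * l + 6 * A * l\<close> with \<open>l = t powr \<alpha>\<close>;
    \<open>powr_add_le\<close> turns the excess into the additive constant \<open>W\<close>.\<close>
  define W where "W = 2 + 6 * A"
  define c3 where "c3 = 2 * exp (bc * W + 1) * exp (3 * pi * A)"
  have c3: "c3 > 0" by (simp add: c3_def)
  define t0 where "t0 = max (x1 + 1) (max r0 1)"
  show ?thesis
  proof (rule that[of "c1 / c3" t0])
    show "c1 / c3 > 0" using c1 c3 by simp
    show "t0 \<ge> 1" by (simp add: t0_def)
    fix t assume t: "t \<ge> t0"
    then have t1: "t \<ge> 1" "x1 + 1 \<le> t" "r0 \<le> t" by (auto simp: t0_def)
    \<comment> \<open>The width of the domain at abscissa \<open>t\<close>, up to a constant.
      Lengths beyond \<open>t\<close> scale with it, so the price of the last piece is a constant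
      factor.\<close>
    define l where "l = t powr \<alpha>"
    have l: "1 \<le> l" "l \<le> t"
      using t1 alpha powr_mono[of \<alpha> 1 t] by (auto simp: l_def ge_one_powr_ge_zero)
    \<comment> \<open>The half-wave \<open>cos (\<mu> * (x - xc))\<close> has its crest at
      \<open>xc\<close> and its zeros at \<open>t\<close> and \<open>R\<close>.\<close>
    define xc where "xc = t + l"
    define R where "R = t + 2 * l"
    define \<mu> where "\<mu> = pi / (2 * l)"
    have \<mu>: "\<mu> > 0" "\<mu> * l = pi / 2" using l by (auto simp: \<mu>_def)
    define E where "E = exp (bc * (t powr p + W) + 1)"
    have E: "E > 0" by (simp add: E_def)
    have width: "A * x powr \<alpha> \<le> 3 * A * l" if "0 \<le> x" "x \<le> R" for x
    proof -
      have "x powr \<alpha> \<le> (3 * t) powr \<alpha>" using that l alpha by (intro powr_mono2) (auto simp: R_def)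
      also have "\<dots> = 3 powr \<alpha> * l" using t1 by (simp add: powr_mult l_def)
      also have "\<dots> \<le> 3 * l" using l alpha powr_mono[of \<alpha> 1 3] by (intro mult_right_mono) auto
      finally show ?thesis using A by (simp add: mult.assoc mult.left_commute)
    qed
    have KE: "K \<le> E"
    proof -
      have "r0 powr p \<le> t powr p" using t1 p x0 A by (intro powr_mono2) (auto simp: r0_def)
      then have "bc * r0 powr p \<le> bc * (t powr p + W)" using bc A by (intro mult_left_mono) (auto simp: W_def)
      then show ?thesis by (simp add: K_def E_def)
    qed
    have g2_E: "Re (g2 (cx w)) \<le> E" if "1 \<le> fst w" "fst w \<le> R" "\<bar>snd w\<bar> \<le> 2 * A * fst w powr \<alpha>" for w
    proof -
      have "cmod (cx w) \<le> fst w + \<bar>snd w\<bar>"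
        using norm_pair_le_sum[of "fst w" "snd w"] that by simp
      also have "\<dots> \<le> R + 6 * A * l" using that width[of "fst w"] by simp
      also have "\<dots> = t + W * t powr (1 - p)" by (simp add: R_def W_def l_def p_def algebra_simps)
      finally have "Re (g2 (cx w)) \<le> exp (bc * (t + W * t powr (1 - p)) powr p + 1) - K"
        using that by (intro g2_le) auto
      also have "\<dots> \<le> exp (bc * (t powr p + W) + 1)"
        using powr_add_le[of p W t] p A t1 bc K
        by (simp add: W_def) (smt (verit) exp_le_cancel_iff mult_left_mono)
      finally show ?thesis by (simp add: E_def)
    qed
    \<comment> \<open>The amplitude \<open>2 * E\<close> makes \<open>g3\<close> at least
      \<open>E\<close>, hence at least \<open>g2\<close>, wherever the cosine is at least 1 / 2. The
      hyperbolic cosine in its real part is at least 1 and, at heights of order \<open>l\<close>,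
      bounded independently of \<open>t\<close>.\<close>
    define g3 where "g3 = (\<lambda>\<zeta> :: complex. of_real (2 * E) * cos (of_real \<mu> * (\<zeta> - of_real xc)))"
    define ch where "ch = (\<lambda>y :: real. cosh (\<mu> * y))"
    have Re_g3: "Re (g3 (cx w)) = 2 * E * (cos (\<mu> * (fst w - xc)) * ch (snd w))" for w
      by (simp add: g3_def ch_def Re_cos cosh_field_def)
    have ch: "1 \<le> ch y" for y by (simp add: ch_def cosh_real_ge_1)
    have ch_le: "ch y \<le> exp (3 * pi * A)" if "\<bar>y\<bar> \<le> 6 * A * l" for y
    proof -
      have "\<mu> * \<bar>y\<bar> \<le> \<mu> * (6 * A * l)" using that \<mu> by (intro mult_left_mono) auto
      also have "\<dots> = 3 * pi * A" using \<mu>(2) by simp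
      finally have "\<bar>\<mu> * y\<bar> \<le> 3 * pi * A" using \<mu>(1) by (simp add: abs_mult)
      then have "exp (\<mu> * y) \<le> exp (3 * pi * A)" "exp (- (\<mu> * y)) \<le> exp (3 * pi * A)"
        by (simp_all add: abs_le_iff)
      then have "cosh (\<mu> * y) * 2 \<le> exp (3 * pi * A) + exp (3 * pi * A)"
        using add_mono[of "exp (\<mu> * y)" "exp (3 * pi * A)" "exp (- (\<mu> * y))" "exp (3 * pi * A)"]
        unfolding cosh_field_def by simp
      then show ?thesis by (simp add: ch_def)
    qed
    \<comment> \<open>The doubled width \<open>2 * A\<close> leaves room around the closed parabola.
      Its sides avoid \<open>S2\<close> through the condition on \<open>Im phi\<close>, and
      \<open>S1\<close> by the choice of \<open>xl\<close> and \<delta>, so they meet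
      \<open>V\<close> only in \<open>S3\<close>.\<close>
    define S1 where "S1 = {w. xl \<le> fst w \<and> fst w \<le> x1 \<and> \<bar>snd w - snd z\<bar> \<le> \<delta>}"
    define S2 where "S2 = {w. x0 \<le> fst w \<and> fst w \<le> xc \<and> \<bar>snd w\<bar> \<le> 2 * A * max 0 (fst w) powr \<alpha> \<and>
      \<bar>Im (phi (cx w))\<bar> \<le> pi / 2}"
    define S3 where "S3 = {w. t \<le> fst w \<and> fst w \<le> R \<and> \<bar>snd w\<bar> \<le> 2 * A * max 0 (fst w) powr \<alpha>}"
    have x0p: "x0 > 0" using x0 by simp
    have cont_phi: "continuous_on S (\<lambda>w. phi (cx w))" if "\<And>w. w \<in> S \<Longrightarrow> fst w > 0" for S
    proof -
      have "continuous_on (cx ` S) phi"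
        by (intro holomorphic_on_imp_continuous_on holomorphic_phi) (use that in auto)
      then show ?thesis
        by (rule continuous_on_compose2) (auto intro!: continuous_intros)
    qed
    have closed1: "closed S1" unfolding S1_def
      by (intro closed_Collect_conj closed_Collect_le continuous_intros)
    have closed3: "closed S3" unfolding S3_def
      by (intro closed_Collect_conj closed_Collect_le continuous_intros continuous_on_profile)
    have closed2: "closed S2"
    proof -
      have H: "closed {w :: real \<times> real. x0 \<le> fst w}" by (intro closed_Collect_le continuous_intros)
      have "closed ({w. x0 \<le> fst w} \<inter> (\<lambda>w. \<bar>Im (phi (cx w))\<bar>) -` {.. pi / 2})"
        using x0p by (intro continuous_closed_preimage continuous_intros cont_phi H) auto
      moreover have "closed {w :: real \<times> real. fst w \<le> xc \<and> \<bar>snd w\<bar> \<le> 2 * A * max 0 (fst w) powr \<alpha>}"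
        by (intro closed_Collect_conj closed_Collect_le continuous_intros continuous_on_profile)
      moreover have "S2 = ({w. x0 \<le> fst w} \<inter> (\<lambda>w. \<bar>Im (phi (cx w))\<bar>) -` {.. pi / 2}) \<inter>
          {w. fst w \<le> xc \<and> \<bar>snd w\<bar> \<le> 2 * A * max 0 (fst w) powr \<alpha>}"
        by (auto simp: S2_def)
      ultimately show ?thesis by auto
    qed
    define h1 where "h1 = (\<lambda>w. if w \<in> S1 then Re (g1 (cx w)) else 0)"
    define h2 where "h2 = (\<lambda>w. if w \<in> S2 then Re (g2 (cx w)) else 0)"
    define h3 where "h3 = (\<lambda>w. if w \<in> S3 then Re (g3 (cx w)) else 0)"
    define F where "F = (\<lambda>w. max 0 (max (h1 w) (max (h2 w) (h3 w))))"
    have F_ge: "0 \<le> F w" "w \<in> S1 \<Longrightarrow> Re (g1 (cx w)) \<le> F w" "w \<in> S2 \<Longrightarrow> Re (g2 (cx w)) \<le> F w"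
      "w \<in> S3 \<Longrightarrow> Re (g3 (cx w)) \<le> F w" for w
      by (auto simp: F_def h1_def h2_def h3_def)
    have F_cases: "F w = 0 \<or> (w \<in> S1 \<and> F w = Re (g1 (cx w))) \<or> (w \<in> S2 \<and> F w = Re (g2 (cx w))) \<or>
        (w \<in> S3 \<and> F w = Re (g3 (cx w)))" for w
      by (auto simp: F_def h1_def h2_def h3_def max_def)
    have meas: "F \<in> borel_measurable borel"
    proof -
      have "h1 \<in> borel_measurable borel" unfolding h1_def g1_def
        by (intro borel_measurable_continuous_on_if borel_closed closed1 continuous_intros)
      moreover have "h2 \<in> borel_measurable borel" unfolding h2_def g2_def
        by (intro borel_measurable_continuous_on_if borel_closed closed2 continuous_intros cont_phi)
           (use x0p in \<open>auto simp: S2_def\<close>)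
      moreover have "h3 \<in> borel_measurable borel" unfolding h3_def g3_def
        by (intro borel_measurable_continuous_on_if borel_closed closed3 continuous_intros)
      ultimately show ?thesis unfolding F_def by measurable
    qed
    define V where "V = S1 \<union> S2 \<union> S3"
    define CF where "CF = 2 * E * exp (3 * pi * A)"
    have CF: "CF > 0" "E \<le> CF"
    proof -
      show "CF > 0" using E by (simp add: CF_def)
      have "E * 1 \<le> E * (2 * exp (3 * pi * A))"
        using E A by (intro mult_left_mono) (auto intro: order_trans[of _ "exp (3 * pi * A)"])
      then show "E \<le> CF" by (simp add: CF_def)
    qed
    have FV: "F w \<le> CF * indicator V w" for w
    proof -
      have "Re (g1 (cx w)) \<le> CF" if "w \<in> S1"
        using g1_le[of w] KE CF that by (simp add: S1_def)
      moreover have "Re (g2 (cx w)) \<le> CF" if "w \<in> S2"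
        using g2_E[of w] CF that x0 l by (simp add: S2_def R_def xc_def max_def split: if_splits)
      moreover have "Re (g3 (cx w)) \<le> CF" if "w \<in> S3"
      proof -
        have w: "t \<le> fst w" "fst w \<le> R" "\<bar>snd w\<bar> \<le> 2 * A * fst w powr \<alpha>"
          using that t1 by (auto simp: S3_def)
        then have "ch (snd w) \<le> exp (3 * pi * A)"
          using width[of "fst w"] t1 by (intro ch_le) simp
        then have "cos (\<mu> * (fst w - xc)) * ch (snd w) \<le> 1 * exp (3 * pi * A)"
          using ch[of "snd w"] by (intro mult_mono) auto
        then show ?thesis unfolding Re_g3 CF_def using E by simp
      qed
      ultimately show ?thesis
        using F_cases[of w] CF by (auto simp: V_def indicator_def)
    qed
    have bnd: "\<bar>F w\<bar> \<le> CF" for w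
      using FV[of w] F_ge(1)[of w] CF by (cases "w \<in> V") auto
    \<comment> \<open>Each set reaches past the cut-offs of its piece only so far that the piece is
      still below \<open>F\<close>. Heights up to \<open>2 * \<delta>\<close>, \<open>Im phi\<close>
      up to \<open>3 * pi / 2\<close> and abscissas up to \<open>3 * l\<close> from the crest keep
      the cosines nonpositive there; the right ends of \<open>U1\<close> and \<open>U2\<close> lie
      where the next piece is larger.\<close>
    define U1 where "U1 = {\<zeta>. Re \<zeta> < x1 + 1 \<and> \<bar>Im \<zeta> - snd z\<bar> < 2 * \<delta>}"
    define U2 where "U2 = {\<zeta>. x0 - 1 < Re \<zeta> \<and> Re \<zeta> < xc + 1 / 2 \<and> \<bar>Im \<zeta>\<bar> < 2 * A * max 1 (Re \<zeta>) powr \<alpha> \<and>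
      \<bar>Im (phi \<zeta>)\<bar> < 3 * pi / 2}"
    define U3 where "U3 = {\<zeta>. \<bar>Re \<zeta> - xc\<bar> < 3 * l \<and> \<bar>Im \<zeta>\<bar> < 2 * A * max 0 (Re \<zeta>) powr \<alpha>}"
    have openU1: "open U1" unfolding U1_def
      by (intro open_Collect_conj open_Collect_less continuous_intros)
    have openU3: "open U3" unfolding U3_def
      using alpha by (intro open_Collect_conj open_Collect_less continuous_intros continuous_on_powr') auto
    have openU2: "open U2"
    proof -
      have H: "open {\<zeta>. x0 - 1 < Re \<zeta>}" by (intro open_Collect_less continuous_intros)
      have "continuous_on {\<zeta>. x0 - 1 < Re \<zeta>} phi"
        by (intro holomorphic_on_imp_continuous_on holomorphic_phi) (use x0 in auto)
      then have "open ({\<zeta>. x0 - 1 < Re \<zeta>} \<inter> (\<lambda>\<zeta>. \<bar>Im (phi \<zeta>)\<bar>) -` {..< 3 * pi / 2})"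
        using H by (intro continuous_open_preimage continuous_intros) auto
      moreover have "open {\<zeta>. Re \<zeta> < xc + 1 / 2 \<and> \<bar>Im \<zeta>\<bar> < 2 * A * max 1 (Re \<zeta>) powr \<alpha>}"
        by (intro open_Collect_conj open_Collect_less continuous_intros) auto
      moreover have "U2 = ({\<zeta>. x0 - 1 < Re \<zeta>} \<inter> (\<lambda>\<zeta>. \<bar>Im (phi \<zeta>)\<bar>) -` {..< 3 * pi / 2}) \<inter>
          {\<zeta>. Re \<zeta> < xc + 1 / 2 \<and> \<bar>Im \<zeta>\<bar> < 2 * A * max 1 (Re \<zeta>) powr \<alpha>}"
        by (auto simp: U2_def)
      ultimately show ?thesis by auto
    qed
    have min1: "Re (g1 (cx w)) \<le> F w" if "cx w \<in> U1" for w
    proof -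
      have w: "fst w < x1 + 1" "\<bar>snd w - snd z\<bar> < 2 * \<delta>" using that by (auto simp: U1_def)
      consider "fst w \<le> xl" | "\<delta> \<le> \<bar>snd w - snd z\<bar>" | "w \<in> S1" | "x1 < fst w" "\<bar>snd w - snd z\<bar> < \<delta>"
        unfolding S1_def by force
      then show ?thesis
      proof cases
        case 1
        then show ?thesis using g1_left[of w] F_ge(1)[of w] by linarith
      next
        case 2
        then show ?thesis using g1_side[of w] w F_ge(1)[of w] by linarith
      next
        case 3
        then show ?thesis by (rule F_ge(2))
      next
        case 4
        have y: "\<bar>snd w\<bar> \<le> \<bar>snd z\<bar> + \<delta>" using 4 by linarith
        have "A * xl powr \<alpha> \<le> A * fst w powr \<alpha>"
          using 4 x1 xl A alpha by (intro mult_left_mono powr_mono2) auto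
        then have "\<bar>snd w\<bar> \<le> 2 * A * fst w powr \<alpha>" using y \<delta> by linarith
        then have "w \<in> S2"
          using 4 x1 x0 w t1 l axis(1)[of "fst w" "snd w"] y pi_gt3
          by (auto simp: S2_def xc_def cx_Complex)
        moreover have "K \<le> Re (g2 (cx w))"
          using axis(2)[of "fst w" "snd w"] 4 y by (simp add: g2_def cx_Complex)
        ultimately show ?thesis using g1_le[of w] w F_ge(3)[of w] by linarith
      qed
    qed
    have min2: "Re (g2 (cx w)) \<le> F w" if "cx w \<in> U2" for w
    proof -
      have w: "x0 - 1 < fst w" "fst w < xc + 1 / 2" "\<bar>snd w\<bar> < 2 * A * fst w powr \<alpha>"
         "\<bar>Im (phi (cx w))\<bar> < 3 * pi / 2"
        using that x0 by (auto simp: U2_def max_def split: if_splits)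
      consider "pi / 2 < \<bar>Im (phi (cx w))\<bar>" | "fst w < x0" | "w \<in> S2" | "xc < fst w"
        using w x0 unfolding S2_def by force
      then show ?thesis
      proof cases
        case 1
        then have "cos (Im (phi (cx w))) \<le> 0" using w by (intro cos_nonpos) auto
        then have "exp (Re (phi (cx w))) * cos (Im (phi (cx w))) \<le> 0" by (simp add: mult_le_0_iff)
        then show ?thesis using K F_ge(1)[of w] by (simp add: Re_g2)
      next
        case 2
        have "A * fst w powr \<alpha> \<le> A * x0 powr \<alpha>"
          using 2 w x0 A alpha by (intro mult_left_mono powr_mono2) auto
        then have "cmod (cx w) \<le> r0"
          using norm_pair_le_sum[of "fst w" "snd w"] 2 w x0 by (simp add: r0_def)
        then have "Re (g2 (cx w)) \<le> 0"
          using g2_le[of "cx w" r0] w x0 by (simp add: K_def)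
        then show ?thesis using F_ge(1)[of w] by linarith
      next
        case 3
        then show ?thesis by (rule F_ge(3))
      next
        case 4
        have wR: "t \<le> fst w" "fst w \<le> R" using 4 w l by (auto simp: xc_def R_def)
        then have "w \<in> S3" using w t1 by (simp add: S3_def max_def)
        \<comment> \<open>\<open>U2\<close> ends 1 / 2 beyond \<open>xc\<close> and
          \<open>l \<ge> 1\<close>, so \<open>w\<close> is within \<open>l / 2\<close> of the crest
          of \<open>g3\<close>.\<close>
        have "\<mu> * (fst w - xc) \<le> \<mu> * (l / 2)"
          using w l \<mu> by (intro mult_left_mono) auto
        also have "\<dots> = pi / 4" using \<mu>(2) by simp
        also have "\<dots> \<le> pi / 3" using pi_gt_zero by simp
        finally have "\<bar>\<mu> * (fst w - xc)\<bar> \<le> pi / 3" using 4 \<mu> by (simp add: abs_mult)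
        then have "1 / 2 \<le> cos (\<mu> * (fst w - xc))" by (rule cos_ge_half)
        then have "1 / 2 * 1 \<le> cos (\<mu> * (fst w - xc)) * ch (snd w)"
          using ch[of "snd w"] by (intro mult_mono) auto
        then have "2 * E * (1 / 2 * 1) \<le> Re (g3 (cx w))"
          unfolding Re_g3 using E by (intro mult_left_mono) auto
        moreover have "Re (g2 (cx w)) \<le> E" using w x0 wR t1 by (intro g2_E) auto
        ultimately show ?thesis using F_ge(4)[OF \<open>w \<in> S3\<close>] by linarith
      qed
    qed
    have min3: "Re (g3 (cx w)) \<le> F w" if "cx w \<in> U3" for w
    proof -
      have w: "\<bar>fst w - xc\<bar> < 3 * l" "\<bar>snd w\<bar> < 2 * A * max 0 (fst w) powr \<alpha>"
        using that by (auto simp: U3_def)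
      show ?thesis
      proof (cases "\<bar>fst w - xc\<bar> \<le> l")
        case True
        then have "w \<in> S3" using w by (auto simp: S3_def xc_def R_def)
        then show ?thesis by (rule F_ge(4))
      next
        case False
        have "\<bar>\<mu> * (fst w - xc)\<bar> = \<mu> * \<bar>fst w - xc\<bar>" using \<mu> by (simp add: abs_mult)
        moreover have "\<mu> * l \<le> \<mu> * \<bar>fst w - xc\<bar>" "\<mu> * \<bar>fst w - xc\<bar> \<le> \<mu> * (3 * l)"
          using False w \<mu> by (auto intro!: mult_left_mono)
        ultimately have "cos (\<mu> * (fst w - xc)) \<le> 0" using \<mu>(2) by (intro cos_nonpos) auto
        then have "cos (\<mu> * (fst w - xc)) * ch (snd w) \<le> 0"
          using ch[of "snd w"] by (simp add: mult_le_0_iff)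
        then have "Re (g3 (cx w)) \<le> 0" unfolding Re_g3 using E by (simp add: mult_le_0_iff)
        then show ?thesis using F_ge(1)[of w] by linarith
      qed
    qed
    \<comment> \<open>The domain is cut at \<open>R + 1\<close>, beyond all of \<open>V\<close>, so
      that an exit in \<open>V\<close> is never through the cut.\<close>
    have zR: "fst z < R + 1" using x1 t1 l by (simp add: R_def)
    define I :: "nat set" where "I = {0, 1, 2, 3}"
    \<comment> \<open>Index 0 stands for the zero function on the whole plane, which is the touching
      piece where \<open>F\<close> is 0.\<close>
    define UU where "UU = (\<lambda>i :: nat. if i = 0 then UNIV else if i = 1 then U1 else if i = 2 then U2 else U3)"
    define SS where "SS = (\<lambda>i :: nat. if i = 0 then UNIV else if i = 1 then S1 else if i = 2 then S2 else S3)"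
    define gg where "gg = (\<lambda>i :: nat. if i = 0 then (\<lambda>_. 0) else if i = 1 then g1 else if i = 2 then g2 else g3)"
    have T: "0 \<le> fst w" "\<bar>snd w\<bar> \<le> A * fst w powr \<alpha>" if "w \<in> closed_truncated (R + 1)" for w
      using that by (auto simp: closed_truncated_def)
    have wide: "\<bar>snd w\<bar> < 2 * A * fst w powr \<alpha>" if "w \<in> closed_truncated (R + 1)" "fst w > 0" for w
    proof -
      have "0 < A * fst w powr \<alpha>" using that(2) A by simp
      then show ?thesis using T(2)[OF that(1)] unfolding mult.assoc by linarith
    qed
    have "F z \<le> CF * prob (exits_in (truncated (R + 1)) V)"
    proof (rule harmonic_exit_principle[where I=I and U=UU and g=gg and K="\<lambda>i. cx ` (closed_truncated (R + 1) \<inter> SS i)"])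
      show "open (truncated (R + 1))" by (rule open_truncated)
      show "bounded (truncated (R + 1))" by (rule bounded_truncated)
      show "z \<in> truncated (R + 1)" by (rule z_truncated[OF zR])
      show "finite I" by (simp add: I_def)
      show "open (UU i)" for i using openU1 openU2 openU3 by (simp add: UU_def)
      show "gg i holomorphic_on UU i" for i
      proof -
        have "g1 holomorphic_on U1" unfolding g1_def by (intro holomorphic_intros)
        moreover have "g2 holomorphic_on U2" unfolding g2_def
          by (intro holomorphic_intros holomorphic_phi) (use x0 in \<open>auto simp: U2_def\<close>)
        moreover have "g3 holomorphic_on U3" unfolding g3_def by (intro holomorphic_intros)
        ultimately show ?thesis by (simp add: UU_def gg_def)
      qed
      have "closed (SS i)" for i using closed1 closed2 closed3 by (simp add: SS_def)
      then show "compact (cx ` (closed_truncated (R + 1) \<inter> SS i))" for i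
        by (intro compact_cx_image compact_Int_closed compact_closed_truncated)
      show "cx ` (closed_truncated (R + 1) \<inter> SS i) \<subseteq> UU i" for i
      proof -
        have "cx w \<in> U1" if "w \<in> S1" for w using that \<delta> by (auto simp: U1_def S1_def)
        moreover have "cx w \<in> U2" if "w \<in> S2" "w \<in> closed_truncated (R + 1)" for w
        proof -
          have "\<bar>Im (phi (cx w))\<bar> \<le> pi / 2" using that by (simp add: S2_def)
          then have "\<bar>Im (phi (cx w))\<bar> < 3 * pi / 2" using pi_gt_zero by linarith
          then show ?thesis using that wide[of w] x0 by (auto simp: U2_def S2_def max_def)
        qed
        moreover have "cx w \<in> U3" if "w \<in> S3" "w \<in> closed_truncated (R + 1)" for w
          using that wide[of w] t1 l by (auto simp: U3_def S3_def max_def xc_def R_def)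
        ultimately show ?thesis by (auto simp: UU_def SS_def)
      qed
      show "F \<in> borel_measurable borel" by (rule meas)
      show "\<bar>F w\<bar> \<le> CF" for w by (rule bnd)
      show "\<exists>i\<in>I. cx x \<in> cx ` (closed_truncated (R + 1) \<inter> SS i) \<and> F x = Re (gg i (cx x))" if "x \<in> truncated (R + 1)" for x
        using F_cases[of x] truncated_subset[of "R + 1"] that by (auto simp: I_def SS_def gg_def)
      show "Re (gg i (cx w)) \<le> F w" if "cx w \<in> UU i" for i w
        using that min1[of w] min2[of w] min3[of w] F_ge(1)[of w] by (auto simp: UU_def gg_def split: if_splits)
      show "closed V" unfolding V_def using closed1 closed2 closed3 by auto
      show "0 \<le> CF" using CF by simp
      show "F w \<le> CF * indicator V w" for w by (rule FV)
    qed
    also have "prob (exits_in (truncated (R + 1)) V) \<le> prob {\<omega>\<in>space M. norm (exit_pos \<omega>) > t}"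
    proof (rule finite_measure_mono_AE)
      show "AE \<omega> in M. \<omega> \<in> exits_in (truncated (R + 1)) V \<longrightarrow> \<omega> \<in> {\<omega>\<in>space M. norm (exit_pos \<omega>) > t}"
        using AE_truncated_exit[OF zR]
      proof eventually_elim
        case (elim \<omega>)
        define e where "e = exit_position B (truncated (R + 1)) \<omega>"
        show ?case
        proof
          assume "\<omega> \<in> exits_in (truncated (R + 1)) V"
          then have \<omega>: "\<omega> \<in> space M" and eV: "e \<in> V" by (auto simp: exits_in_def e_def)
          have e: "e \<in> closed_truncated (R + 1)" "e \<notin> truncated (R + 1)" "fst e < R + 1 \<Longrightarrow> exit_pos \<omega> = e"
            using elim by (auto simp: e_def)
          have eR: "xl \<le> fst e \<or> x0 \<le> fst e" "0 < fst e" "fst e \<le> R"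
            using eV xl x0 t1 l x1 by (auto simp: V_def S1_def S2_def S3_def R_def xc_def)
          have "e \<notin> parabola_domain A \<alpha>" using e(2) eR by (simp add: truncated_def)
          then have y: "\<bar>snd e\<bar> = A * fst e powr \<alpha>"
            using T(2)[OF e(1)] eR(2) by (cases e) (auto simp: parabola_domain_def)
          have "e \<notin> S1"
          proof
            assume "e \<in> S1"
            then have "A * xl powr \<alpha> \<le> A * fst e powr \<alpha>" "\<bar>snd e\<bar> \<le> \<bar>snd z\<bar> + \<delta>"
              using xl A alpha by (auto simp: S1_def intro!: mult_left_mono powr_mono2)
            then show False using y \<delta> by linarith
          qed
          moreover have "e \<notin> S2" using side[of "fst e" "snd e"] y by (auto simp: S2_def cx_Complex)
          ultimately have "t \<le> fst e" using eV by (auto simp: V_def S3_def)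
          \<comment> \<open>A nonzero height makes the norm strictly larger than the abscissa, which
            turns \<open>t \<le> fst e\<close> into the strict inequality required.\<close>
          moreover have "snd e \<noteq> 0" using y A eR(2) by auto
          then have "(fst e)\<^sup>2 < (fst e)\<^sup>2 + (snd e)\<^sup>2" by simp
          then have "sqrt ((fst e)\<^sup>2) < sqrt ((fst e)\<^sup>2 + (snd e)\<^sup>2)" by (rule real_sqrt_less_mono)
          then have "fst e < norm e" using eR(2) by (simp add: norm_prod_def)
          ultimately show "\<omega> \<in> {\<omega>\<in>space M. norm (exit_pos \<omega>) > t}"
            using e(3) eR(3) \<omega> by simp
        qed
      qed
    qed measurable
    finally have "F z \<le> CF * prob {\<omega>\<in>space M. norm (exit_pos \<omega>) > t}"
      using CF by (simp add: mult_left_mono)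
    moreover have "c1 \<le> F z"
      unfolding c1_def using xl x1 \<delta> by (intro F_ge(2)) (simp add: S1_def)
    \<comment> \<open>The factor \<open>c3\<close> is free of \<open>t\<close>: nothing but a
      constant is lost against the exact rate.\<close>
    moreover have "CF = c3 * exp (bc * t powr p)"
      by (simp add: CF_def c3_def E_def distrib_left exp_add)
    ultimately have "c1 \<le> c3 * (exp (bc * t powr p) * prob {\<omega>\<in>space M. norm (exit_pos \<omega>) > t})"
      by (simp add: mult.assoc)
    then have "c1 / c3 \<le> exp (bc * t powr p) * prob {\<omega>\<in>space M. norm (exit_pos \<omega>) > t}"
      using c3 by (simp add: pos_divide_le_eq mult.commute)
    then have "c1 / c3 * exp (- bc * t powr p)
        \<le> exp (bc * t powr p) * prob {\<omega>\<in>space M. norm (exit_pos \<omega>) > t} * exp (- bc * t powr p)"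
      by (rule mult_right_mono) simp
    also have "\<dots> = prob {\<omega>\<in>space M. norm (exit_pos \<omega>) > t}"
      by (simp add: exp_minus field_simps)
    finally show "c1 / c3 * exp (- bc * t powr p) \<le> prob {\<omega>\<in>space M. norm (exit_pos \<omega>) > t}" .
  qed
qed

end

section \<open>Exponential moments\<close>

text \<open>Beyond the crossover point \<open>y1\<close> the higher power dominates; below it the
  lower power is at most its value at \<open>y1\<close>, which gives the constant.\<close>

lemma powr_dominated:
  fixes a a' b b' :: real
  assumes "0 < a" "a < a'" "0 < b" "0 < b'"
  obtains K where "\<And>y. 0 \<le> y \<Longrightarrow> b * y powr a \<le> b' * y powr a' + K"
proof (rule that)
  fix y :: real assume y: "0 \<le> y"
  define y1 where "y1 = (b / b') powr (1 / (a' - a))"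
  have y1: "y1 > 0" "y1 powr (a' - a) = b / b'" using assms by (auto simp: y1_def powr_powr)
  show "b * y powr a \<le> b' * y powr a' + b * y1 powr a"
  proof (cases "y \<le> y1")
    case True
    then have "b * y powr a \<le> b * y1 powr a" using assms y by (intro mult_left_mono powr_mono2) auto
    then show ?thesis using assms by (simp add: add_increasing)
  next
    case False
    then have "b / b' \<le> y powr (a' - a)"
      unfolding y1(2)[symmetric] using assms y1 by (intro powr_mono2) auto
    then have "b \<le> b' * y powr (a' - a)" using assms by (simp add: pos_divide_le_eq mult.commute)
    then have "b * y powr a \<le> b' * y powr (a' - a) * y powr a" by (intro mult_right_mono) auto
    also have "\<dots> = b' * y powr a'" by (simp add: mult.assoc flip: powr_add)
    finally show ?thesis using assms by (simp add: add_increasing2)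
  qed
qed

context parabola_exit
begin

lemma norm_exit_pos_powr_tail:
  "0 \<le> t \<Longrightarrow> {\<omega>\<in>space M. norm (exit_pos \<omega>) > t} \<subseteq> {\<omega>\<in>space M. norm (exit_pos \<omega>) powr p > t powr p}"
  using p by (auto intro: powr_less_mono2)

text \<open>After the logarithm the constant factors contribute terms of order
  \<open>t powr (- p)\<close>. The lower bound already has the exact rate; the upper bounds hold for
  every positive \<kappa> < \<open>bc\<close>, and \<kappa> may be taken as close to
  \<open>bc\<close> as the target neighbourhood demands.\<close>

lemma log_tail:
  assumes lower: "c > 0" "\<And>t. t \<ge> t0 \<Longrightarrow> c * exp (- bc * t powr p) \<le> prob {\<omega>\<in>space M. norm (exit_pos \<omega>) > t}"
  shows "((\<lambda>t. t powr (\<alpha> - 1) * ln (prob {\<omega>\<in>space M. norm (exit_pos \<omega>) > t})) \<longlongrightarrow> - bc) at_top"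
proof -
  define P where "P = (\<lambda>t. prob {\<omega>\<in>space M. norm (exit_pos \<omega>) > t})"
  have Ppos: "P t > 0" if "t \<ge> t0" for t
    using lower(2)[OF that] lower(1) by (auto simp: P_def intro: less_le_trans[rotated])
  have lim: "((\<lambda>t. C * t powr (- p) - \<kappa>) \<longlongrightarrow> - \<kappa>) at_top" for C \<kappa> :: real
  proof -
    have "((\<lambda>t. C * t powr (- p) - \<kappa>) \<longlongrightarrow> C * 0 - \<kappa>) at_top"
      using p by (intro tendsto_intros tendsto_neg_powr filterlim_ident) auto
    then show ?thesis by simp
  qed
  have cancel: "t powr (- p) * (C - \<kappa> * t powr p) = C * t powr (- p) - \<kappa>" if "t \<ge> 1" for t C \<kappa>
    using that by (simp add: right_diff_distrib powr_minus field_simps)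
  have lo: "ln c * t powr (- p) - bc \<le> t powr (- p) * ln (P t)" if "t \<ge> max t0 1" for t
  proof -
    have "ln (c * exp (- bc * t powr p)) \<le> ln (P t)"
      using lower that Ppos[of t] by (subst ln_le_cancel_iff) (auto simp: P_def)
    then have "t powr (- p) * (ln c - bc * t powr p) \<le> t powr (- p) * ln (P t)"
      using lower(1) by (intro mult_left_mono) (simp_all add: ln_mult)
    then show ?thesis using that by (subst (asm) cancel) auto
  qed
  have up: "\<exists>C. \<forall>t\<ge>max t0 1. t powr (- p) * ln (P t) \<le> C * t powr (- p) - \<kappa>" if \<kappa>: "0 < \<kappa>" "\<kappa> < bc" for \<kappa>
  proof -
    obtain C where C: "C > 0" "\<And>u. prob {\<omega>\<in>space M. norm (exit_pos \<omega>) powr p > u} \<le> C * exp (- \<kappa> * u)"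
      using upper_tail[OF \<kappa>] by blast
    have "t powr (- p) * ln (P t) \<le> ln C * t powr (- p) - \<kappa>" if "t \<ge> max t0 1" for t
    proof -
      have "P t \<le> prob {\<omega>\<in>space M. norm (exit_pos \<omega>) powr p > t powr p}"
        unfolding P_def using that by (intro finite_measure_mono norm_exit_pos_powr_tail) auto
      also have "\<dots> \<le> C * exp (- \<kappa> * t powr p)" by (rule C(2))
      finally have "ln (P t) \<le> ln (C * exp (- \<kappa> * t powr p))"
        using Ppos[of t] C(1) that by (subst ln_le_cancel_iff) auto
      then have "t powr (- p) * ln (P t) \<le> t powr (- p) * (ln C - \<kappa> * t powr p)"
        using C(1) by (intro mult_left_mono) (simp_all add: ln_mult)
      then show ?thesis using that by (subst (asm) cancel) auto
    qed
    then show ?thesis by blast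
  qed
  have "((\<lambda>t. t powr (- p) * ln (P t)) \<longlongrightarrow> - bc) at_top"
  proof (rule order_tendstoI)
    fix a assume "a < - bc"
    then have "\<forall>\<^sub>F t in at_top. a < ln c * t powr (- p) - bc" using lim by (rule order_tendstoD(1)[rotated])
    then show "\<forall>\<^sub>F t in at_top. a < t powr (- p) * ln (P t)"
      using eventually_ge_at_top[of "max t0 1"] by eventually_elim (use lo in force)
  next
    fix a assume a: "- bc < a"
    obtain \<kappa> where \<kappa>: "max 0 (- a) < \<kappa>" "\<kappa> < bc" using dense[of "max 0 (- a)" bc] a bc(1) by auto
    then obtain C where C: "\<And>t. t \<ge> max t0 1 \<Longrightarrow> t powr (- p) * ln (P t) \<le> C * t powr (- p) - \<kappa>"
      using up[of \<kappa>] by auto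
    have "- \<kappa> < a" using \<kappa> by simp
    then have "\<forall>\<^sub>F t in at_top. C * t powr (- p) - \<kappa> < a" using lim by (rule order_tendstoD(2)[rotated])
    then show "\<forall>\<^sub>F t in at_top. t powr (- p) * ln (P t) < a"
      using eventually_ge_at_top[of "max t0 1"] by eventually_elim (use C in force)
  qed
  then show ?thesis by (simp add: P_def p_def)
qed

text \<open>Summation over unit shells of \<open>norm powr p\<close>: a rate \<kappa> strictly
  between the exponent and \<open>bc\<close> bounds the sum by a convergent geometric
  series.\<close>

lemma exponential_moment_finite:
  assumes "b < bc"
  shows "(\<integral>\<^sup>+ \<omega>. ennreal (exp (b * norm (exit_pos \<omega>) powr p)) \<partial>M) < \<infinity>"
proof -
  \<comment> \<open>For negative \<open>b\<close> the rate 0 is used instead, so that the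
    exponential can be bounded by its value at the outer end of each shell.\<close>
  define b' where "b' = max b 0"
  have b': "0 \<le> b'" "b' < bc" using assms bc(1) by (auto simp: b'_def)
  obtain \<kappa> where \<kappa>: "b' < \<kappa>" "\<kappa> < bc" using dense b' by blast
  obtain C where C: "C > 0" "\<And>u. prob {\<omega>\<in>space M. norm (exit_pos \<omega>) powr p > u} \<le> C * exp (- \<kappa> * u)"
    using upper_tail[of \<kappa>] b' \<kappa> by auto
  define Y where "Y = (\<lambda>\<omega>. norm (exit_pos \<omega>) powr p)"
  have [measurable]: "Y \<in> borel_measurable M" unfolding Y_def by measurable
  \<comment> \<open>The threshold is \<open>n - 1\<close> because the tail bound concerns a strict
    inequality, while the shell of \<open>n\<close> includes the value
    \<open>Y \<omega> = n\<close>.\<close>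
  define S where "S = (\<lambda>n :: nat. {\<omega>\<in>space M. Y \<omega> > real n - 1})"
  have [measurable]: "S n \<in> sets M" for n unfolding S_def by measurable
  have "(\<integral>\<^sup>+ \<omega>. ennreal (exp (b * Y \<omega>)) \<partial>M) \<le> (\<integral>\<^sup>+ \<omega>. (\<Sum>n. ennreal (exp (b' * (real n + 1))) * indicator (S n) \<omega>) \<partial>M)"
  proof (rule nn_integral_mono)
    fix \<omega> assume \<omega>: "\<omega> \<in> space M"
    define n where "n = nat \<lfloor>Y \<omega>\<rfloor>"
    have Y0: "0 \<le> Y \<omega>" by (simp add: Y_def)
    have n: "real n \<le> Y \<omega>" "Y \<omega> \<le> real n + 1" using Y0 by (auto simp: n_def)
    have "b * Y \<omega> \<le> b' * Y \<omega>" using Y0 by (intro mult_right_mono) (auto simp: b'_def)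
    also have "\<dots> \<le> b' * (real n + 1)" using n b' by (intro mult_left_mono) auto
    finally have "ennreal (exp (b * Y \<omega>)) \<le> ennreal (exp (b' * (real n + 1))) * indicator (S n) \<omega>"
      using n \<omega> by (auto simp: S_def intro!: ennreal_leI)
    also have "\<dots> \<le> (\<Sum>n. ennreal (exp (b' * (real n + 1))) * indicator (S n) \<omega>)"
    proof -
      let ?t = "\<lambda>n. ennreal (exp (b' * (real n + 1))) * indicator (S n) \<omega>"
      have "sum ?t {n} \<le> suminf ?t" by (rule sum_le_suminf) auto
      then show ?thesis by (simp only: sum.insert finite.emptyI sum.empty empty_iff not_False_eq_True add_0_right)
    qed
    finally show "ennreal (exp (b * Y \<omega>)) \<le> (\<Sum>n. ennreal (exp (b' * (real n + 1))) * indicator (S n) \<omega>)" .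
  qed
  also have "\<dots> = (\<Sum>n. ennreal (exp (b' * (real n + 1))) * emeasure M (S n))"
    by (subst nn_integral_suminf) (auto simp: nn_integral_cmult_indicator)
  also have "\<dots> \<le> (\<Sum>n. ennreal (C * exp (b' + \<kappa>) * exp (b' - \<kappa>) ^ n))"
  proof (intro suminf_le)
    fix n
    have "exp (b' * (real n + 1)) * prob (S n) \<le> exp (b' * (real n + 1)) * (C * exp (- \<kappa> * (real n - 1)))"
      unfolding S_def Y_def by (intro mult_left_mono C) auto
    also have "\<dots> = C * exp (b' * (real n + 1) + - \<kappa> * (real n - 1))"
      unfolding exp_add by simp
    also have "b' * (real n + 1) + - \<kappa> * (real n - 1) = (b' + \<kappa>) + real n * (b' - \<kappa>)"
      by (simp add: algebra_simps)
    also have "C * exp \<dots> = C * exp (b' + \<kappa>) * exp (b' - \<kappa>) ^ n"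
      by (simp add: exp_add exp_of_nat_mult)
    finally show "ennreal (exp (b' * (real n + 1))) * emeasure M (S n) \<le> ennreal (C * exp (b' + \<kappa>) * exp (b' - \<kappa>) ^ n)"
      by (simp add: emeasure_eq_measure ennreal_mult[symmetric] ennreal_leI)
  qed auto
  also have "\<dots> < \<infinity>"
  proof -
    have "summable (\<lambda>n. C * exp (b' + \<kappa>) * exp (b' - \<kappa>) ^ n)"
      using \<kappa> by (intro summable_mult summable_geometric) auto
    then have "(\<Sum>n. ennreal (C * exp (b' + \<kappa>) * exp (b' - \<kappa>) ^ n)) \<noteq> top"
      using C(1) by (intro ennreal_suminf_neq_top) auto
    then show ?thesis by (simp add: less_top)
  qed
  finally show ?thesis by (simp add: Y_def)
qed

text \<open>If the moment were finite, its part over \<open>norm > n\<close> would tend to 0 by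
  dominated convergence. On that event the integrand is at least \<open>exp (bc * n powr p)\<close>,
  and the sharp lower tail leaves at least \<open>c\<close> for every large
  \<open>n\<close>.\<close>

lemma critical_moment_infinite:
  assumes lower: "c > 0" "\<And>t. t \<ge> t0 \<Longrightarrow> c * exp (- bc * t powr p) \<le> prob {\<omega>\<in>space M. norm (exit_pos \<omega>) > t}"
  shows "(\<integral>\<^sup>+ \<omega>. ennreal (exp (bc * norm (exit_pos \<omega>) powr p)) \<partial>M) = \<infinity>"
proof (rule ccontr)
  define f where "f = (\<lambda>\<omega>. exp (bc * norm (exit_pos \<omega>) powr p))"
  assume "\<not> ?thesis"
  then have f: "integrable M f"
    unfolding f_def by (intro integrableI_bounded) (auto simp: less_top)
  have [measurable]: "f \<in> borel_measurable M" unfolding f_def by measurable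
  define S where "S = (\<lambda>n :: nat. {\<omega>\<in>space M. norm (exit_pos \<omega>) > real n})"
  have [measurable]: "S n \<in> sets M" for n unfolding S_def by measurable
  have "(\<lambda>n. \<integral>\<omega>. indicator (S n) \<omega> * f \<omega> \<partial>M) \<longlonglongrightarrow> (\<integral>\<omega>. 0 \<partial>M)"
  proof (rule integral_dominated_convergence[where w=f])
    show "AE \<omega> in M. (\<lambda>n. indicator (S n) \<omega> * f \<omega>) \<longlonglongrightarrow> 0"
    proof (rule AE_I2)
      fix \<omega>
      have "\<forall>\<^sub>F n in sequentially. norm (exit_pos \<omega>) \<le> real n"
        by (metis eventually_sequentiallyI le_nat_iff nat_ceiling_le_eq of_nat_le_iff order_trans real_nat_ceiling_ge)
      then have "\<forall>\<^sub>F n in sequentially. indicator (S n) \<omega> * f \<omega> = 0"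
        by eventually_elim (simp add: S_def)
      then show "(\<lambda>n. indicator (S n) \<omega> * f \<omega>) \<longlonglongrightarrow> 0" by (rule tendsto_eventually)
    qed
    show "AE \<omega> in M. norm (indicator (S n) \<omega> * f \<omega>) \<le> f \<omega>" for n
      by (intro AE_I2) (auto simp: f_def indicator_def)
  qed (use f in auto)
  then have lim: "(\<lambda>n. \<integral>\<omega>. indicator (S n) \<omega> * f \<omega> \<partial>M) \<longlonglongrightarrow> 0" by simp
  have "c \<le> (\<integral>\<omega>. indicator (S n) \<omega> * f \<omega> \<partial>M)" if n: "real n \<ge> t0" for n
  proof -
    have "c = c * exp (- bc * real n powr p) * exp (bc * real n powr p)"
      by (simp add: exp_minus)
    also have "\<dots> \<le> prob (S n) * exp (bc * real n powr p)"
      unfolding S_def using lower(2)[OF n] by (intro mult_right_mono) auto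
    also have "\<dots> = (\<integral>\<omega>. indicator (S n) \<omega> * exp (bc * real n powr p) \<partial>M)" by simp
    also have "\<dots> \<le> (\<integral>\<omega>. indicator (S n) \<omega> * f \<omega> \<partial>M)"
    proof (rule integral_mono)
      show "integrable M (\<lambda>\<omega>. indicator (S n) \<omega> * f \<omega>)"
        using f by (rule Bochner_Integration.integrable_bound) (auto simp: f_def indicator_def)
      show "integrable M (\<lambda>\<omega>. indicator (S n) \<omega> * exp (bc * real n powr p))"
        by (rule integrable_const_bound[where B="exp (bc * real n powr p)"]) (auto simp: indicator_def)
      show "indicator (S n) \<omega> * exp (bc * real n powr p) \<le> indicator (S n) \<omega> * f \<omega>" for \<omega>
        using bc(1) p by (auto simp: f_def S_def indicator_def intro!: mult_left_mono powr_mono2)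
    qed
    finally show ?thesis .
  qed
  moreover obtain N :: nat where "t0 \<le> real N" using real_arch_simple by blast
  ultimately have "\<And>n. n \<ge> N \<Longrightarrow> c \<le> (\<integral>\<omega>. indicator (S n) \<omega> * f \<omega> \<partial>M)"
    by (metis of_nat_le_iff order_trans)
  then have "c \<le> 0" by (intro LIMSEQ_le_const[OF lim]) auto
  then show False using lower(1) by simp
qed

lemma exponential_moment_mono:
  assumes "\<And>y. 0 \<le> y \<Longrightarrow> b * y powr a \<le> b' * y powr a' + K"
    and fin: "(\<integral>\<^sup>+ \<omega>. ennreal (exp (b' * norm (exit_pos \<omega>) powr a')) \<partial>M) < \<infinity>"
  shows "(\<integral>\<^sup>+ \<omega>. ennreal (exp (b * norm (exit_pos \<omega>) powr a)) \<partial>M) < \<infinity>"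
proof -
  have "(\<integral>\<^sup>+ \<omega>. ennreal (exp (b * norm (exit_pos \<omega>) powr a)) \<partial>M)
      \<le> (\<integral>\<^sup>+ \<omega>. ennreal (exp K) * ennreal (exp (b' * norm (exit_pos \<omega>) powr a')) \<partial>M)"
    using assms(1) by (intro nn_integral_mono) (auto simp: add.commute simp flip: ennreal_mult exp_add intro!: ennreal_leI)
  also have "\<dots> = ennreal (exp K) * (\<integral>\<^sup>+ \<omega>. ennreal (exp (b' * norm (exit_pos \<omega>) powr a')) \<partial>M)"
    by (rule nn_integral_cmult) measurable
  also have "\<dots> < \<infinity>" using fin by (simp add: ennreal_mult_less_top)
  finally show ?thesis .
qed

end

theorem theorem2:
  fixes \<alpha> A :: real
    and z :: "real \<times> real"
    and M :: "'w measure"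
    and B :: "real \<Rightarrow> 'w \<Rightarrow> real \<times> real"
  assumes "0 < \<alpha>" and "\<alpha> < 1" and "A > 0"
    and "z \<in> parabola_domain A \<alpha>"
    and "planar_brownian_motion M B z"
  defines "X \<equiv> exit_position B (parabola_domain A \<alpha>)"
  shows "((\<lambda>t::real. t powr (\<alpha> - 1) * ln (measure M {\<omega> \<in> space M. norm (X \<omega>) > t}))
            \<longlongrightarrow> - (pi / (2 * A * (1 - \<alpha>)))) at_top \<and>
         (\<forall>b::real. (\<integral>\<^sup>+ \<omega>. ennreal (exp (b * norm (X \<omega>) powr (1 - \<alpha>))) \<partial>M) < \<infinity> \<longleftrightarrow>
            b < pi / (2 * A * (1 - \<alpha>))) \<and>
         (\<forall>a::real. a > 0 \<longrightarrow>
            (a < 1 - \<alpha> \<longrightarrow>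
              (\<forall>b::real. b > 0 \<longrightarrow> (\<integral>\<^sup>+ \<omega>. ennreal (exp (b * norm (X \<omega>) powr a)) \<partial>M) < \<infinity>)) \<and>
            (a > 1 - \<alpha> \<longrightarrow>
              (\<forall>b::real. b > 0 \<longrightarrow> (\<integral>\<^sup>+ \<omega>. ennreal (exp (b * norm (X \<omega>) powr a)) \<partial>M) = \<infinity>)))"
proof -
  interpret parabola_exit M B z \<alpha> A
    using assms by (intro parabola_exit.intro parabola_exit_axioms.intro)
  have X: "X = exit_pos" by (simp add: X_def exit_pos_def)
  have constants: "1 - \<alpha> = p" "pi / (2 * A * p) = bc" by (simp_all add: p_def bc_def)
  obtain c t0 where lower: "c > 0"
    "\<And>t. t \<ge> t0 \<Longrightarrow> c * exp (- bc * t powr p) \<le> prob {\<omega>\<in>space M. norm (exit_pos \<omega>) > t}"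
    using lower_tail by blast
  note crit = critical_moment_infinite[OF lower]
  have "b < bc" if "(\<integral>\<^sup>+ \<omega>. ennreal (exp (b * norm (exit_pos \<omega>) powr p)) \<partial>M) < \<infinity>" for b
  proof (rule ccontr)
    assume "\<not> b < bc"
    \<comment> \<open>Reduction to the critical case; the comparison needs no additive
      constant.\<close>
    then have "bc * y powr p \<le> b * y powr p + 0" for y
      by (simp add: mult_right_mono)
    then show False using exponential_moment_mono[of bc p b p 0] that crit by simp
  qed
  moreover have "(\<integral>\<^sup>+ \<omega>. ennreal (exp (b * norm (exit_pos \<omega>) powr a)) \<partial>M) < \<infinity>"
    if ab: "0 < a" "a < p" "0 < b" for a b
  proof -
    \<comment> \<open>Any rate strictly between 0 and \<open>bc\<close> would serve here.\<close>
    have "0 < bc / 2" using bc(1) by simp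
    then obtain K where "\<And>y. 0 \<le> y \<Longrightarrow> b * y powr a \<le> bc / 2 * y powr p + K"
      using powr_dominated[OF ab \<open>0 < bc / 2\<close>] by blast
    moreover have "(\<integral>\<^sup>+ \<omega>. ennreal (exp (bc / 2 * norm (exit_pos \<omega>) powr p)) \<partial>M) < \<infinity>"
      using bc(1) by (intro exponential_moment_finite) simp
    ultimately show ?thesis by (rule exponential_moment_mono)
  qed
  moreover have "(\<integral>\<^sup>+ \<omega>. ennreal (exp (b * norm (exit_pos \<omega>) powr a)) \<partial>M) = \<infinity>"
    if ab: "p < a" "0 < b" for a b
  proof (rule ccontr)
    assume "\<not> ?thesis"
    then have fin: "(\<integral>\<^sup>+ \<omega>. ennreal (exp (b * norm (exit_pos \<omega>) powr a)) \<partial>M) < \<infinity>"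
      by (simp add: less_top)
    \<comment> \<open>The comparison now runs the other way: a finite moment with exponent
      \<open>a\<close> would bound the critical one.\<close>
    obtain K where "\<And>y. 0 \<le> y \<Longrightarrow> bc * y powr p \<le> b * y powr a + K"
      using powr_dominated[OF p(1) ab(1) bc(1) ab(2)] by blast
    then show False using exponential_moment_mono[OF _ fin] crit by fastforce
  qed
  ultimately show ?thesis
    unfolding X constants using log_tail[OF lower] exponential_moment_finite by blast
qed

end
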